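(* Let $F_{17}:=(6,\{01,03,13,45\})$. Then $\lambda_{F_{17}}=40/81$. Furthermore, the $F_{17}$-problem is perfectly $B$-stable with $B:=(3,\{00,11,22\})$, and the unique (up to automorphisms of $B$) maximiser of $p(F_{17},B(\boldsymbol x))$ over $\boldsymbol x\in\mathbb S_3$ is $\boldsymbol x=(1/3,1/3,1/3)$.
   Context: All graphs are finite and simple. $(m,E)$ denotes the graph or pattern with vertex set $\{0,\dots,m-1\}$ and edge set $E$; $ij$ abbreviates $\{i,j\}$ ($ii$ is a loop). For graphs $F,G$ with $\kappa\le n$ vertices, $p(F,G)$ is the number of $\kappa$-subsets of $V(G)$ inducing a subgraph isomorphic to $F$, divided by $\binom n\kappa$; $p(F,n)$ is the maximum of $p(F,G)$ over $n$-vertex graphs $G$; $\lambda_F=\lim_{n\to\infty}p(F,n)$ (the limit exists). A pattern is a graph in which loops are allowed; its automorphisms are the bijections of the vertex set preserving edges, non-edges, loops and non-loops. For a pattern $B$ on $\{0,\dots,m-1\}$ and disjoint (possibly empty) sets $V_0,\dots,V_{m-1}$, the blowup $B(V_0,\dots,V_{m-1})$ is the simple graph on $\bigcup V_i$ in which distinct $x\in V_i$, $y\in V_j$ are adjacent iff $\{i,j\}\in E(B)$ (so $V_i$ is a clique if $i$ has a loop and independent otherwise); $B()$ is the family of all blowups. $\mathbb S_m=\{\boldsymbol x\in\mathbb R^m:x_i\ge0,\sum x_i=1\}$, and $p(F,B(\boldsymbol x))$ is the limit as $n\to\infty$ of $p(F,B(V_0,\dots,V_{m-1}))$ with $|V_i|=(x_i+o(1))n$.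 $\delta_{\mathrm{edit}}(G,B())$ is the minimum number of vertex pairs whose adjacency must be changed to turn $G$ into a graph isomorphic to a blowup of $B$ (of the same order). The $F$-problem is perfectly $B$-stable if there is $C>0$ such that every graph $G$ with $n\ge C$ vertices satisfies $\delta_{\mathrm{edit}}(G,B())\le C\,(p(F,n)-p(F,G))\,n^2$. *)

theory Defs
  imports Complex_Main "HOL-Library.FuncSet" "HOL-Library.Ramsey" "HOL-Library.Disjoint_Sets"
begin

text \<open>Graphs and patterns are pairs of a vertex set and a set of edges. An edge between
  \<open>i\<close> and \<open>j\<close> is the set \<open>{i, j}\<close>; in a pattern, a loop at \<open>i\<close> is the singleton \<open>{i}\<close>.\<close>

type_synonym 'a graph = "'a set \<times> 'a set set"

abbreviation verts :: "'a graph \<Rightarrow> 'a set" where "verts \<equiv> fst"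

abbreviation edges :: "'a graph \<Rightarrow> 'a set set" where "edges \<equiv> snd"

definition simple_graph :: "'a graph \<Rightarrow> bool" where
  "simple_graph G \<longleftrightarrow> finite (verts G) \<and> edges G \<subseteq> nsets (verts G) 2"

definition is_iso :: "('a \<Rightarrow> 'b) \<Rightarrow> 'a graph \<Rightarrow> 'b graph \<Rightarrow> bool" where
  "is_iso f G H \<longleftrightarrow> bij_betw f (verts G) (verts H) \<and>
     (\<forall>x\<in>verts G. \<forall>y\<in>verts G. {x, y} \<in> edges G \<longleftrightarrow> {f x, f y} \<in> edges H)"

definition isomorphic :: "'a graph \<Rightarrow> 'b graph \<Rightarrow> bool" where
  "isomorphic G H \<longleftrightarrow> (\<exists>f. is_iso f G H)"

text \<open>The case \<open>x = y\<close> in \<open>is_iso\<close> makes automorphisms of patterns preserve loops and non-loops.\<close>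

definition automorphisms :: "'a graph \<Rightarrow> ('a \<Rightarrow> 'a) set" where
  "automorphisms B = {\<pi>. is_iso \<pi> B B}"

definition induced :: "'a graph \<Rightarrow> 'a set \<Rightarrow> 'a graph" where
  "induced G S = (S, {e \<in> edges G. e \<subseteq> S})"

definition density :: "'a graph \<Rightarrow> 'b graph \<Rightarrow> real" where
  "density F G =
     real (card {S \<in> nsets (verts G) (card (verts F)). isomorphic (induced G S) F}) /
     real (card (verts G) choose card (verts F))"

text \<open>Every finite graph is isomorphic to one whose vertices are natural numbers, so ``all graphs''
  is rendered as all finite simple graphs on natural numbers.\<close>

definition max_density :: "'a graph \<Rightarrow> nat \<Rightarrow> real" where
  "max_density F n = Max {density F G | G :: nat graph. simple_graph G \<and> card (verts G) = n}"

definition inducibility :: "'a graph \<Rightarrow> real" where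
  "inducibility F = lim (max_density F)"

definition blowup :: "'b graph \<Rightarrow> ('b \<Rightarrow> 'a set) \<Rightarrow> 'a graph" where
  "blowup B V =
     (\<Union>i\<in>verts B. V i,
      {{x, y} | x y i j. i \<in> verts B \<and> j \<in> verts B \<and> x \<in> V i \<and> y \<in> V j \<and> x \<noteq> y \<and> {i, j} \<in> edges B})"

definition blowup_parts :: "'b graph \<Rightarrow> ('b \<Rightarrow> 'a set) \<Rightarrow> bool" where
  "blowup_parts B V \<longleftrightarrow> disjoint_family_on V (verts B) \<and> (\<forall>i\<in>verts B. finite (V i))"

definition blowups :: "'b graph \<Rightarrow> nat graph set" where
  "blowups B = {blowup B V | V. blowup_parts B V}"

definition edit_distance :: "nat graph \<Rightarrow> nat graph set \<Rightarrow> nat" where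
  "edit_distance G \<H> = (LEAST k. \<exists>E. E \<subseteq> nsets (verts G) 2 \<and> (\<exists>H\<in>\<H>. isomorphic (verts G, E) H) \<and>
     k = card ((edges G - E) \<union> (E - edges G)))"

definition perfectly_stable :: "'a graph \<Rightarrow> 'b graph \<Rightarrow> bool" where
  "perfectly_stable F B \<longleftrightarrow> (\<exists>C::real. C > 0 \<and>
     (\<forall>G :: nat graph. simple_graph G \<and> real (card (verts G)) \<ge> C \<longrightarrow>
        real (edit_distance G (blowups B))
          \<le> C * (max_density F (card (verts G)) - density F G) * real (card (verts G)) ^ 2))"

text \<open>Points of \<open>\<real>\<^sup>I\<close> are extensional functions, so that equality of points is equality on \<open>I\<close>.\<close>

definition std_simplex :: "'i set \<Rightarrow> ('i \<Rightarrow> real) set" where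
  "std_simplex I = {x \<in> I \<rightarrow>\<^sub>E {0..}. (\<Sum>i\<in>I. x i) = 1}"

text \<open>\<open>L\<close> is the common limit along all sequences of blowups with part sizes \<open>(x\<^sub>i + o(1)) n\<close>.\<close>

definition has_blowup_density :: "'a graph \<Rightarrow> 'b graph \<Rightarrow> ('b \<Rightarrow> real) \<Rightarrow> real \<Rightarrow> bool" where
  "has_blowup_density F B x L \<longleftrightarrow>
     (\<forall>V :: nat \<Rightarrow> 'b \<Rightarrow> nat set.
        (\<forall>n. blowup_parts B (V n)) \<and>
        (\<forall>i\<in>verts B. (\<lambda>n. real (card (V n i)) / real n) \<longlonglongrightarrow> x i) \<longrightarrow>
        (\<lambda>n. density F (blowup B (V n))) \<longlonglongrightarrow> L)"

definition blowup_density :: "'a graph \<Rightarrow> 'b graph \<Rightarrow> ('b \<Rightarrow> real) \<Rightarrow> real" where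
  "blowup_density F B x = (THE L. has_blowup_density F B x L)"

definition blowup_maximiser :: "'a graph \<Rightarrow> 'b graph \<Rightarrow> ('b \<Rightarrow> real) \<Rightarrow> bool" where
  "blowup_maximiser F B = is_arg_max (blowup_density F B) (\<lambda>x. x \<in> std_simplex (verts B))"

definition unique_blowup_maximiser :: "'a graph \<Rightarrow> 'b graph \<Rightarrow> ('b \<Rightarrow> real) \<Rightarrow> bool" where
  "unique_blowup_maximiser F B x \<longleftrightarrow> blowup_maximiser F B x \<and>
     (\<forall>y. blowup_maximiser F B y \<longrightarrow> (\<exists>\<pi>\<in>automorphisms B. \<forall>i\<in>verts B. y i = x (\<pi> i)))"

definition F17 :: "nat graph" where
  "F17 = ({..<6}, {{0, 1}, {0, 3}, {1, 3}, {4, 5}})"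

definition B17 :: "nat graph" where
  "B17 = ({..<3}, {{0, 0}, {1, 1}, {2, 2}})"

end

theory Submission
  imports Defs
begin

text \<open>Up to complementation, \<open>F17\<close> is the complete multipartite graph with parts of size 3, 2 and 1, and Zykov
symmetrisation applies: if \<open>u\<close> and \<open>v\<close> are adjacent, then turning \<open>u\<close> into a twin of \<open>v\<close>, or \<open>v\<close> into
a twin of \<open>u\<close>, does not decrease the number of copies of \<open>F17\<close>, since a copy containing both has them in one
component (\<open>homs_clone_average\<close>). Hence some disjoint union of cliques is extremal up to lower order. For a union
of cliques the count is a symmetric polynomial in the clique sizes. Merging the two smallest of at least four cliques
increases it (\<open>distinct_sum_merge\<close>), and for three cliques it is at most \<open>2/243 n\<^sup>6\<close> labelled copies, with a deficit
quadratic in the distance from equal sizes (\<open>three_part_stability\<close>). As \<open>F17\<close> has 12 automorphisms, this is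
density \<open>40/81\<close>, and it also gives the unique maximiser over the simplex.

Perfect stability asks for a number of lost copies that is linear in the edit distance, with the exact maximum as
reference. It is proved by comparing any graph with a better one, never by computing the maximum. Close to
three balanced cliques there are two comparisons (\<open>local_stability\<close>). A vertex with many wrong adjacencies takes part
in fewer copies, by order \<open>n\<^sup>5\<close>, than one joined to exactly one clique (\<open>attach_le\<close>), so it can be rewired. If every
vertex has few wrong adjacencies, then correcting them all gains order \<open>n\<^sup>4\<close> copies per wrong pair, while a copy using
a wrong pair uses at least two of them (\<open>no_single_mismatch\<close>), and such copies are negligible (\<open>flat_gain\<close>).

An almost extremal graph that is not close to three cliques is excluded by continuity (\<open>stability\<close>): symmetrisation
and merging move it towards three cliques in steps of small edit distance without decreasing the count, so
they pass through a graph at a distance where the local result applies but already forces a substantial loss. The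
only steps that are not small merge two large cliques, and these gain a positive proportion of all copies.\<close>

section \<open>Placements of the six-vertex graph\<close>

text \<open>The graph \<open>F17\<close> is a disjoint union of a triangle, an edge and a vertex; \<open>component\<close> names these as
\<open>0\<close>, \<open>1\<close> and \<open>2\<close>. Two vertices of \<open>F17\<close> are equal or adjacent iff they lie in the same component.\<close>

definition component :: "nat \<Rightarrow> nat" where
  "component p = (if p = 2 then 2 else if p \<ge> 4 then 1 else 0)"

abbreviation (input) maps :: "'a set \<Rightarrow> (nat \<Rightarrow> 'a) set" where
  "maps V \<equiv> {..<6} \<rightarrow>\<^sub>E V"

text \<open>Throughout, \<open>R x y\<close> reads ``\<open>x\<close> and \<open>y\<close> are equal or adjacent'', so that a graph is a reflexive
symmetric relation and a disjoint union of cliques is an equivalence relation. A map in \<open>homs\<close> may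
collapse vertices of one component. This makes the count in a union of cliques an exact polynomial in the sizes of
the cliques, while \<open>embs\<close>, the labelled induced copies, are fewer by \<open>O(n\<^sup>5)\<close> only.\<close>

definition homs :: "'a set \<Rightarrow> ('a \<Rightarrow> 'a \<Rightarrow> bool) \<Rightarrow> (nat \<Rightarrow> 'a) set" where
  "homs V R = {f \<in> maps V. \<forall>p<6. \<forall>q<6. R (f p) (f q) \<longleftrightarrow> component p = component q}"

definition embs :: "'a set \<Rightarrow> ('a \<Rightarrow> 'a \<Rightarrow> bool) \<Rightarrow> (nat \<Rightarrow> 'a) set" where
  "embs V R = {f \<in> homs V R. inj_on f {..<6}}"

abbreviation (input) same :: "('a \<Rightarrow> 'b) \<Rightarrow> 'a \<Rightarrow> 'a \<Rightarrow> bool" where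
  "same \<phi> \<equiv> (\<lambda>x y. \<phi> x = \<phi> y)"

text \<open>The pairs are ordered, so every edit is counted twice. Parts of \<open>\<phi>\<close> may be empty: \<open>dist3\<close> measures the
distance to a union of at most three cliques.\<close>

definition mismatches :: "'a set \<Rightarrow> ('a \<Rightarrow> 'a \<Rightarrow> bool) \<Rightarrow> ('a \<Rightarrow> nat) \<Rightarrow> ('a \<times> 'a) set" where
  "mismatches V R \<phi> = {(x, y) \<in> V \<times> V. R x y \<noteq> same \<phi> x y}"

definition dist3 :: "'a set \<Rightarrow> ('a \<Rightarrow> 'a \<Rightarrow> bool) \<Rightarrow> nat" where
  "dist3 V R = (LEAST k. \<exists>\<phi>\<in>V \<rightarrow> {..<3}. k = card (mismatches V R \<phi>))"

lemma less6: "{..<6::nat} = {0, 1, 2, 3, 4, 5}"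
  by auto

lemma all_less6: "(\<forall>p<6::nat. P p) \<longleftrightarrow> P 0 \<and> P 1 \<and> P 2 \<and> P 3 \<and> P 4 \<and> P 5"
proof -
  have "(\<forall>p<6::nat. P p) \<longleftrightarrow> (\<forall>p\<in>{..<6}. P p)" by auto
  then show ?thesis unfolding less6 by simp
qed

section \<open>Counting maps with few free values\<close>

lemma card_funs_le:
  fixes \<Omega> :: "('i \<Rightarrow> 'a) set"
  assumes "finite V" "finite I" "distinct ps" "set ps \<subseteq> I" "finite X"
    and \<Omega>: "\<Omega> \<subseteq> {f \<in> I \<rightarrow>\<^sub>E V. map f ps \<in> X}"
  shows "card \<Omega> \<le> card X * card V ^ (card I - length ps)"
proof -
  let ?J = "I - set ps"
  let ?g = "\<lambda>f. (map f ps, restrict f ?J)"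
  have inj: "inj_on ?g \<Omega>"
  proof (rule inj_onI)
    fix f h assume f: "f \<in> \<Omega>" and h: "h \<in> \<Omega>" and e: "?g f = ?g h"
    have fh: "f \<in> I \<rightarrow>\<^sub>E V" "h \<in> I \<rightarrow>\<^sub>E V" using f h \<Omega> by auto
    show "f = h"
    proof (rule PiE_ext[OF fh])
      fix i assume i: "i \<in> I"
      show "f i = h i"
      proof (cases "i \<in> set ps")
        case True then show ?thesis using e by auto
      next
        case False then have "i \<in> ?J" using i by auto
        then show ?thesis using e by (metis Pair_inject restrict_apply)
      qed
    qed
  qed
  have sub: "?g ` \<Omega> \<subseteq> X \<times> (?J \<rightarrow>\<^sub>E V)"
    using \<Omega> by (fastforce simp: PiE_iff)
  have fin: "finite (X \<times> (?J \<rightarrow>\<^sub>E V))"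
    using assms by (simp add: finite_PiE)
  have "card \<Omega> = card (?g ` \<Omega>)" using card_image[OF inj] by simp
  also have "\<dots> \<le> card (X \<times> (?J \<rightarrow>\<^sub>E V))" by (rule card_mono[OF fin sub])
  also have "\<dots> = card X * card V ^ (card I - length ps)"
    using assms by (simp add: card_cartesian_product card_PiE card_Diff_subset distinct_card)
  finally show ?thesis .
qed

lemma finite_homs: "finite V \<Longrightarrow> finite (homs V R)"
  unfolding homs_def by (rule finite_subset[of _ "maps V"]) (auto intro: finite_PiE)

lemma embs_subset_homs: "embs V R \<subseteq> homs V R"
  by (auto simp: embs_def)

lemma finite_embs: "finite V \<Longrightarrow> finite (embs V R)"
  using finite_homs embs_subset_homs finite_subset by metis

lemma card_le_by_cover:
  assumes "finite J" "card J \<le> k" "\<Omega> \<subseteq> (\<Union>j\<in>J. A j)"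
    and A: "\<And>j. j \<in> J \<Longrightarrow> finite (A j)" "\<And>j. j \<in> J \<Longrightarrow> card (A j) \<le> m"
  shows "card \<Omega> \<le> k * m"
proof -
  have "card \<Omega> \<le> card (\<Union>j\<in>J. A j)" using assms by (intro card_mono) auto
  also have "\<dots> \<le> (\<Sum>j\<in>J. card (A j))" using assms by (intro card_UN_le)
  also have "\<dots> \<le> card J * m" using sum_bounded_above[of J "\<lambda>j. card (A j)" m] A by simp
  also have "\<dots> \<le> k * m" using assms by simp
  finally show ?thesis .
qed

text \<open>The maps for which the values at some distinct positions form one of the lists in \<open>X\<close>. All error terms
below count such maps: if \<open>X\<close> consists of \<open>m\<close> lists of length \<open>l\<close>, then there are at most \<open>6\<^sup>l\<close> choices of the
positions, and \<open>6 - l\<close> free values.\<close>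

definition confined :: "'a set \<Rightarrow> 'a list set \<Rightarrow> (nat \<Rightarrow> 'a) set" where
  "confined V X = {f \<in> maps V. \<exists>ps. distinct ps \<and> set ps \<subseteq> {..<6} \<and> map f ps \<in> X}"

lemma confinedI: "f \<in> maps V \<Longrightarrow> map f ps \<in> X \<Longrightarrow> distinct ps \<Longrightarrow> set ps \<subseteq> {..<6} \<Longrightarrow> f \<in> confined V X"
  by (auto simp: confined_def)

lemma finite_maps: "finite V \<Longrightarrow> finite (maps V)"
  by (simp add: finite_PiE)

lemma finite_confined: "finite V \<Longrightarrow> finite (confined V X)"
  unfolding confined_def by (rule finite_subset[OF _ finite_maps]) auto

lemma card_confined_le:
  assumes V: "finite V" and X: "finite X" "card X \<le> m" "\<And>xs. xs \<in> X \<Longrightarrow> length xs = l"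
  shows "card (confined V X) \<le> 6 ^ l * (m * card V ^ (6 - l))"
proof (rule card_le_by_cover)
  let ?J = "{ps. set ps \<subseteq> {..<6::nat} \<and> length ps = l \<and> distinct ps}"
  let ?A = "\<lambda>ps. {f \<in> maps V. map f ps \<in> X}"
  have sub: "?J \<subseteq> {ps. set ps \<subseteq> {..<6::nat} \<and> length ps = l}" by auto
  have fin: "finite {ps. set ps \<subseteq> {..<6::nat} \<and> length ps = l}"
    by (rule finite_lists_length_eq) simp
  show "finite ?J" by (rule finite_subset[OF sub fin])
  show "card ?J \<le> 6 ^ l"
    using card_mono[OF fin sub] card_lists_length_eq[of "{..<6::nat}" l] by simp
  show "confined V X \<subseteq> (\<Union>ps\<in>?J. ?A ps)" using X(3) by (fastforce simp: confined_def)
  show "finite (?A ps)" for ps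
    by (rule finite_subset[OF _ finite_maps[OF V]]) auto
  show "card (?A ps) \<le> m * card V ^ (6 - l)" if "ps \<in> ?J" for ps
  proof -
    have "card (?A ps) \<le> card X * card V ^ (card {..<6::nat} - length ps)"
      by (rule card_funs_le) (use that V X in auto)
    also have "\<dots> \<le> m * card V ^ (6 - l)" using that X by (auto intro: mult_right_mono)
    finally show ?thesis .
  qed
qed

lemma card_noninj:
  assumes V: "finite V"
  shows "card {f \<in> maps V. \<not> inj_on f {..<6}} \<le> 36 * card V ^ 5"
proof -
  let ?X = "(\<lambda>x. [x, x]) ` V"
  have "{f \<in> maps V. \<not> inj_on f {..<6}} \<subseteq> confined V ?X"
  proof
    fix f assume f: "f \<in> {f \<in> maps V. \<not> inj_on f {..<6}}"
    then obtain p q where pq: "p < 6" "q < 6" "p \<noteq> q" "f p = f q" by (auto simp: inj_on_def)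
    have "f p \<in> V" using f pq by auto
    then show "f \<in> confined V ?X" using f pq by (intro confinedI[of _ _ "[p, q]"]) auto
  qed
  then have "card {f \<in> maps V. \<not> inj_on f {..<6}} \<le> card (confined V ?X)"
    by (rule card_mono[OF finite_confined[OF V]])
  also have "\<dots> \<le> 6 ^ 2 * (card V * card V ^ (6 - 2))"
    by (rule card_confined_le) (use V card_image_le in auto)
  finally show ?thesis by (simp add: eval_nat_numeral)
qed

lemma homs_le_embs:
  assumes V: "finite V"
  shows "card (homs V R) \<le> card (embs V R) + 36 * card V ^ 5"
proof -
  have "homs V R \<subseteq> embs V R \<union> {f \<in> maps V. \<not> inj_on f {..<6}}"
    by (auto simp: embs_def homs_def)
  then have "card (homs V R) \<le> card (embs V R \<union> {f \<in> maps V. \<not> inj_on f {..<6}})"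
    by (intro card_mono) (auto intro!: finite_embs V finite_subset[of _ "maps V"] finite_PiE)
  also have "\<dots> \<le> card (embs V R) + card {f \<in> maps V. \<not> inj_on f {..<6}}"
    by (rule card_Un_le)
  finally show ?thesis using card_noninj[OF V] by linarith
qed

lemma embs_le_homs: "finite V \<Longrightarrow> card (embs V R) \<le> card (homs V R)"
  by (intro card_mono finite_homs embs_subset_homs)

lemma card_homs_le: "finite V \<Longrightarrow> card (homs V R) \<le> card V ^ 6"
proof -
  assume V: "finite V"
  have "card (homs V R) \<le> card (maps V)"
    by (rule card_mono) (auto simp: homs_def intro!: finite_PiE V)
  then show ?thesis by (simp add: card_PiE)
qed

lemma homs_cong:
  assumes "\<And>x y. x \<in> V \<Longrightarrow> y \<in> V \<Longrightarrow> R x y = R' x y"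
  shows "homs V R = homs V R'"
proof -
  have "R (f p) (f q) = R' (f p) (f q)" if "f \<in> maps V" "p < 6" "q < 6" for f p q
    using that by (intro assms) (auto simp: PiE_iff)
  then show ?thesis by (auto simp: homs_def)
qed

lemma embs_cong:
  assumes "\<And>x y. x \<in> V \<Longrightarrow> y \<in> V \<Longrightarrow> R x y = R' x y"
  shows "embs V R = embs V R'"
  using homs_cong[of V R R'] assms by (simp add: embs_def)

section \<open>Distance to three cliques\<close>

lemma finite_mismatches: "finite V \<Longrightarrow> finite (mismatches V R \<phi>)"
  unfolding mismatches_def by (rule finite_subset[of _ "V \<times> V"]) auto

lemma dist3_le: "\<phi> \<in> V \<rightarrow> {..<3} \<Longrightarrow> dist3 V R \<le> card (mismatches V R \<phi>)"
  unfolding dist3_def by (rule Least_le) auto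

lemma dist3_attained:
  obtains \<phi> where "\<phi> \<in> V \<rightarrow> {..<3}" "card (mismatches V R \<phi>) = dist3 V R"
proof -
  have "\<exists>k. \<exists>\<phi>\<in>V \<rightarrow> {..<3}. k = card (mismatches V R \<phi>)"
    by (intro exI bexI[of _ "\<lambda>_. 0"]) auto
  from LeastI_ex[OF this] show ?thesis using that unfolding dist3_def by metis
qed

lemma dist3_le_square: "finite V \<Longrightarrow> dist3 V R \<le> card V ^ 2"
proof -
  assume V: "finite V"
  have "dist3 V R \<le> card (mismatches V R (\<lambda>_. 0))" by (rule dist3_le) auto
  also have "\<dots> \<le> card (V \<times> V)" by (rule card_mono) (auto simp: mismatches_def V)
  finally show ?thesis by (simp add: card_cartesian_product power2_eq_square)
qed

text \<open>This makes the steps of symmetrisation and merging short: they rewire one vertex or one small clique.\<close>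

lemma dist3_diff:
  assumes V: "finite V" and W: "W \<subseteq> V"
    and eq: "\<And>x y. x \<in> V - W \<Longrightarrow> y \<in> V - W \<Longrightarrow> R x y = R' x y"
  shows "dist3 V R \<le> dist3 V R' + 2 * card W * card V"
proof -
  obtain \<phi> where \<phi>: "\<phi> \<in> V \<rightarrow> {..<3}" "card (mismatches V R' \<phi>) = dist3 V R'"
    by (rule dist3_attained)
  have "mismatches V R \<phi> \<subseteq> mismatches V R' \<phi> \<union> (W \<times> V \<union> V \<times> W)"
    using eq by (auto simp: mismatches_def)
  then have "card (mismatches V R \<phi>) \<le> card (mismatches V R' \<phi> \<union> (W \<times> V \<union> V \<times> W))"
    using V finite_subset[OF W V] by (intro card_mono) (auto simp: finite_mismatches)
  also have "\<dots> \<le> card (mismatches V R' \<phi>) + (card (W \<times> V) + card (V \<times> W))"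
    using card_Un_le[of "mismatches V R' \<phi>" "W \<times> V \<union> V \<times> W"] card_Un_le[of "W \<times> V" "V \<times> W"]
    by linarith
  also have "\<dots> = dist3 V R' + 2 * card W * card V"
    by (simp add: \<phi> card_cartesian_product)
  finally show ?thesis using dist3_le[OF \<phi>(1), of R] by linarith
qed

section \<open>The polynomial of a union of cliques\<close>

text \<open>With \<open>c i\<close> the size of the clique \<open>i\<close>, this counts the placements of the triangle, the edge and the
vertex of \<open>F17\<close> into three different cliques.\<close>

definition distinct_sum :: "'i set \<Rightarrow> ('i \<Rightarrow> real) \<Rightarrow> real" where
  "distinct_sum I c = (\<Sum>i\<in>I. \<Sum>j\<in>I - {i}. \<Sum>k\<in>I - {i, j}. c i ^ 3 * c j ^ 2 * c k)"

text \<open>Written in power sums, the effect of changing two of the sizes becomes a polynomial identity.\<close>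

lemma distinct_sum_power_sums:
  fixes c :: "'i \<Rightarrow> real"
  assumes I: "finite I"
  defines "p \<equiv> \<lambda>m. \<Sum>i\<in>I. c i ^ m"
  shows "distinct_sum I c = p 3 * p 2 * p 1 - p 5 * p 1 - p 4 * p 2 - p 3 ^ 2 + 2 * p 6"
proof -
  have inner: "(\<Sum>k\<in>I - {i, j}. c k) = p 1 - c i - c j" if "i \<in> I" "j \<in> I - {i}" for i j
  proof -
    have "sum c {i, j} = c i + c j" using that by auto
    then show ?thesis using that I by (simp add: p_def sum_diff)
  qed
  have mid: "(\<Sum>j\<in>I - {i}. \<Sum>k\<in>I - {i, j}. c i ^ 3 * c j ^ 2 * c k)
      = c i ^ 3 * (p 2 * p 1 - c i * p 2 - p 3 - c i ^ 2 * p 1 + 2 * c i ^ 3)" if i: "i \<in> I" for i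
  proof -
    have "(\<Sum>j\<in>I - {i}. \<Sum>k\<in>I - {i, j}. c i ^ 3 * c j ^ 2 * c k)
        = (\<Sum>j\<in>I - {i}. c i ^ 3 * c j ^ 2 * (p 1 - c i - c j))"
      by (rule sum.cong[OF refl]) (simp add: inner[OF i] flip: sum_distrib_left)
    also have "\<dots> = (\<Sum>j\<in>I. c i ^ 3 * c j ^ 2 * (p 1 - c i - c j)) - c i ^ 3 * c i ^ 2 * (p 1 - c i - c i)"
      using i I by (simp add: sum_diff1)
    also have "(\<Sum>j\<in>I. c i ^ 3 * c j ^ 2 * (p 1 - c i - c j))
        = (\<Sum>j\<in>I. (c i ^ 3 * (p 1 - c i)) * c j ^ 2 - c i ^ 3 * c j ^ 3)"
      by (rule sum.cong[OF refl]) algebra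
    also have "\<dots> = (c i ^ 3 * (p 1 - c i)) * p 2 - c i ^ 3 * p 3"
      unfolding sum_subtractf p_def by (simp flip: sum_distrib_left)
    finally show ?thesis by (simp add: algebra_simps eval_nat_numeral)
  qed
  have "distinct_sum I c = (\<Sum>i\<in>I. c i ^ 3 * (p 2 * p 1 - c i * p 2 - p 3 - c i ^ 2 * p 1 + 2 * c i ^ 3))"
    unfolding distinct_sum_def by (rule sum.cong[OF refl]) (rule mid)
  also have "\<dots> = (\<Sum>i\<in>I. (p 2 * p 1 - p 3) * c i ^ 3 - p 2 * c i ^ 4 - p 1 * c i ^ 5 + 2 * c i ^ 6)"
    by (rule sum.cong[OF refl]) algebra
  also have "\<dots> = (p 2 * p 1 - p 3) * p 3 - p 2 * p 4 - p 1 * p 5 + 2 * p 6"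
    by (simp add: p_def sum.distrib sum_subtractf flip: sum_distrib_left)
  finally show ?thesis by (simp add: algebra_simps power2_eq_square)
qed

text \<open>Merging the two smallest of at least four cliques gains. With \<open>s\<close> and \<open>q\<close> the sum and the product of
the two sizes and \<open>r m\<close> the power sums of the others, the change is \<open>q * D\<close> for the \<open>D\<close> below. Every
other size is at least \<open>s / 2\<close>, and there are at least two others; hence the lost placements,
counted by the negative terms of \<open>D\<close>, are outweighed by those in which one component goes into the merged
clique and the other two into two other cliques.\<close>

lemma distinct_sum_merge:
  fixes c :: "'i \<Rightarrow> real"
  assumes I: "finite I" and ij: "i \<in> I" "j \<in> I" "i \<noteq> j"
    and pos: "c i \<ge> 0" "c j \<ge> 0"
    and rest: "\<And>k. k \<in> I - {i, j} \<Longrightarrow> c i \<le> c k \<and> c j \<le> c k"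
    and two: "card I \<ge> 4"
  shows "distinct_sum I c + c i * c j * (c i + c j)\<^sup>2 / 2 * (\<Sum>k\<in>I - {i, j}. c k ^ 2)
     \<le> distinct_sum (I - {i}) (c(j := c i + c j))"
proof -
  define K where "K = I - {i, j}"
  define r where "r m = (\<Sum>k\<in>K. c k ^ m)" for m :: nat
  define a where "a = c i"
  define b where "b = c j"
  have K: "finite K" "i \<notin> K" "j \<notin> K" using I by (auto simp: K_def)
  have I_eq: "I = insert i (insert j K)" and I'_eq: "I - {i} = insert j K"
    using ij by (auto simp: K_def)
  have P: "(\<Sum>k\<in>I. c k ^ m) = a ^ m + b ^ m + r m" for m
    unfolding I_eq using K ij by (simp add: r_def a_def b_def)
  have P': "(\<Sum>k\<in>I - {i}. (c(j := c i + c j)) k ^ m) = (a + b) ^ m + r m" for m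
  proof -
    have "(\<Sum>k\<in>K. (c(j := c i + c j)) k ^ m) = r m"
      unfolding r_def using K by (intro sum.cong) auto
    then show ?thesis unfolding I'_eq using K ij by (simp add: a_def b_def)
  qed
  define s where "s = a + b"
  define q where "q = a * b"
  define D where "D = 3 * s * (r 1 * r 2 - r 3) + 2 * (r 1 * r 3 - r 4) - s\<^sup>2 * r 2 - s * r 3 - q * (s * r 1 - 2 * r 2)"
  have identity: "distinct_sum (I - {i}) (c(j := c i + c j)) - distinct_sum I c = q * D"
    using I unfolding distinct_sum_power_sums[OF I] distinct_sum_power_sums[OF finite_Diff[OF I]] P P'
      D_def s_def q_def by algebra
  have ab: "a \<ge> 0" "b \<ge> 0" "s \<ge> 0" "q \<ge> 0" using pos by (auto simp: a_def b_def s_def q_def)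
  have big: "s / 2 \<le> c k" if "k \<in> K" for k
    using rest[of k] that by (simp add: K_def a_def b_def s_def)
  have others: "s / 2 \<le> r 1 - c k" if k: "k \<in> K" for k
  proof -
    have "card K \<ge> 2" using two ij I by (simp add: K_def card_Diff_subset)
    then have "K - {k} \<noteq> {}" using k
      by (metis K(1) One_nat_def Suc_1 Suc_n_not_le_n card.empty card_Suc_Diff1)
    then obtain l where l: "l \<in> K" "l \<noteq> k" by auto
    have nn: "c x \<ge> 0" if "x \<in> K" for x using big[OF that] ab by linarith
    have "c l \<le> (\<Sum>x\<in>K - {k}. c x)"
      using l K nn by (intro member_le_sum) auto
    also have "\<dots> = r 1 - c k" using k K by (simp add: r_def sum_diff1)
    finally show ?thesis using big[OF l(1)] by linarith
  qed
  have nn: "c k \<ge> 0" if "k \<in> K" for k using big[OF that] ab by linarith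
  (* r 1 * r 2 - r 3 and r 1 * r 3 - r 4 are sums over ordered pairs of distinct other parts *)
  have e21: "r 1 * r 2 - r 3 \<ge> s / 2 * r 2"
  proof -
    have "s / 2 * r 2 = (\<Sum>k\<in>K. s / 2 * c k ^ 2)" by (simp add: r_def sum_distrib_left)
    also have "\<dots> \<le> (\<Sum>k\<in>K. (r 1 - c k) * c k ^ 2)"
      by (intro sum_mono mult_right_mono others) auto
    also have "\<dots> = (\<Sum>k\<in>K. r 1 * c k ^ 2 - c k ^ 3)"
      by (rule sum.cong[OF refl]) algebra
    also have "\<dots> = r 1 * r 2 - r 3" by (simp add: r_def sum_subtractf sum_distrib_left)
    finally show ?thesis .
  qed
  have e31: "r 1 * r 3 - r 4 \<ge> s / 2 * r 3"
  proof -
    have "s / 2 * r 3 = (\<Sum>k\<in>K. s / 2 * c k ^ 3)" by (simp add: r_def sum_distrib_left)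
    also have "\<dots> \<le> (\<Sum>k\<in>K. (r 1 - c k) * c k ^ 3)"
      by (intro sum_mono mult_right_mono others) (auto simp: nn)
    also have "\<dots> = (\<Sum>k\<in>K. r 1 * c k ^ 3 - c k ^ 4)"
      by (rule sum.cong[OF refl]) algebra
    also have "\<dots> = r 1 * r 3 - r 4" by (simp add: r_def sum_subtractf sum_distrib_left)
    finally show ?thesis .
  qed
  have "s * r 1 = (\<Sum>k\<in>K. s * c k)" by (simp add: r_def sum_distrib_left)
  also have "\<dots> \<le> (\<Sum>k\<in>K. 2 * c k ^ 2)"
  proof (rule sum_mono)
    fix k assume k: "k \<in> K"
    have "s * c k \<le> (2 * c k) * c k" using big[OF k] nn[OF k] by (intro mult_right_mono) auto
    then show "s * c k \<le> 2 * c k ^ 2" by (simp add: power2_eq_square)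
  qed
  also have "\<dots> = 2 * r 2" by (simp add: r_def sum_distrib_left)
  finally have "q * (s * r 1 - 2 * r 2) \<le> 0" using ab by (simp add: mult_le_0_iff)
  moreover have "3 * s * (r 1 * r 2 - r 3) \<ge> 3 * s * (s / 2 * r 2)"
    using ab e21 by (intro mult_left_mono) auto
  moreover have "2 * (r 1 * r 3 - r 4) \<ge> s * r 3" using e31 by simp
  ultimately have "D \<ge> 3 * s * (s / 2 * r 2) + s * r 3 - s\<^sup>2 * r 2 - s * r 3"
    using \<open>2 * (r 1 * r 3 - r 4) \<ge> s * r 3\<close> unfolding D_def by linarith
  then have "D \<ge> s\<^sup>2 * r 2 / 2" by (simp add: power2_eq_square)
  then have "q * (s\<^sup>2 * r 2 / 2) \<le> q * D" using ab by (intro mult_left_mono)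
  then show ?thesis using identity
    unfolding q_def s_def a_def b_def r_def K_def[symmetric] by (simp add: mult.assoc)
qed

lemma less3: "{..<3::nat} = {0, 1, 2}" by auto

lemma distinct_sum_three:
  fixes c :: "nat \<Rightarrow> real"
  shows "distinct_sum {..<3} c =
    c 0 * c 1 * c 2 * ((c 0 + c 1 + c 2) * (c 0 * c 1 + c 0 * c 2 + c 1 * c 2) - 3 * c 0 * c 1 * c 2)"
proof -
  have sums: "(\<Sum>i<3. c i ^ m) = c 0 ^ m + c 1 ^ m + c 2 ^ m" for m
    by (simp add: less3)
  show ?thesis
    unfolding distinct_sum_power_sums[OF finite_lessThan] sums unfolding power_one_right by algebra
qed

text \<open>For three sizes with sum \<open>1\<close> and elementary symmetric functions \<open>e = e\<^sub>2\<close> and \<open>t = e\<^sub>3\<close> the polynomial is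
\<open>t (e - 3 t)\<close>. As \<open>e \<le> 1/3\<close> and \<open>t \<le> e\<^sup>2 / 3 \<le> 1/27\<close>, it stays below its value \<open>2/243\<close> at \<open>t = 1/27\<close> by
a multiple of \<open>1/27 - t\<close>, which in turn controls \<open>1/3 - e\<close>, half the squared distance to the
barycentre.\<close>

lemma three_part_stability:
  fixes a b c :: real
  assumes nn: "a \<ge> 0" "b \<ge> 0" "c \<ge> 0" and sum: "a + b + c = 1"
  shows "a * b * c * ((a * b + a * c + b * c) - 3 * a * b * c)
    \<le> 2 / 243 - ((a - 1/3)\<^sup>2 + (b - 1/3)\<^sup>2 + (c - 1/3)\<^sup>2) / 162"
proof -
  define e where "e = a * b + a * c + b * c"
  define t where "t = a * b * c"
  define d where "d = (a - 1/3)\<^sup>2 + (b - 1/3)\<^sup>2 + (c - 1/3)\<^sup>2"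
  have c: "c = 1 - a - b" using sum by linarith
  have d: "d = 2 / 3 - 2 * e"
    unfolding d_def e_def c by (simp add: power2_eq_square algebra_simps)
  have d0: "d \<ge> 0" by (simp add: d_def)
  have e0: "e \<ge> 0" "t \<ge> 0" using nn by (auto simp: e_def t_def)
  have "3 * t * (a + b + c) \<le> e\<^sup>2"
  proof -
    have "0 \<le> (a * b - a * c)\<^sup>2 + (a * b - b * c)\<^sup>2 + (a * c - b * c)\<^sup>2" by simp
    also have "\<dots> = 2 * (e\<^sup>2 - 3 * t * (a + b + c))"
      unfolding e_def t_def by algebra
    finally show ?thesis by simp
  qed
  then have t: "t \<le> e\<^sup>2 / 3" using sum by simp
  define h where "h = 1 / 27 - t"
  have "t = 1 / 27 - h" by (simp add: h_def)
  have "h \<ge> d / 18"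
  proof -
    have "d / 18 = (1 / 3) * (1 / 3 - e) * (1 / 3)" using d by simp
    also have "\<dots> \<le> (1 / 3) * (1 / 3 - e) * (1 / 3 + e)"
      using d d0 e0 by (intro mult_left_mono) auto
    also have "\<dots> = 1 / 27 - e\<^sup>2 / 3"
      by (simp add: power2_eq_square algebra_simps)
    also have "\<dots> \<le> h" using t by (simp add: h_def)
    finally show ?thesis .
  qed
  have "t * (e - 3 * t) \<le> t * (1 / 3 - 3 * t)"
    using d d0 e0 by (intro mult_left_mono) auto
  also have "\<dots> = 2 / 243 - h / 9 - 3 * h\<^sup>2"
    unfolding \<open>t = 1 / 27 - h\<close> by (simp add: power2_eq_square algebra_simps)
  also have "\<dots> \<le> 2 / 243 - d / 162" using \<open>h \<ge> d / 18\<close> zero_le_power2[of h] by linarith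
  finally show ?thesis by (simp add: t_def e_def d_def mult.assoc)
qed

lemma three_part_stability_scaled:
  fixes c :: "nat \<Rightarrow> real"
  assumes nn: "\<And>i. i < 3 \<Longrightarrow> c i \<ge> 0" and n: "c 0 + c 1 + c 2 = n" "n > 0" and i: "i < 3"
  shows "distinct_sum {..<3} c \<le> 2 / 243 * n ^ 6 - (c i - n / 3)\<^sup>2 * n ^ 4 / 162"
proof -
  define x where "x j = c j / n" for j
  have c: "c j = n * x j" for j using n by (simp add: x_def)
  have xs: "x 0 + x 1 + x 2 = 1" using n by (simp add: x_def flip: add_divide_distrib)
  have x0: "x 0 \<ge> 0" "x 1 \<ge> 0" "x 2 \<ge> 0" using nn n by (auto simp: x_def)
  have le: "(x i - 1/3)\<^sup>2 \<le> (x 0 - 1/3)\<^sup>2 + (x 1 - 1/3)\<^sup>2 + (x 2 - 1/3)\<^sup>2"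
  proof -
    have "i = 0 \<or> i = 1 \<or> i = 2" using i by linarith
    then show ?thesis by (smt (verit) zero_le_power2)
  qed
  have "distinct_sum {..<3} c = n ^ 6 * (x 0 * x 1 * x 2 * ((x 0 + x 1 + x 2) * (x 0 * x 1 + x 0 * x 2 + x 1 * x 2) - 3 * x 0 * x 1 * x 2))"
    unfolding distinct_sum_three c by algebra
  also have "\<dots> \<le> n ^ 6 * (2 / 243 - (x i - 1/3)\<^sup>2 / 162)"
    using three_part_stability[OF x0 xs] le n xs by (intro mult_left_mono) (auto simp: field_simps)
  also have "\<dots> = 2 / 243 * n ^ 6 - (c i - n / 3)\<^sup>2 * n ^ 4 / 162"
    unfolding c by (simp add: field_simps power2_eq_square eval_nat_numeral)
  finally show ?thesis .
qed

text \<open>The triple lists the cliques that receive the triangle, the edge and the isolated vertex.\<close>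

lemma homs_same_eq:
  assumes \<phi>: "\<phi> \<in> V \<rightarrow> I"
  shows "homs V (same \<phi>) = (\<Union>(i, j, k)\<in>(SIGMA i:I. SIGMA j:I - {i}. I - {i, j}).
    PiE {..<6} (\<lambda>p. {x \<in> V. \<phi> x = [i, j, k] ! component p}))" (is "_ = ?U")
proof (intro equalityI subsetI)
  fix f assume f: "f \<in> homs V (same \<phi>)"
  then have fV: "f \<in> maps V"
    and fc: "\<And>p q. p < 6 \<Longrightarrow> q < 6 \<Longrightarrow> \<phi> (f p) = \<phi> (f q) \<longleftrightarrow> component p = component q"
    by (auto simp: homs_def)
  have mem: "\<phi> (f p) \<in> I" if "p < 6" for p using fV \<phi> that by (auto simp: PiE_iff)
  let ?t = "(\<phi> (f 0), \<phi> (f 4), \<phi> (f 2))"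
  have "?t \<in> (SIGMA i:I. SIGMA j:I - {i}. I - {i, j})"
    using mem fc[of 0 4] fc[of 0 2] fc[of 4 2] by (auto simp: component_def)
  moreover have "f \<in> PiE {..<6} (\<lambda>p. {x \<in> V. \<phi> x = [\<phi> (f 0), \<phi> (f 4), \<phi> (f 2)] ! component p})"
  proof (rule PiE_I)
    fix p :: nat assume "p \<in> {..<6}"
    then have p: "p < 6" by simp
    have "\<phi> (f p) = [\<phi> (f 0), \<phi> (f 4), \<phi> (f 2)] ! component p"
      using fc[OF p, of 0] fc[OF p, of 4] fc[OF p, of 2] by (auto simp: component_def)
    then show "f p \<in> {x \<in> V. \<phi> x = [\<phi> (f 0), \<phi> (f 4), \<phi> (f 2)] ! component p}"
      using fV p by auto
  next
    fix p :: nat assume "p \<notin> {..<6}" then show "f p = undefined" using fV by (rule PiE_arb[rotated])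
  qed
  ultimately show "f \<in> ?U" by blast
next
  fix f assume "f \<in> ?U"
  then obtain i j k where ijk: "i \<in> I" "j \<in> I - {i}" "k \<in> I - {i, j}"
    and f: "f \<in> PiE {..<6} (\<lambda>p. {x \<in> V. \<phi> x = [i, j, k] ! component p})" by auto
  have fp: "f p \<in> V" "\<phi> (f p) = [i, j, k] ! component p" if "p < 6" for p
    using f that by (auto simp: PiE_iff)
  have inj: "[i, j, k] ! component p = [i, j, k] ! component q \<longleftrightarrow> component p = component q" for p q
    using ijk by (auto simp: component_def)
  show "f \<in> homs V (same \<phi>)"
    unfolding homs_def using f fp inj by (auto simp: PiE_iff)
qed

lemma card_homs_same:
  assumes V: "finite V" and I: "finite I" and \<phi>: "\<phi> \<in> V \<rightarrow> I"
  shows "real (card (homs V (same \<phi>))) = distinct_sum I (\<lambda>i. real (card {x \<in> V. \<phi> x = i}))"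
proof -
  let ?T = "SIGMA i:I. SIGMA j:I - {i}. I - {i, j}"
  let ?A = "\<lambda>(i, j, k). PiE {..<6::nat} (\<lambda>p. {x \<in> V. \<phi> x = [i, j, k] ! component p})"
  let ?c = "\<lambda>i. card {x \<in> V. \<phi> x = i}"
  have T: "finite ?T" using I by auto
  have disj: "?A s \<inter> ?A t = {}" if "s \<noteq> t" for s t
  proof (rule ccontr)
    assume "?A s \<inter> ?A t \<noteq> {}"
    then obtain f where f: "f \<in> ?A s" "f \<in> ?A t" by blast
    obtain i j k i' j' k' where st: "s = (i, j, k)" "t = (i', j', k')" by (metis prod_cases3)
    have "[i, j, k] ! component p = [i', j', k'] ! component p" if "p < 6" for p
      using f that by (auto simp: st PiE_iff)
    from this[of 0] this[of 4] this[of 2] show False using \<open>s \<noteq> t\<close> by (simp add: st component_def)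
  qed
  have cardA: "card (?A (i, j, k)) = ?c i ^ 3 * ?c j ^ 2 * ?c k" for i j k
    by (simp add: card_PiE less6 component_def power2_eq_square power3_eq_cube)
  have "card (homs V (same \<phi>)) = card (\<Union>t\<in>?T. ?A t)"
    unfolding homs_same_eq[OF \<phi>] ..
  also have "\<dots> = (\<Sum>t\<in>?T. card (?A t))"
    by (rule card_UN_disjoint) (use T V disj in \<open>auto intro!: finite_PiE\<close>)
  also have "real \<dots> = (\<Sum>(i, j, k)\<in>?T. real (?c i) ^ 3 * real (?c j) ^ 2 * real (?c k))"
    unfolding of_nat_sum by (rule sum.cong[OF refl]) (use cardA in auto)
  also have "\<dots> = distinct_sum I (\<lambda>i. real (?c i))"
    unfolding distinct_sum_def using I by (simp add: sum.Sigma)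
  finally show ?thesis .
qed

section \<open>Symmetrisation\<close>

text \<open>The vertex \<open>u\<close> becomes an adjacent twin of \<open>v\<close>: pulling the relation back along the map that sends
\<open>u\<close> to \<open>v\<close> keeps it reflexive and symmetric.\<close>

definition clone :: "'a \<Rightarrow> 'a \<Rightarrow> ('a \<Rightarrow> 'a \<Rightarrow> bool) \<Rightarrow> 'a \<Rightarrow> 'a \<Rightarrow> bool" where
  "clone u v R x y = R ((id(u := v)) x) ((id(u := v)) y)"

definition homs_hitting :: "'a set \<Rightarrow> ('a \<Rightarrow> 'a \<Rightarrow> bool) \<Rightarrow> 'a set \<Rightarrow> 'a set \<Rightarrow> (nat \<Rightarrow> 'a) set" where
  "homs_hitting V R W U = {f \<in> homs V R. f ` {..<6} \<inter> W = U}"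

lemma finite_homs_hitting: "finite V \<Longrightarrow> finite (homs_hitting V R W U)"
  unfolding homs_hitting_def by (simp add: finite_homs)

lemma card_homs_split:
  assumes V: "finite V" and uv: "u \<noteq> v"
  shows "card (homs V R) = card (homs_hitting V R {u, v} {}) + card (homs_hitting V R {u, v} {u})
    + card (homs_hitting V R {u, v} {v}) + card (homs_hitting V R {u, v} {u, v})"
proof -
  let ?h = "homs_hitting V R {u, v}"
  have "homs V R = (\<Union>U\<in>{{}, {u}, {v}, {u, v}}. ?h U)"
    unfolding homs_hitting_def by auto
  also have "card \<dots> = (\<Sum>U\<in>{{}, {u}, {v}, {u, v}}. card (?h U))"
    by (rule card_UN_disjoint) (auto simp: finite_homs_hitting V, auto simp: homs_hitting_def)
  also have "\<dots> = card (?h {}) + card (?h {u}) + card (?h {v}) + card (?h {u, v})"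
    using uv by (simp add: doubleton_eq_iff)
  finally show ?thesis .
qed

text \<open>Placements that avoid \<open>u\<close> survive; those that use \<open>v\<close> but not \<open>u\<close> have a second copy with \<open>u\<close> in the role
of \<open>v\<close>; and those that use both survive as well, because \<open>u\<close> and \<open>v\<close>, being adjacent, receive vertices
of the same component of \<open>F17\<close>, and these have the same neighbours outside.\<close>

lemma homs_clone_ge:
  assumes V: "finite V" "u \<in> V" "v \<in> V" "u \<noteq> v" and R: "R u v"
  shows "card (homs_hitting V R {u, v} {}) + 2 * card (homs_hitting V R {u, v} {v})
    + card (homs_hitting V R {u, v} {u, v}) \<le> card (homs V (clone u v R))"
proof -
  let ?h = "homs_hitting V R {u, v}"
  let ?\<tau> = "id(u := v)"
  define swap where "swap f = (\<lambda>p\<in>{..<6::nat}. if f p = v then u else f p)" for f :: "nat \<Rightarrow> 'a"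
  (* a map is a placement of the cloned relation as soon as sending u to v turns it, component by
     component, into values of a placement of R *)
  have lift: "f \<in> homs V (clone u v R)"
    if g: "g \<in> homs V R" and f: "f \<in> maps V"
      and ex: "\<And>p. p < 6 \<Longrightarrow> \<exists>q<6. ?\<tau> (f p) = g q \<and> component q = component p" for f g
  proof -
    have "clone u v R (f p) (f q) \<longleftrightarrow> component p = component q" if p: "p < 6" and q: "q < 6" for p q
    proof -
      obtain p' where p': "p' < 6" "?\<tau> (f p) = g p'" "component p' = component p" using ex[OF p] by auto
      obtain q' where q': "q' < 6" "?\<tau> (f q) = g q'" "component q' = component q" using ex[OF q] by auto
      have "R (g p') (g q') \<longleftrightarrow> component p' = component q'" using g p'(1) q'(1) by (simp add: homs_def)
      then show ?thesis unfolding clone_def p'(2) q'(2) p'(3) q'(3) .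
    qed
    then show ?thesis using f by (simp add: homs_def)
  qed
  have 1: "?h {} \<union> ?h {v} \<subseteq> homs V (clone u v R)"
  proof
    fix f assume f: "f \<in> ?h {} \<union> ?h {v}"
    then have fR: "f \<in> homs V R" and u: "u \<notin> f ` {..<6}" using V by (auto simp: homs_hitting_def)
    show "f \<in> homs V (clone u v R)"
    proof (rule lift[OF fR])
      show "f \<in> maps V" using fR by (simp add: homs_def)
      show "\<exists>q<6. ?\<tau> (f p) = f q \<and> component q = component p" if "p < 6" for p
      proof -
        have "f p \<noteq> u" using u that by auto
        then have "?\<tau> (f p) = f p" by simp
        then show ?thesis using that by blast
      qed
    qed
  qed
  have 2: "swap ` ?h {v} \<subseteq> homs V (clone u v R)"
  proof
    fix g assume "g \<in> swap ` ?h {v}"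
    then obtain f where f: "f \<in> ?h {v}" "g = swap f" by auto
    then have fR: "f \<in> homs V R" and u: "u \<notin> f ` {..<6}" using V by (auto simp: homs_hitting_def)
    have fV: "f \<in> maps V" using fR by (simp add: homs_def)
    show "g \<in> homs V (clone u v R)"
    proof (rule lift[OF fR])
      show "g \<in> maps V" unfolding f(2) swap_def using fV V by (auto simp: PiE_iff)
      show "\<exists>q<6. ?\<tau> (g p) = f q \<and> component q = component p" if "p < 6" for p
      proof -
        have "f p \<noteq> u" using u that by auto
        moreover have "g p = (if f p = v then u else f p)" using that by (simp add: f(2) swap_def)
        ultimately have "?\<tau> (g p) = f p" using V(4) by simp
        then show ?thesis using that by blast
      qed
    qed
  qed
  have 3: "?h {u, v} \<subseteq> homs V (clone u v R)"
  proof
    fix f assume f: "f \<in> ?h {u, v}"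
    then have fR: "f \<in> homs V R" and "u \<in> f ` {..<6}" "v \<in> f ` {..<6}" by (auto simp: homs_hitting_def)
    then obtain b where b: "b < 6" "f b = v" by auto
    show "f \<in> homs V (clone u v R)"
    proof (rule lift[OF fR])
      show "f \<in> maps V" using fR by (simp add: homs_def)
      show "\<exists>q<6. ?\<tau> (f p) = f q \<and> component q = component p" if p: "p < 6" for p
      proof (cases "f p = u")
        case True
        then have "component p = component b" using fR p b R unfolding homs_def by blast
        then show ?thesis using True b by auto
      next
        case False then show ?thesis using p by auto
      qed
    qed
  qed
  have inj: "inj_on swap (?h {v})"
  proof (rule inj_onI)
    fix f g assume f: "f \<in> ?h {v}" and g: "g \<in> ?h {v}" and eq: "swap f = swap g"
    have fg: "f \<in> maps V" "g \<in> maps V"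
      using f g by (auto simp: homs_hitting_def homs_def)
    show "f = g"
    proof (rule PiE_ext[OF fg])
      fix p :: nat assume p: "p \<in> {..<6}"
      have "f p \<noteq> u" "g p \<noteq> u" using f g p V by (auto simp: homs_hitting_def)
      moreover have "swap f p = swap g p" using eq by simp
      ultimately show "f p = g p" using p by (auto simp: swap_def split: if_splits)
    qed
  qed
  have hit_swap: "u \<in> g ` {..<6}" "v \<notin> g ` {..<6}" if "g \<in> swap ` ?h {v}" for g
  proof -
    from \<open>g \<in> swap ` ?h {v}\<close> obtain f where f: "f \<in> ?h {v}" "g = swap f" by blast
    then have "v \<in> f ` {..<6}" unfolding homs_hitting_def by blast
    then obtain p where "p < 6" "f p = v" by auto
    then show "u \<in> g ` {..<6}" using f by (auto simp: swap_def intro!: image_eqI[of _ _ p])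
    show "v \<notin> g ` {..<6}" using f V by (auto simp: swap_def)
  qed
  have "card (?h {}) + 2 * card (?h {v}) + card (?h {u, v})
      = card (?h {} \<union> ?h {v}) + card (swap ` ?h {v}) + card (?h {u, v})"
  proof -
    have "?h {} \<inter> ?h {v} = {}" unfolding homs_hitting_def by blast
    then have "card (?h {} \<union> ?h {v}) = card (?h {}) + card (?h {v})"
      by (intro card_Un_disjoint finite_homs_hitting V)
    then show ?thesis using card_image[OF inj] by simp
  qed
  also have "\<dots> = card (?h {} \<union> ?h {v} \<union> swap ` ?h {v} \<union> ?h {u, v})"
  proof -
    have "u \<notin> f ` {..<6}" if "f \<in> ?h {} \<union> ?h {v}" for f
      using that V(4) unfolding homs_hitting_def by blast
    then have d1: "(?h {} \<union> ?h {v}) \<inter> swap ` ?h {v} = {}"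
      using hit_swap(1) by blast
    have d2: "(?h {} \<union> ?h {v} \<union> swap ` ?h {v}) \<inter> ?h {u, v} = {}"
    proof -
      have "f \<notin> swap ` ?h {v}" if "f \<in> ?h {u, v}" for f
        using hit_swap(2)[of f] that unfolding homs_hitting_def by blast
      moreover have "(?h {} \<union> ?h {v}) \<inter> ?h {u, v} = {}"
        using V(4) unfolding homs_hitting_def by blast
      ultimately show ?thesis by blast
    qed
    show ?thesis using V(1) d1 d2 by (simp add: card_Un_disjoint finite_homs_hitting)
  qed
  also have "\<dots> \<le> card (homs V (clone u v R))"
    by (rule card_mono) (use 1 2 3 V in \<open>auto simp: finite_homs\<close>)
  finally show ?thesis .
qed

text \<open>Placements that use \<open>u\<close> only are lost in one of the two symmetrisations and doubled in the other. So at
least one of them does not decrease the count.\<close>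

lemma homs_clone_average:
  assumes V: "finite V" "u \<in> V" "v \<in> V" "u \<noteq> v" and R: "R u v" "symp R"
  shows "2 * card (homs V R) \<le> card (homs V (clone u v R)) + card (homs V (clone v u R))"
proof -
  have "{v, u} = {u, v}" by auto
  moreover have "R v u" using R sympD by fastforce
  ultimately show ?thesis
    using homs_clone_ge[where V = V and R = R and u = u and v = v, OF V R(1)] homs_clone_ge[of V v u R] card_homs_split[OF V(1,4), of R] V
    by simp
qed

lemma reflp_clone: "reflp R \<Longrightarrow> reflp (clone u v R)"
  unfolding reflp_def clone_def by blast

lemma symp_clone: "symp R \<Longrightarrow> symp (clone u v R)"
  unfolding symp_def clone_def by blast

definition twins :: "'a set \<Rightarrow> ('a \<Rightarrow> 'a \<Rightarrow> bool) \<Rightarrow> ('a \<times> 'a) set" where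
  "twins V R = {(x, y) \<in> V \<times> V. R x y \<and> (\<forall>z\<in>V. R x z = R y z)}"

lemma card_twins_le: "finite V \<Longrightarrow> card (twins V R) \<le> card V ^ 2"
  unfolding power2_eq_square card_cartesian_product[symmetric]
  by (rule card_mono) (auto simp: twins_def)

text \<open>The tie-breaker: cloning the vertex of the larger twin class enlarges the set of twin pairs, since \<open>u\<close> moves
from its class into one that was already at least as large, and other twins stay twins.\<close>

lemma twins_clone_less:
  assumes V: "finite V" "u \<in> V" "v \<in> V" and R: "reflp R" "symp R" "R u v" and nt: "(u, v) \<notin> twins V R"
    and le: "card {y. (u, y) \<in> twins V R} \<le> card {y. (v, y) \<in> twins V R}"
  shows "card (twins V R) < card (twins V (clone u v R))"
proof -
  define Tu where "Tu = {y. (u, y) \<in> twins V R}"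
  define Tv where "Tv = {y. (v, y) \<in> twins V R}"
  define P where "P = {(x, y) \<in> twins V R. x \<noteq> u \<and> y \<noteq> u}"
  have TV: "Tu \<subseteq> V" "Tv \<subseteq> V" by (auto simp: Tu_def Tv_def twins_def)
  then have fin: "finite Tu" "finite Tv" using V finite_subset by auto
  have finP: "finite P" "finite (twins V R)" "finite (twins V (clone u v R))"
    using V by (auto simp: P_def twins_def intro: finite_subset[of _ "V \<times> V"])
  have symT: "(y, x) \<in> twins V R" if "(x, y) \<in> twins V R" for x y
    using that sympD[OF R(2)] unfolding twins_def by blast
  have uTu: "u \<in> Tu" using V R by (auto simp: Tu_def twins_def reflp_def)
  have uTv: "u \<notin> Tv" using nt symT by (auto simp: Tv_def)
  (* u is in its own twin class: it contributes 2 |Tu| - 1 pairs before and 2 |Tv| + 1 pairs after *)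
  have "twins V R \<subseteq> P \<union> {u} \<times> Tu \<union> (Tu - {u}) \<times> {u}"
    using symT by (auto simp: P_def Tu_def)
  then have "card (twins V R) \<le> card (P \<union> {u} \<times> Tu \<union> (Tu - {u}) \<times> {u})"
    by (rule card_mono[rotated]) (use fin finP in auto)
  also have "\<dots> \<le> card P + card ({u} \<times> Tu) + card ((Tu - {u}) \<times> {u})"
    by (meson add_le_mono1 card_Un_le order_trans)
  also have "\<dots> = card P + card Tu + (card Tu - 1)"
    using uTu fin by (simp add: card_cartesian_product)
  also have "\<dots> < card P + (card Tv + 1) + card Tv"
    using le by (simp add: Tu_def Tv_def)
  also have "\<dots> = card (P \<union> {u} \<times> insert u Tv \<union> Tv \<times> {u})"
  proof -
    have "P \<inter> ({u} \<times> insert u Tv) = {}" by (auto simp: P_def)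
    moreover have "(P \<union> {u} \<times> insert u Tv) \<inter> (Tv \<times> {u}) = {}" using uTv by (auto simp: P_def)
    ultimately show ?thesis using fin finP uTv
      by (simp add: card_Un_disjoint card_cartesian_product)
  qed
  also have "\<dots> \<le> card (twins V (clone u v R))"
  proof (rule card_mono[OF finP(3)])
    have vz: "R v y" "\<And>z. z \<in> V \<Longrightarrow> R v z = R y z" "y \<in> V" if "y \<in> Tv" for y
      using that by (auto simp: Tv_def twins_def)
    have "P \<subseteq> twins V (clone u v R)"
      using V by (auto simp: P_def twins_def clone_def)
    moreover have "(u, y) \<in> twins V (clone u v R)" if "y \<in> Tv" for y
    proof -
      have "y \<noteq> u" using that uTv by auto
      then show ?thesis using vz[OF that] V by (auto simp: twins_def clone_def)
    qed
    moreover have "(y, u) \<in> twins V (clone u v R)" if "y \<in> Tv" for y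
    proof -
      have "y \<noteq> u" using that uTv by auto
      moreover have "R y v" using vz(1)[OF that] sympD[OF R(2)] by blast
      ultimately show ?thesis using vz[OF that] V by (auto simp: twins_def clone_def)
    qed
    moreover have "(u, u) \<in> twins V (clone u v R)"
      using V R by (auto simp: twins_def clone_def reflp_def)
    ultimately show "P \<union> {u} \<times> insert u Tv \<union> Tv \<times> {u} \<subseteq> twins V (clone u v R)" by blast
  qed
  finally show ?thesis .
qed

text \<open>The lexicographic order by number of placements, then number of twin pairs, encoded in one number; the
second entry is at most \<open>n\<^sup>2\<close>.\<close>

definition potential :: "'a set \<Rightarrow> ('a \<Rightarrow> 'a \<Rightarrow> bool) \<Rightarrow> nat" where
  "potential V R = card (homs V R) * (card V ^ 2 + 1) + card (twins V R)"

lemma potential_less_homs: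
  assumes "finite V" "card (homs V R) < card (homs V R')"
  shows "potential V R < potential V R'"
proof -
  have "potential V R < (card (homs V R) + 1) * (card V ^ 2 + 1)"
    using card_twins_le[OF assms(1), of R] by (simp add: potential_def)
  also have "\<dots> \<le> card (homs V R') * (card V ^ 2 + 1)"
    using assms(2) by (intro mult_right_mono) auto
  finally show ?thesis by (simp add: potential_def)
qed

lemma potential_bounded: "finite V \<Longrightarrow> potential V R \<le> card V ^ 6 * (card V ^ 2 + 1) + card V ^ 2"
  unfolding potential_def by (intro add_mono mult_right_mono card_homs_le card_twins_le) auto

lemma improve_by_cloning:
  assumes V: "finite V" "u \<in> V" "v \<in> V" and R: "reflp R" "symp R" "R u v" and nt: "(u, v) \<notin> twins V R"
  shows "\<exists>R'. reflp R' \<and> symp R' \<and> potential V R < potential V R' \<and>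
    card (homs V R) \<le> card (homs V R') \<and> dist3 V R \<le> dist3 V R' + 2 * card V"
proof -
  have main: ?thesis
    if uv: "u \<in> V" "v \<in> V" "R u v" "(u, v) \<notin> twins V R"
      "card {y. (u, y) \<in> twins V R} \<le> card {y. (v, y) \<in> twins V R}" for u v
  proof -
    have ne: "u \<noteq> v" using uv R by (auto simp: twins_def)
    let ?A = "clone u v R" and ?B = "clone v u R"
    have avg: "2 * card (homs V R) \<le> card (homs V ?A) + card (homs V ?B)"
      by (rule homs_clone_average) (use V uv ne R in auto)
    have dA: "dist3 V R \<le> dist3 V ?A + 2 * card V" and dB: "dist3 V R \<le> dist3 V ?B + 2 * card V"
      using dist3_diff[of V "{u}" R ?A] dist3_diff[of V "{v}" R ?B] V uv by (auto simp: clone_def)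
    show ?thesis
    proof (cases "card (homs V ?B) > card (homs V R)")
      case True
      then show ?thesis using dB R potential_less_homs[OF V(1), of R ?B]
        by (intro exI[of _ ?B]) (auto intro: reflp_clone symp_clone)
    next
      case False
      then have A: "card (homs V R) \<le> card (homs V ?A)" using avg by linarith
      have "card (twins V R) < card (twins V ?A)"
        by (rule twins_clone_less) (use V uv R in auto)
      then have "potential V R < potential V ?A"
        unfolding potential_def using A by (intro add_le_less_mono mult_right_mono) auto
      then show ?thesis using dA A R
        by (intro exI[of _ ?A]) (auto intro: reflp_clone symp_clone)
    qed
  qed
  have nt': "(v, u) \<notin> twins V R" using nt sympD[OF R(2)] unfolding twins_def by blast
  have "R v u" using R(3) sympD[OF R(2)] by blast
  show ?thesis
  proof (cases "card {y. (u, y) \<in> twins V R} \<le> card {y. (v, y) \<in> twins V R}")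
    case True then show ?thesis by (rule main[OF V(2,3) R(3) nt])
  next
    case False
    then have "card {y. (v, y) \<in> twins V R} \<le> card {y. (u, y) \<in> twins V R}" by simp
    then show ?thesis by (rule main[OF V(3,2) \<open>R v u\<close> nt'])
  qed
qed

lemma distinct_sum_cong:
  assumes "\<And>i. i \<in> I \<Longrightarrow> c i = d i"
  shows "distinct_sum I c = distinct_sum I d"
  unfolding distinct_sum_def by (intro sum.cong) (use assms in auto)

text \<open>The parameter \<open>\<theta>\<close> separates two cases: if the smallest clique has at most \<open>\<theta> n\<close> vertices, merging it moves
the graph only slightly, and otherwise the gain has the order of all placements.\<close>

lemma improve_by_merging:
  fixes \<phi> :: "'a \<Rightarrow> 'b" and \<theta> :: real
  assumes V: "finite V" and four: "card (\<phi> ` V) \<ge> 4" and \<theta>: "\<theta> \<ge> 0"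
  shows "\<exists>R'. reflp R' \<and> symp R' \<and> potential V (same \<phi>) < potential V R' \<and>
    card (homs V (same \<phi>)) \<le> card (homs V R') \<and>
    (real (dist3 V (same \<phi>)) \<le> dist3 V R' + 2 * \<theta> * real (card V) ^ 2 \<or>
     real (card (homs V (same \<phi>))) + 4 * \<theta> ^ 6 * real (card V) ^ 6 \<le> card (homs V R'))"
proof -
  define I where "I = \<phi> ` V"
  define c where "c i = real (card {x \<in> V. \<phi> x = i})" for i
  have I: "finite I" "card I \<ge> 4" using V four by (auto simp: I_def)
  have cpos: "c i > 0" if "i \<in> I" for i
    using that V by (auto simp: I_def c_def card_gt_0_iff)
  have "I \<noteq> {}" using I by auto
  then obtain i where i: "i \<in> I" "\<And>k. k \<in> I \<Longrightarrow> c i \<le> c k"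
    using ex_is_arg_min_if_finite[of I c] I by (auto simp: is_arg_min_linorder)
  have "card (I - {i}) \<ge> 3" using I i by simp
  then have "I - {i} \<noteq> {}" by (metis card.empty not_numeral_le_zero)
  then obtain j where j: "j \<in> I - {i}" "\<And>k. k \<in> I - {i} \<Longrightarrow> c j \<le> c k"
    using ex_is_arg_min_if_finite[of "I - {i}" c] I by (auto simp: is_arg_min_linorder)
  define \<psi> where "\<psi> x = (if \<phi> x = i then j else \<phi> x)" for x
  let ?R = "same \<psi>"
  have hR: "card (homs V (same \<phi>)) = distinct_sum I c"
    using card_homs_same[of V I \<phi>] V I by (simp add: I_def c_def[abs_def])
  have hR': "card (homs V ?R) = distinct_sum (I - {i}) (c(j := c i + c j))"
  proof -
    have "\<psi> \<in> V \<rightarrow> I - {i}" using j by (auto simp: \<psi>_def I_def)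
    then have "card (homs V ?R) = distinct_sum (I - {i}) (\<lambda>k. real (card {x \<in> V. \<psi> x = k}))"
      using card_homs_same[of V "I - {i}" \<psi>] V I by auto
    also have "\<dots> = distinct_sum (I - {i}) (c(j := c i + c j))"
    proof (rule distinct_sum_cong)
      fix k assume k: "k \<in> I - {i}"
      show "real (card {x \<in> V. \<psi> x = k}) = (c(j := c i + c j)) k"
      proof (cases "k = j")
        case True
        have "{x \<in> V. \<psi> x = k} = {x \<in> V. \<phi> x = i} \<union> {x \<in> V. \<phi> x = j}"
          using True by (auto simp: \<psi>_def)
        moreover have "{x \<in> V. \<phi> x = i} \<inter> {x \<in> V. \<phi> x = j} = {}" using j by auto
        ultimately show ?thesis using V True by (simp add: card_Un_disjoint c_def)
      next
        case False
        then have "{x \<in> V. \<psi> x = k} = {x \<in> V. \<phi> x = k}" using k by (auto simp: \<psi>_def)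
        then show ?thesis using False by (simp add: c_def)
      qed
    qed
    finally show ?thesis .
  qed
  define K where "K = I - {i, j}"
  have K: "finite K" "card K \<ge> 2" using I i j by (auto simp: K_def card_Diff_subset)
  have gain: "distinct_sum I c + c i * c j * (c i + c j)\<^sup>2 / 2 * (\<Sum>k\<in>K. c k ^ 2)
     \<le> distinct_sum (I - {i}) (c(j := c i + c j))"
    unfolding K_def
    by (rule distinct_sum_merge) (use I i j cpos in \<open>auto intro: less_imp_le\<close>)
  have sumK: "(\<Sum>k\<in>K. c k ^ 2) \<ge> 2 * c i ^ 2"
  proof -
    have "2 * c i ^ 2 \<le> real (card K) * c i ^ 2" using K by (intro mult_right_mono) auto
    also have "\<dots> = (\<Sum>k\<in>K. c i ^ 2)" by simp
    also have "\<dots> \<le> (\<Sum>k\<in>K. c k ^ 2)"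
      using i cpos[OF i(1)] by (intro sum_mono power_mono) (auto simp: K_def)
    finally show ?thesis .
  qed
  have step: "4 * c i ^ 6 \<le> c i * c j * (c i + c j)\<^sup>2 / 2 * (\<Sum>k\<in>K. c k ^ 2)"
  proof -
    have ci: "c i > 0" "c i \<le> c j" using cpos i j by auto
    have "4 * c i ^ 6 = c i * c i * (c i + c i)\<^sup>2 / 2 * (2 * c i ^ 2)"
      by (simp add: power2_eq_square eval_nat_numeral)
    also have "\<dots> \<le> c i * c j * (c i + c j)\<^sup>2 / 2 * (\<Sum>k\<in>K. c k ^ 2)"
      using ci sumK by (intro mult_mono divide_right_mono power_mono) auto
    finally show ?thesis .
  qed
  have inc: "real (card (homs V (same \<phi>))) + 4 * c i ^ 6 \<le> card (homs V ?R)"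
    using gain step unfolding hR hR' by linarith
  have "4 * c i ^ 6 > 0" using cpos[OF i(1)] by simp
  then have less: "card (homs V (same \<phi>)) < card (homs V ?R)" using inc by linarith
  have d: "dist3 V (same \<phi>) \<le> dist3 V ?R + 2 * card {x \<in> V. \<phi> x = i} * card V"
    using dist3_diff[of V "{x \<in> V. \<phi> x = i}" "same \<phi>" ?R] V by (auto simp: \<psi>_def)
  have alt: "real (dist3 V (same \<phi>)) \<le> dist3 V ?R + 2 * \<theta> * real (card V) ^ 2 \<or>
     real (card (homs V (same \<phi>))) + 4 * \<theta> ^ 6 * real (card V) ^ 6 \<le> card (homs V ?R)"
  proof (cases "c i \<le> \<theta> * card V")
    case True
    have "real (dist3 V (same \<phi>)) \<le> dist3 V ?R + 2 * c i * card V"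
      using d unfolding c_def by (metis (no_types, lifting) of_nat_add of_nat_le_iff of_nat_mult of_nat_numeral)
    also have "\<dots> \<le> dist3 V ?R + 2 * (\<theta> * card V) * card V"
      using True by (intro add_left_mono mult_right_mono) auto
    finally show ?thesis by (simp add: power2_eq_square mult.assoc)
  next
    case False
    then have "(\<theta> * card V) ^ 6 \<le> c i ^ 6" using \<theta> by (intro power_mono) auto
    then show ?thesis using inc by (simp add: power_mult_distrib)
  qed
  show ?thesis
    by (rule exI[of _ ?R]) (use less alt potential_less_homs[OF V less] in \<open>auto simp: reflp_def symp_def\<close>)
qed

lemma dist3_eq_0_iff:
  assumes "finite V"
  shows "dist3 V R = 0 \<longleftrightarrow> (\<exists>\<phi>\<in>V \<rightarrow> {..<3::nat}. \<forall>x\<in>V. \<forall>y\<in>V. R x y = (\<phi> x = \<phi> y))"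
proof
  assume 0: "dist3 V R = 0"
  obtain \<phi> where \<phi>: "\<phi> \<in> V \<rightarrow> {..<3}" "card (mismatches V R \<phi>) = dist3 V R"
    by (rule dist3_attained)
  then have "mismatches V R \<phi> = {}" using 0 finite_mismatches[OF assms] by auto
  then show "\<exists>\<phi>\<in>V \<rightarrow> {..<3::nat}. \<forall>x\<in>V. \<forall>y\<in>V. R x y = (\<phi> x = \<phi> y)"
    using \<phi> by (intro bexI[of _ \<phi>]) (auto simp: mismatches_def)
next
  assume "\<exists>\<phi>\<in>V \<rightarrow> {..<3::nat}. \<forall>x\<in>V. \<forall>y\<in>V. R x y = (\<phi> x = \<phi> y)"
  then obtain \<phi> where \<phi>: "\<phi> \<in> V \<rightarrow> {..<3::nat}" "\<forall>x\<in>V. \<forall>y\<in>V. R x y = (\<phi> x = \<phi> y)" by auto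
  then have "mismatches V R \<phi> = {}" by (auto simp: mismatches_def)
  then show "dist3 V R = 0" using dist3_le[OF \<phi>(1), of R] by simp
qed

text \<open>One step towards three cliques. If all adjacent vertices are twins, the relation is an equivalence
and two cliques can be merged, unless there are at most three; otherwise one of two adjacent non-twins can
be cloned. The steps are short, apart from those that gain a lot. This allows to stop at a
prescribed distance from three cliques.\<close>

lemma improve:
  fixes \<theta> :: real
  assumes V: "finite V" and R: "reflp R" "symp R" and \<theta>: "\<theta> \<ge> 0" and far: "dist3 V R \<noteq> 0"
  shows "\<exists>R'. reflp R' \<and> symp R' \<and> potential V R < potential V R' \<and>
    card (homs V R) \<le> card (homs V R') \<and>
    (real (dist3 V R) \<le> dist3 V R' + 2 * real (card V) + 2 * \<theta> * real (card V) ^ 2 \<or>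
     real (card (homs V R)) + 4 * \<theta> ^ 6 * real (card V) ^ 6 \<le> card (homs V R'))"
proof (cases "\<exists>u\<in>V. \<exists>v\<in>V. R u v \<and> (u, v) \<notin> twins V R")
  case True
  then obtain u v where uv: "u \<in> V" "v \<in> V" "R u v" "(u, v) \<notin> twins V R" by auto
  from improve_by_cloning[OF V uv(1,2) R uv(3,4)]
  obtain R' where R': "reflp R'" "symp R'" "potential V R < potential V R'"
    "card (homs V R) \<le> card (homs V R')" "dist3 V R \<le> dist3 V R' + 2 * card V" by auto
  have "real (dist3 V R) \<le> real (dist3 V R' + 2 * card V)" using R'(5) by (rule of_nat_mono)
  also have "\<dots> \<le> dist3 V R' + 2 * real (card V) + 2 * \<theta> * real (card V) ^ 2" using \<theta> by simp
  finally show ?thesis using R' by (intro exI[of _ R']) auto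
next
  case False
  (* adjacent vertices are twins, so cliques can be labelled by closed neighbourhoods *)
  define \<phi> where "\<phi> x = {y \<in> V. R x y}" for x
  have eq: "R x y = (\<phi> x = \<phi> y)" if "x \<in> V" "y \<in> V" for x y
  proof
    assume "R x y" then have "(x, y) \<in> twins V R" using False that by auto
    then show "\<phi> x = \<phi> y" by (auto simp: \<phi>_def twins_def)
  next
    assume "\<phi> x = \<phi> y"
    moreover have "y \<in> \<phi> y" using that R by (auto simp: \<phi>_def reflp_def)
    ultimately show "R x y" by (auto simp: \<phi>_def)
  qed
  have four: "card (\<phi> ` V) \<ge> 4"
  proof (rule ccontr)
    assume "\<not> card (\<phi> ` V) \<ge> 4"
    then have "card (\<phi> ` V) \<le> card {..<3::nat}" by simp
    then obtain g where g: "g ` \<phi> ` V \<subseteq> {..<3::nat}" "inj_on g (\<phi> ` V)"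
      using card_le_inj[of "\<phi> ` V" "{..<3::nat}"] V by auto
    have g1: "(g \<circ> \<phi>) \<in> V \<rightarrow> {..<3::nat}" using g(1) by (auto simp: image_subset_iff)
    have g2: "\<forall>x\<in>V. \<forall>y\<in>V. R x y = ((g \<circ> \<phi>) x = (g \<circ> \<phi>) y)"
      using eq g(2) by (auto simp: inj_on_eq_iff)
    have "dist3 V R = 0" unfolding dist3_eq_0_iff[OF V] by (rule bexI[of _ "g \<circ> \<phi>"], rule g2, rule g1)
    then show False using far by simp
  qed
  have "homs V R = homs V (same \<phi>)" using eq by (rule homs_cong)
  moreover have "dist3 V R = dist3 V (same \<phi>)"
  proof -
    have "mismatches V R \<psi> = mismatches V (same \<phi>) \<psi>" for \<psi>
      using eq by (auto simp: mismatches_def)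
    then show ?thesis by (simp add: dist3_def)
  qed
  moreover have "twins V R = twins V (same \<phi>)"
    using eq by (auto simp: twins_def)
  ultimately have "\<exists>R'. reflp R' \<and> symp R' \<and> potential V R < potential V R' \<and>
    card (homs V R) \<le> card (homs V R') \<and>
    (real (dist3 V R) \<le> dist3 V R' + 2 * \<theta> * real (card V) ^ 2 \<or>
     real (card (homs V R)) + 4 * \<theta> ^ 6 * real (card V) ^ 6 \<le> card (homs V R'))"
    using improve_by_merging[OF V four \<theta>] by (simp add: potential_def)
  then show ?thesis by (smt (verit) of_nat_0_le_iff)
qed

lemma sum_part_sizes:
  fixes \<phi> :: "'a \<Rightarrow> nat"
  assumes V: "finite V" and \<phi>: "\<phi> \<in> V \<rightarrow> {..<3}"
  shows "card {x \<in> V. \<phi> x = 0} + card {x \<in> V. \<phi> x = 1} + card {x \<in> V. \<phi> x = 2} = card V"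
proof -
  have "V = (\<Union>i<3. {x \<in> V. \<phi> x = i})" using \<phi> by auto
  then have "card V = card (\<Union>i<3. {x \<in> V. \<phi> x = i})" by simp
  also have "\<dots> = (\<Sum>i<3. card {x \<in> V. \<phi> x = i})"
    by (rule card_UN_disjoint) (use V in auto)
  finally show ?thesis by (simp add: less3)
qed

lemma homs_three_parts:
  fixes \<phi> :: "'a \<Rightarrow> nat"
  assumes V: "finite V" "V \<noteq> {}" and \<phi>: "\<phi> \<in> V \<rightarrow> {..<3}" and i: "i < 3"
  shows "real (card (homs V (same \<phi>))) \<le> 2 / 243 * real (card V) ^ 6
    - (card {x \<in> V. \<phi> x = i} - card V / 3)\<^sup>2 * real (card V) ^ 4 / 162"
proof -
  define c where "c = (\<lambda>i. real (card {x \<in> V. \<phi> x = i}))"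
  have n: "card V > 0" using V by (simp add: card_gt_0_iff)
  have "c 0 + c 1 + c 2 = card V"
    using sum_part_sizes[OF V(1) \<phi>] unfolding c_def by linarith
  then have "distinct_sum {..<3} c \<le> 2 / 243 * real (card V) ^ 6 - (c i - card V / 3)\<^sup>2 * real (card V) ^ 4 / 162"
    using n i by (intro three_part_stability_scaled) (auto simp: c_def)
  then show ?thesis
    using card_homs_same[OF V(1) finite_lessThan \<phi>] by (simp add: c_def)
qed

text \<open>A relation of largest potential among those with at least as many placements as \<open>R\<close> admits no improvement,
so it consists of at most three cliques.\<close>

lemma homs_bound:
  assumes V: "finite V" and R: "reflp R" "symp R"
  shows "real (card (homs V R)) \<le> 2 / 243 * real (card V) ^ 6"
proof (cases "V = {}")
  case True
  then show ?thesis using card_homs_le[OF V, of R] by simp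
next
  case False
  let ?P = "\<lambda>R'. reflp R' \<and> symp R' \<and> card (homs V R) \<le> card (homs V R')"
  obtain R' where R': "?P R'" and max: "\<And>R''. ?P R'' \<Longrightarrow> potential V R'' \<le> potential V R'"
  proof -
    have "?P R" using R by simp
    moreover have "\<forall>R'. ?P R' \<longrightarrow> potential V R' < Suc (card V ^ 6 * (card V ^ 2 + 1) + card V ^ 2)"
      using potential_bounded[OF V] le_imp_less_Suc by blast
    ultimately have "\<exists>R'. ?P R' \<and> (\<forall>R''. ?P R'' \<longrightarrow> potential V R'' \<le> potential V R')"
      by (rule ex_has_greatest_nat)
    then show ?thesis using that by blast
  qed
  have "dist3 V R' = 0"
  proof (rule ccontr)
    assume "dist3 V R' \<noteq> 0"
    then obtain R'' where "reflp R''" "symp R''" "potential V R' < potential V R''" "card (homs V R') \<le> card (homs V R'')"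
      using improve[OF V, of R' 0] R' by auto
    then show False using max[of R''] R' by auto
  qed
  then obtain \<phi> where \<phi>: "\<phi> \<in> V \<rightarrow> {..<3::nat}" "\<And>x y. x \<in> V \<Longrightarrow> y \<in> V \<Longrightarrow> R' x y = (\<phi> x = \<phi> y)"
    using dist3_eq_0_iff[OF V, of R'] by blast
  have "real (card (homs V R)) \<le> card (homs V R')" using R' by simp
  also have "homs V R' = homs V (same \<phi>)" using \<phi> by (intro homs_cong) auto
  also have "real (card \<dots>) \<le> 2 / 243 * real (card V) ^ 6
      - (card {x \<in> V. \<phi> x = 0} - card V / 3)\<^sup>2 * real (card V) ^ 4 / 162"
    by (rule homs_three_parts) (use V False \<phi> in auto)
  also have "\<dots> \<le> 2 / 243 * real (card V) ^ 6" by simp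
  finally show ?thesis .
qed

section \<open>Few mismatches at every vertex\<close>

lemma mismatches_sym:
  assumes "symp R" "(x, y) \<in> mismatches V R \<phi>"
  shows "(y, x) \<in> mismatches V R \<phi>"
  using assms unfolding mismatches_def symp_def by auto

lemma mismatches_irrefl: "reflp R \<Longrightarrow> (x, x) \<notin> mismatches V R \<phi>"
  by (auto simp: mismatches_def reflp_def)

text \<open>No induced copy of \<open>F17\<close> arises from a union of at most three cliques by changing exactly one pair. If the component of
one of its two vertices has a further vertex \<open>r\<close>, transitivity at \<open>r\<close> yields a second mismatch. This leaves the two
ends of the isolated edge, and separating them would require four cliques.\<close>

lemma no_single_mismatch:
  fixes \<psi> :: "nat \<Rightarrow> nat"
  assumes lt: "\<And>p. p < 6 \<Longrightarrow> \<psi> p < 3" and p: "p < 6" and q: "q < 6"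
    and ne: "(\<psi> p = \<psi> q) \<noteq> (component p = component q)"
  shows "\<exists>p'<6. \<exists>q'<6. {p', q'} \<noteq> {p, q} \<and> (\<psi> p' = \<psi> q') \<noteq> (component p' = component q')"
proof (rule ccontr)
  assume "\<not> ?thesis"
  then have eq: "\<psi> a = \<psi> b \<longleftrightarrow> component a = component b" if "a < 6" "b < 6" "{a, b} \<noteq> {p, q}" for a b
    using that by blast
  have pq: "p \<noteq> q" using ne by auto
  have third: False if r: "r < 6" "r \<noteq> p" "r \<noteq> q" "component r = component p \<or> component r = component q" for r
  proof -
    have "\<psi> r = \<psi> p \<longleftrightarrow> component r = component p" "\<psi> r = \<psi> q \<longleftrightarrow> component r = component q"
      using eq[of r p] eq[of r q] r p q by (auto simp: doubleton_eq_iff)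
    then show False using r(4) ne by auto
  qed
  have "p \<in> {0, 1, 2, 3, 4, 5}" "q \<in> {0, 1, 2, 3, 4, 5}"
    using p q unfolding less6[symmetric] by auto
  then have "{p, q} = {4, 5}"
    using third[of 0] third[of 1] third[of 3] third[of 4] third[of 5] pq
    by (auto simp: component_def)
  moreover have "\<psi> 0 < 3" "\<psi> 2 < 3" "\<psi> 4 < 3" "\<psi> 5 < 3" using lt by auto
  moreover have "\<psi> 0 \<noteq> \<psi> 2" "\<psi> 0 \<noteq> \<psi> 4" "\<psi> 0 \<noteq> \<psi> 5" "\<psi> 2 \<noteq> \<psi> 4" "\<psi> 2 \<noteq> \<psi> 5"
    using eq[of 0 2] eq[of 0 4] eq[of 0 5] eq[of 2 4] eq[of 2 5] \<open>{p, q} = {4, 5}\<close>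
    by (auto simp: component_def doubleton_eq_iff)
  moreover have "\<psi> 4 \<noteq> \<psi> 5" using ne \<open>{p, q} = {4, 5}\<close> by (auto simp: component_def doubleton_eq_iff)
  ultimately show False by linarith
qed

definition bad_maps :: "(nat \<Rightarrow> 'a) set \<Rightarrow> ('a \<times> 'a) set \<Rightarrow> (nat \<Rightarrow> 'a) set" where
  "bad_maps F B = {f \<in> F. \<exists>p<6. \<exists>q<6. (f p, f q) \<in> B}"

lemma card_bad_maps_le:
  assumes V: "finite V" and R: "reflp R" and F: "F \<subseteq> maps V"
  shows "card (bad_maps F (mismatches V R \<phi>)) \<le> 36 * (card (mismatches V R \<phi>) * card V ^ 4)"
proof -
  let ?B = "mismatches V R \<phi>"
  let ?X = "(\<lambda>(x, y). [x, y]) ` ?B"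
  have "bad_maps F ?B \<subseteq> confined V ?X"
  proof
    fix f assume f: "f \<in> bad_maps F ?B"
    then obtain p q where pq: "p < 6" "q < 6" "(f p, f q) \<in> ?B" by (auto simp: bad_maps_def)
    then have "p \<noteq> q" using mismatches_irrefl[OF R] by metis
    moreover have "map f [p, q] \<in> ?X" using pq by force
    ultimately show "f \<in> confined V ?X"
      using f pq F by (intro confinedI[of _ _ "[p, q]"]) (auto simp: bad_maps_def)
  qed
  then have "card (bad_maps F ?B) \<le> card (confined V ?X)" by (rule card_mono[OF finite_confined[OF V]])
  also have "\<dots> \<le> 6 ^ 2 * (card ?B * card V ^ (6 - 2))"
    by (rule card_confined_le) (use V finite_mismatches[OF V] card_image_le in auto)
  finally show ?thesis by simp
qed

lemma embs_maps: "embs V R \<subseteq> maps V"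
  by (auto simp: embs_def homs_def)

lemma good_maps_eq:
  "embs V R - bad_maps (embs V R) (mismatches V R \<phi>)
   = embs V (same \<phi>) - bad_maps (embs V (same \<phi>)) (mismatches V R \<phi>)"
proof -
  have "R (f p) (f q) = (\<phi> (f p) = \<phi> (f q))"
    if "f \<in> maps V" "\<And>p q. p < 6 \<Longrightarrow> q < 6 \<Longrightarrow> (f p, f q) \<notin> mismatches V R \<phi>" "p < 6" "q < 6" for f p q
    using that(2)[OF that(3,4)] that(1,3,4) by (auto simp: mismatches_def PiE_iff)
  then show ?thesis
    unfolding embs_def homs_def bad_maps_def by auto
qed

text \<open>The loss through mismatches is of second order: a copy with one mismatched pair has another one, which either
shares a vertex with the first (at most \<open>m\<close> choices for the second pair) or is disjoint from it.\<close>

lemma bad_embs_le: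
  assumes V: "finite V" and R: "reflp R" "symp R" and \<phi>: "\<phi> \<in> V \<rightarrow> {..<3}"
    and deg: "\<And>x. x \<in> V \<Longrightarrow> card {y. (x, y) \<in> mismatches V R \<phi>} \<le> m"
  defines "B \<equiv> mismatches V R \<phi>"
  shows "card (bad_maps (embs V R) B) \<le> 216 * (card B * m * card V ^ 3) + 1296 * (card B * card B * card V ^ 2)"
proof -
  have finB: "finite B" unfolding B_def by (rule finite_mismatches[OF V])
  have sym: "(y, x) \<in> B" if "(x, y) \<in> B" for x y
    using mismatches_sym[OF R(2)] that unfolding B_def by metis
  have irr: "(x, x) \<notin> B" for x unfolding B_def by (rule mismatches_irrefl[OF R(1)])
  let ?X = "(\<lambda>((x, y), z). [x, y, z]) ` (SIGMA e:B. {z. (fst e, z) \<in> B})"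
  let ?Y = "(\<lambda>((x, y), (z, w)). [x, y, z, w]) ` (B \<times> B)"
  have finz: "finite {z. (x, z) \<in> B}" for x
    by (rule finite_subset[of _ "snd ` B"]) (use finB in force)+
  have X: "finite ?X" "card ?X \<le> card B * m"
  proof -
    show "finite ?X" using finB finz by auto
    have "card ?X \<le> card (SIGMA e:B. {z. (fst e, z) \<in> B})"
      by (rule card_image_le) (use finB finz in auto)
    also have "\<dots> = (\<Sum>e\<in>B. card {z. (fst e, z) \<in> B})" using finB finz by simp
    also have "\<dots> \<le> card B * m"
      using sum_bounded_above[of B "\<lambda>e. card {z. (fst e, z) \<in> B}" m] deg
      by (auto simp: B_def mismatches_def)
    finally show "card ?X \<le> card B * m" .
  qed
  have Y: "finite ?Y" "card ?Y \<le> card B * card B"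
    using finB card_image_le[of "B \<times> B" "\<lambda>((x, y), (z, w)). [x, y, z, w]"]
    by (auto simp: card_cartesian_product)
  have "bad_maps (embs V R) B \<subseteq> confined V ?X \<union> confined V ?Y"
  proof
    fix f assume f: "f \<in> bad_maps (embs V R) B"
    then obtain p q where pq: "p < 6" "q < 6" "(f p, f q) \<in> B" and fe: "f \<in> embs V R"
      by (auto simp: bad_maps_def)
    have fV: "f \<in> maps V" using fe embs_maps by blast
    have iff: "(f a, f b) \<in> B \<longleftrightarrow> (\<phi> (f a) = \<phi> (f b)) \<noteq> (component a = component b)" if "a < 6" "b < 6" for a b
      using fe fV that by (auto simp: B_def mismatches_def embs_def homs_def)
    have "\<phi> (f a) < 3" if "a < 6" for a using \<phi> fV that by (auto simp: PiE_iff)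
    then have "\<exists>p'<6. \<exists>q'<6. {p', q'} \<noteq> {p, q} \<and> (\<phi> (f p') = \<phi> (f q')) \<noteq> (component p' = component q')"
      using no_single_mismatch[of "\<lambda>a. \<phi> (f a)" p q] pq iff by auto
    then obtain p' q' where pq': "p' < 6" "q' < 6" "{p', q'} \<noteq> {p, q}" "(f p', f q') \<in> B"
      using iff by auto
    have ne: "p \<noteq> q" "p' \<noteq> q'" using pq(3) pq'(4) irr by auto
    have share: "f \<in> confined V ?X" if "a < 6" "b < 6" "c < 6" "a \<noteq> b" "a \<noteq> c" "b \<noteq> c" "(f a, f b) \<in> B" "(f a, f c) \<in> B" for a b c
    proof -
      have "map f [a, b, c] \<in> ?X" using that by (auto intro!: image_eqI[of _ _ "((f a, f b), f c)"])
      then show ?thesis using that fV by (intro confinedI[of _ _ "[a, b, c]"]) auto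
    qed
    show "f \<in> confined V ?X \<union> confined V ?Y"
    proof (cases "{p, q} \<inter> {p', q'} = {}")
      case True
      have "map f [p, q, p', q'] \<in> ?Y"
        using pq pq' by (auto intro!: image_eqI[of _ _ "((f p, f q), (f p', f q'))"])
      then have "f \<in> confined V ?Y" using True ne pq pq' fV
        by (intro confinedI[of _ _ "[p, q, p', q']"]) auto
      then show ?thesis by simp
    next
      case False
      then consider "p = p'" | "p = q'" | "q = p'" | "q = q'" by auto
      then have "f \<in> confined V ?X"
      proof cases
        case 1
        then have "q \<noteq> q'" using pq'(3) by auto
        then show ?thesis using share[of p q q'] pq pq' ne 1 by simp
      next
        case 2
        then have "q \<noteq> p'" using pq'(3) by auto
        then show ?thesis using share[of p q p'] sym[OF pq'(4)] pq pq' ne 2 by simp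
      next
        case 3
        then have "p \<noteq> q'" using pq'(3) by auto
        then show ?thesis using share[of q p q'] sym[OF pq(3)] pq pq' ne 3 by simp
      next
        case 4
        then have "p \<noteq> p'" using pq'(3) by auto
        then show ?thesis using share[of q p p'] sym[OF pq(3)] sym[OF pq'(4)] pq pq' ne 4 by simp
      qed
      then show ?thesis by simp
    qed
  qed
  then have "card (bad_maps (embs V R) B) \<le> card (confined V ?X \<union> confined V ?Y)"
    by (rule card_mono[rotated]) (simp add: finite_confined V)
  also have "\<dots> \<le> card (confined V ?X) + card (confined V ?Y)" by (rule card_Un_le)
  also have "\<dots> \<le> 6 ^ 3 * (card B * m * card V ^ (6 - 3)) + 6 ^ 4 * (card B * card B * card V ^ (6 - 4))"
    by (intro add_mono card_confined_le V X Y) auto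
  finally show ?thesis by simp
qed

lemma three_disjoint_subsets:
  assumes "3 * s \<le> card A"
  obtains A1 A2 A3 where "A1 \<subseteq> A" "A2 \<subseteq> A" "A3 \<subseteq> A" "A1 \<inter> A2 = {}" "A1 \<inter> A3 = {}" "A2 \<inter> A3 = {}"
    "card A1 = s" "card A2 = s" "card A3 = s" "finite A1" "finite A2" "finite A3"
proof -
  obtain A1 where A1: "A1 \<subseteq> A" "card A1 = s" "finite A1"
    using obtain_subset_with_card_n[of s A] assms by auto
  have "card (A - A1) \<ge> 2 * s" using card_Diff_subset[OF A1(3,1)] A1(2) assms by linarith
  then obtain A2 where A2: "A2 \<subseteq> A - A1" "card A2 = s" "finite A2"
    using obtain_subset_with_card_n[of s "A - A1"] by auto
  have "card (A - A1 - A2) \<ge> s"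
    using card_Diff_subset[OF A2(3,1)] A2(2) \<open>card (A - A1) \<ge> 2 * s\<close> by linarith
  then obtain A3 where A3: "A3 \<subseteq> A - A1 - A2" "card A3 = s" "finite A3"
    using obtain_subset_with_card_n[of s "A - A1 - A2"] by auto
  show ?thesis by (rule that[of A1 A2 A3]) (use A1 A2 A3 in auto)
qed

text \<open>Choosing the six values from disjoint sets makes injectivity automatic, which is enough for lower bounds up
to a constant factor.\<close>

lemma disjoint_choices_embs:
  assumes S: "\<And>p. p < 6 \<Longrightarrow> S p \<subseteq> V" "\<And>p q. p < 6 \<Longrightarrow> q < 6 \<Longrightarrow> p \<noteq> q \<Longrightarrow> S p \<inter> S q = {}"
    and \<phi>: "\<And>p x. p < 6 \<Longrightarrow> x \<in> S p \<Longrightarrow> \<phi> x = t (component p)" and t: "inj_on t {..<3}"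
  shows "PiE {..<6} S \<subseteq> embs V (same \<phi>)"
proof
  fix f assume f: "f \<in> PiE {..<6} S"
  have fS: "f p \<in> S p" if "p < 6" for p using f that by auto
  have c3: "component p < 3" for p by (simp add: component_def)
  have "\<phi> (f p) = \<phi> (f q) \<longleftrightarrow> component p = component q" if "p < 6" "q < 6" for p q
    using \<phi>[OF that(1) fS[OF that(1)]] \<phi>[OF that(2) fS[OF that(2)]] t c3 by (simp add: inj_on_eq_iff)
  moreover have "inj_on f {..<6}"
  proof (rule inj_onI)
    fix p q :: nat assume pq: "p \<in> {..<6}" "q \<in> {..<6}" "f p = f q"
    then have "f p \<in> S p \<inter> S q" using fS[of p] fS[of q] by simp
    then show "p = q" using S(2)[of p q] pq by auto
  qed
  moreover have "f \<in> maps V" using f fS S(1) by (auto simp: PiE_iff)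
  ultimately show "f \<in> embs V (same \<phi>)" by (simp add: embs_def homs_def)
qed

lemma disjoint_choices_through:
  assumes V: "finite V" and S: "\<And>p q. p < 6 \<Longrightarrow> q < 6 \<Longrightarrow> p \<noteq> q \<Longrightarrow> S p \<inter> S q = {}"
    and \<phi>: "\<And>p. p < 6 \<Longrightarrow> S p \<subseteq> {x \<in> V. \<phi> x = t (component p)}" and t: "inj_on t {..<3}"
    and u: "u < 6" "S u = {x}" and v: "v < 6" "S v = {y}"
  shows "(\<Prod>p<6. card (S p)) \<le> card {f \<in> embs V (same \<phi>). f u = x \<and> f v = y}"
proof -
  have sub: "PiE {..<6} S \<subseteq> embs V (same \<phi>)"
    by (rule disjoint_choices_embs[OF _ S _ t]) (use \<phi> in blast)+
  have "(\<Prod>p<6. card (S p)) = card (PiE {..<6} S)" by (simp add: card_PiE)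
  also have "\<dots> \<le> card {f \<in> embs V (same \<phi>). f u = x \<and> f v = y}"
  proof (rule card_mono)
    show "finite {f \<in> embs V (same \<phi>). f u = x \<and> f v = y}" using finite_embs[OF V] by simp
    have "f u = x \<and> f v = y" if "f \<in> PiE {..<6} S" for f
      using PiE_mem[OF that, of u] PiE_mem[OF that, of v] u v by simp
    then show "PiE {..<6} S \<subseteq> {f \<in> embs V (same \<phi>). f u = x \<and> f v = y}" using sub by blast
  qed
  finally show ?thesis .
qed

text \<open>Every mismatched pair lies in many copies in the union of three cliques: a pair inside a clique can serve as the
isolated edge of \<open>F17\<close>, and a pair between two cliques as one end of this edge together with the isolated
vertex.\<close>

lemma embs_through_pair:
  fixes \<phi> :: "'a \<Rightarrow> nat"
  assumes V: "finite V" and \<phi>: "\<phi> \<in> V \<rightarrow> {..<3}"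
    and large: "\<And>i. i < 3 \<Longrightarrow> 3 * s + 1 \<le> card {x \<in> V. \<phi> x = i}"
    and xy: "x \<in> V" "y \<in> V" "x \<noteq> y"
  shows "s ^ 4 \<le> card {f \<in> embs V (same \<phi>). f 4 = x \<and> f (if \<phi> x = \<phi> y then 5 else 2) = y}"
proof -
  let ?P = "\<lambda>i. {x \<in> V. \<phi> x = i}"
  define i where "i = \<phi> x"
  define k where "k = (if \<phi> x = \<phi> y then if i = 0 then 1 else 0 else \<phi> y)"
  (* i, j, k are the three parts, to receive the edge, the triangle and the vertex *)
  define j where "j = 3 - i - k"
  have "i < 3" "k < 3" "i \<noteq> k" using \<phi> xy by (auto simp: i_def k_def)
  then have "(i = 0 \<or> i = 1 \<or> i = 2) \<and> (k = 0 \<or> k = 1 \<or> k = 2)" by linarith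
  then have ijk: "i < 3" "j < 3" "k < 3" "i \<noteq> k" "j \<noteq> i" "j \<noteq> k" using \<open>i \<noteq> k\<close> by (auto simp: j_def)
  obtain A1 A2 A3 where A: "A1 \<subseteq> ?P j" "A2 \<subseteq> ?P j" "A3 \<subseteq> ?P j"
    "A1 \<inter> A2 = {}" "A1 \<inter> A3 = {}" "A2 \<inter> A3 = {}" "card A1 = s" "card A2 = s" "card A3 = s"
    by (rule three_disjoint_subsets[of s "?P j"]) (use large[OF ijk(2)] in auto)
  have ex: "\<exists>C. C \<subseteq> ?P l - {x} \<and> card C = s" if "l < 3" for l
  proof -
    have "s \<le> card (?P l - {x})"
      using large[OF that] card_Diff_singleton_if[of "?P l" x] by (auto split: if_splits)
    from obtain_subset_with_card_n[OF this] show ?thesis by blast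
  qed
  obtain Ci where Ci: "Ci \<subseteq> ?P i - {x}" "card Ci = s" using ex[OF ijk(1)] by blast
  obtain Ck where Ck: "Ck \<subseteq> ?P k - {x}" "card Ck = s" using ex[OF ijk(3)] by blast
  define S where "S p = (if \<phi> x = \<phi> y then [A1, A2, Ck, A3, {x}, {y}] else [A1, A2, {y}, A3, {x}, Ci]) ! p" for p
  have P: "A1 \<subseteq> ?P j" "A2 \<subseteq> ?P j" "A3 \<subseteq> ?P j" "Ci \<subseteq> ?P i" "Ck \<subseteq> ?P k" "x \<in> ?P i" "\<phi> x = \<phi> y \<Longrightarrow> y \<in> ?P i"
    "\<phi> x \<noteq> \<phi> y \<Longrightarrow> y \<in> ?P k"
    using A Ci Ck xy by (auto simp: i_def k_def)
  have sub: "\<forall>p<6. S p \<subseteq> ?P ([j, i, k] ! component p)"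
    unfolding all_less6 using P by (simp add: S_def component_def)
  have other: "S p \<inter> S q = {}" if "p < 6" "q < 6" "component p \<noteq> component q" for p q
  proof -
    have "component p = 0 \<or> component p = 1 \<or> component p = 2" for p by (simp add: component_def)
    from this[of p] this[of q] have ne: "[j, i, k] ! component p \<noteq> [j, i, k] ! component q" using that(3) ijk by auto
    have "\<phi> z = [j, i, k] ! component p" if "z \<in> S p" for z using sub[rule_format, OF \<open>p < 6\<close>] that by auto
    moreover have "\<phi> z = [j, i, k] ! component q" if "z \<in> S q" for z using sub[rule_format, OF \<open>q < 6\<close>] that by auto
    ultimately show ?thesis using ne by (metis disjoint_iff)
  qed
  have "x \<notin> Ci" using Ci by blast
  have "\<forall>p<6. \<forall>q<6. p \<noteq> q \<and> component p = component q \<longrightarrow> S p \<inter> S q = {}"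
    unfolding all_less6 using A(4-6) xy(3) \<open>x \<notin> Ci\<close> by (simp add: S_def component_def Int_commute)
  then have disj: "S p \<inter> S q = {}" if "p < 6" "q < 6" "p \<noteq> q" for p q using other that by blast
  have "s ^ 4 = (\<Prod>p<6. card (S p))"
    using A Ci Ck by (simp add: less6 S_def eval_nat_numeral)
  also have "\<dots> \<le> card {f \<in> embs V (same \<phi>). f 4 = x \<and> f (if \<phi> x = \<phi> y then 5 else 2) = y}"
  proof (rule disjoint_choices_through[OF V disj, where t = "\<lambda>c. [j, i, k] ! c"])
    show "S p \<subseteq> ?P ([j, i, k] ! component p)" if "p < 6" for p using sub that by blast
    show "inj_on (\<lambda>c. [j, i, k] ! c) {..<3}" using ijk by (auto simp: inj_on_def less3)
  qed (auto simp: S_def)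
  finally show ?thesis .
qed

lemma card_maps_through_pairs:
  assumes F: "finite F" and B: "finite B" and pq: "p < 6" "q < 6"
    and m: "\<And>x y. (x, y) \<in> B' \<Longrightarrow> m \<le> card {f \<in> F. f p = x \<and> f q = y}" and B': "B' \<subseteq> B"
  shows "card B' * m \<le> card (bad_maps F B)"
proof -
  have "card B' * m = (\<Sum>e\<in>B'. m)" by simp
  also have "\<dots> \<le> (\<Sum>e\<in>B'. card {f \<in> F. (f p, f q) = e})"
    by (rule sum_mono) (use m in auto)
  also have "\<dots> = card (\<Union>e\<in>B'. {f \<in> F. (f p, f q) = e})"
    using F finite_subset[OF B' B] by (intro card_UN_disjoint[symmetric]) auto
  also have "\<dots> \<le> card (bad_maps F B)"
    using F pq B' by (intro card_mono) (auto simp: bad_maps_def)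
  finally show ?thesis .
qed

text \<open>Repairing all mismatches gains to first order and loses only to second order. The factor \<open>2\<close> arises as
pairs inside a clique and pairs between cliques are counted separately.\<close>

lemma flat_gain:
  assumes V: "finite V" and R: "reflp R" "symp R" and \<phi>: "\<phi> \<in> V \<rightarrow> {..<3}"
    and deg: "\<And>x. x \<in> V \<Longrightarrow> card {y. (x, y) \<in> mismatches V R \<phi>} \<le> m"
    and large: "\<And>i. i < 3 \<Longrightarrow> 3 * s + 1 \<le> card {x \<in> V. \<phi> x = i}"
  defines "b \<equiv> card (mismatches V R \<phi>)"
  shows "2 * card (embs V R) + b * s ^ 4
    \<le> 2 * card (embs V (same \<phi>)) + 2 * (216 * (b * m * card V ^ 3) + 1296 * (b * b * card V ^ 2))"
proof -
  let ?B = "mismatches V R \<phi>"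
  let ?P = "embs V (same \<phi>)"
  let ?in = "{(x, y) \<in> ?B. \<phi> x = \<phi> y}" and ?out = "{(x, y) \<in> ?B. \<phi> x \<noteq> \<phi> y}"
  have finB: "finite ?B" by (rule finite_mismatches[OF V])
  have BV: "x \<in> V" "y \<in> V" "x \<noteq> y" if "(x, y) \<in> ?B" for x y
    using that R by (auto simp: mismatches_def reflp_def)
  have through_in: "s ^ 4 \<le> card {f \<in> ?P. f 4 = x \<and> f 5 = y}" if "(x, y) \<in> ?in" for x y
    using that BV[of x y] embs_through_pair[OF V \<phi> large, of x y] by simp
  have through_out: "s ^ 4 \<le> card {f \<in> ?P. f 4 = x \<and> f 2 = y}" if "(x, y) \<in> ?out" for x y
    using that BV[of x y] embs_through_pair[OF V \<phi> large, of x y] by simp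
  have "card ?in * s ^ 4 \<le> card (bad_maps ?P ?B)"
    by (rule card_maps_through_pairs[OF finite_embs[OF V] finB _ _ through_in]) auto
  moreover have "card ?out * s ^ 4 \<le> card (bad_maps ?P ?B)"
    by (rule card_maps_through_pairs[OF finite_embs[OF V] finB _ _ through_out]) auto
  moreover have "b = card ?in + card ?out"
  proof -
    have "?B = ?in \<union> ?out" "?in \<inter> ?out = {}" by auto
    then show ?thesis unfolding b_def using finB by (metis (no_types, lifting) card_Un_disjoint finite_Un)
  qed
  ultimately have 1: "b * s ^ 4 \<le> 2 * card (bad_maps ?P ?B)" by (simp add: add_mult_distrib)
  have split: "card E = card (E - bad_maps E ?B) + card (bad_maps E ?B)" if "finite E" for E
  proof -
    have "bad_maps E ?B \<subseteq> E" by (auto simp: bad_maps_def)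
    then show ?thesis using that by (metis add.commute card_Diff_subset card_mono finite_subset le_add_diff_inverse)
  qed
  have 2: "card (bad_maps (embs V R) ?B) \<le> 216 * (b * m * card V ^ 3) + 1296 * (b * b * card V ^ 2)"
    unfolding b_def by (rule bad_embs_le[OF V R \<phi> deg])
  show ?thesis
    using 1 2 split[OF finite_embs[OF V, of R]] split[OF finite_embs[OF V, of "same \<phi>"]]
      good_maps_eq[of V R \<phi>] by simp
qed

section \<open>A vertex with many mismatches\<close>

definition embs_at :: "'a set \<Rightarrow> ('a \<Rightarrow> 'a \<Rightarrow> bool) \<Rightarrow> 'a \<Rightarrow> (nat \<Rightarrow> 'a) set" where
  "embs_at V R x = {f \<in> embs V R. x \<in> f ` {..<6}}"

definition mismatches_off :: "'a set \<Rightarrow> ('a \<Rightarrow> 'a \<Rightarrow> bool) \<Rightarrow> ('a \<Rightarrow> nat) \<Rightarrow> 'a \<Rightarrow> ('a \<times> 'a) set" where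
  "mismatches_off V R \<phi> x = {(y, z) \<in> mismatches V R \<phi>. y \<noteq> x \<and> z \<noteq> x}"

definition perms3 :: "(nat \<times> nat \<times> nat) set" where
  "perms3 = {(0, 1, 2), (0, 2, 1), (1, 0, 2), (1, 2, 0), (2, 0, 1), (2, 1, 0)}"

text \<open>This counts the placements through a vertex \<open>x\<close> attached to three cliques, where \<open>x\<close> has \<open>a i\<close> neighbours and
\<open>z i\<close> non-neighbours in clique \<open>i\<close>. The summands stand for \<open>x\<close> in the triangle, at an end of the isolated
edge, and as the isolated vertex; in the last case the index \<open>k\<close> is that of the clique that receives
nothing.\<close>

definition attach :: "(nat \<Rightarrow> real) \<Rightarrow> (nat \<Rightarrow> real) \<Rightarrow> real" where
  "attach a z = (\<Sum>(i, j, k)\<in>perms3. 3 * a i ^ 2 * z j ^ 2 * z k + 2 * z i ^ 3 * a j * z k + z i ^ 3 * z j ^ 2)"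

lemma less3_cases: "i < (3::nat) \<longleftrightarrow> i = 0 \<or> i = 1 \<or> i = 2"
  by auto

lemma perms3_iff: "(i, j, k) \<in> perms3 \<longleftrightarrow> i < 3 \<and> j < 3 \<and> k < 3 \<and> i \<noteq> j \<and> i \<noteq> k \<and> j \<noteq> k"
  unfolding perms3_def less3_cases by auto

lemma sum_perms3: "(\<Sum>t\<in>perms3. g t) = g (0,1,2) + g (0,2,1) + g (1,0,2) + g (1,2,0) + g (2,0,1) + g (2,1,0)"
  unfolding perms3_def by (simp add: add.assoc)

lemma finite_perms3: "finite perms3"
  by (simp add: perms3_def)

lemma card_mismatches_at:
  assumes V: "finite V" "x \<in> V" and R: "reflp R" "symp R"
  shows "card (mismatches V R \<phi>) = card (mismatches_off V R \<phi> x) + 2 * card {y \<in> V - {x}. R x y \<noteq> (\<phi> x = \<phi> y)}"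
proof -
  let ?O = "mismatches_off V R \<phi> x" and ?D = "{y \<in> V - {x}. R x y \<noteq> (\<phi> x = \<phi> y)}"
  have sym: "R y x = R x y" for y using R(2) by (meson sympD)
  have "mismatches V R \<phi> = ?O \<union> ({x} \<times> ?D \<union> ?D \<times> {x})"
    using V R(1) sym by (auto simp: mismatches_def mismatches_off_def reflp_def)
  moreover have "?O \<inter> ({x} \<times> ?D \<union> ?D \<times> {x}) = {}" by (auto simp: mismatches_off_def)
  moreover have "({x} \<times> ?D) \<inter> (?D \<times> {x}) = {}" by auto
  moreover have "finite ?O"
    by (rule finite_subset[OF _ finite_mismatches[OF V(1)]]) (auto simp: mismatches_off_def)
  moreover have "finite ?D" using V by simp
  ultimately show ?thesis by (simp add: card_Un_disjoint card_cartesian_product)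
qed

lemma bad_at_le:
  assumes V: "finite V" and R: "reflp R"
  shows "card (bad_maps (embs_at V R' x) (mismatches_off V R \<phi> x)) \<le> 216 * (card (mismatches V R \<phi>) * card V ^ 3)"
proof -
  let ?B = "mismatches_off V R \<phi> x"
  have sub: "?B \<subseteq> mismatches V R \<phi>" by (auto simp: mismatches_off_def)
  have fin: "finite ?B" using finite_mismatches[OF V] sub by (rule finite_subset[rotated])
  let ?X = "(\<lambda>(y, z). [x, y, z]) ` ?B"
  have "bad_maps (embs_at V R' x) ?B \<subseteq> confined V ?X"
  proof
    fix f assume f: "f \<in> bad_maps (embs_at V R' x) ?B"
    then obtain p q where pq: "p < 6" "q < 6" "(f p, f q) \<in> ?B" by (auto simp: bad_maps_def)
    have "x \<in> f ` {..<6}" using f by (auto simp: bad_maps_def embs_at_def)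
    then obtain r where r: "r < 6" "f r = x" by auto
    have "p \<noteq> q" using pq(3) mismatches_irrefl[OF R] by (auto simp: mismatches_off_def)
    moreover have "r \<noteq> p" "r \<noteq> q" using pq(3) r by (auto simp: mismatches_off_def)
    moreover have "map f [r, p, q] \<in> ?X" using pq r by force
    moreover have "f \<in> maps V" using f embs_maps by (auto simp: bad_maps_def embs_at_def)
    ultimately show "f \<in> confined V ?X" using pq r by (intro confinedI[of _ _ "[r, p, q]"]) auto
  qed
  then have "card (bad_maps (embs_at V R' x) ?B) \<le> card (confined V ?X)"
    by (rule card_mono[OF finite_confined[OF V]])
  also have "\<dots> \<le> 6 ^ 3 * (card (mismatches V R \<phi>) * card V ^ (6 - 3))"
  proof (rule card_confined_le[OF V])
    show "card ?X \<le> card (mismatches V R \<phi>)"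
      using card_image_le[OF fin] card_mono[OF finite_mismatches[OF V] sub] by (rule order_trans)
  qed (use fin in auto)
  finally show ?thesis by simp
qed

text \<open>Outside the position \<open>r\<close> of the special vertex, a placement without mismatches sends the components to
distinct cliques. Representatives \<open>a\<close> and \<open>b\<close> of the two larger components can be chosen different
from \<open>r\<close>; if \<open>r\<close> is the isolated vertex, the remaining clique fills the third entry.\<close>

lemma good_at_pattern:
  fixes \<psi> :: "nat \<Rightarrow> nat"
  assumes r: "r < 6" and lt: "\<And>p. p < 6 \<Longrightarrow> \<psi> p < 3"
    and H: "\<And>p q. p < 6 \<Longrightarrow> q < 6 \<Longrightarrow> p \<noteq> r \<Longrightarrow> q \<noteq> r \<Longrightarrow> \<psi> p = \<psi> q \<longleftrightarrow> component p = component q"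
  obtains i j k where "(i, j, k) \<in> perms3" "\<And>p. p < 6 \<Longrightarrow> p \<noteq> r \<Longrightarrow> \<psi> p = [i, j, k] ! component p"
proof -
  define a where "a = (if r = 0 then 1 else 0 :: nat)"
  define b where "b = (if r = 4 then 5 else 4 :: nat)"
  define i where "i = \<psi> a"
  define j where "j = \<psi> b"
  define k where "k = (if r = 2 then 3 - i - j else \<psi> 2)"
  have ab: "a < 6" "a \<noteq> r" "component a = 0" "b < 6" "b \<noteq> r" "component b = 1"
    by (auto simp: a_def b_def component_def)
  have "i \<noteq> j" using H[of a b] ab by (simp add: i_def j_def)
  have ij: "i < 3" "j < 3" using lt ab by (auto simp: i_def j_def)
  have "(i, j, k) \<in> perms3"
  proof (cases "r = 2")
    case True
    then show ?thesis using ij \<open>i \<noteq> j\<close> unfolding perms3_iff less3_cases by (auto simp: k_def)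
  next
    case False
    then have "i \<noteq> k" "j \<noteq> k" using H[of a 2] H[of b 2] ab by (auto simp: i_def j_def k_def component_def)
    moreover have "k < 3" using False lt by (simp add: k_def)
    ultimately show ?thesis using ij \<open>i \<noteq> j\<close> by (simp add: perms3_iff)
  qed
  moreover have "\<psi> p = [i, j, k] ! component p" if p: "p < 6" "p \<noteq> r" for p
  proof -
    consider "component p = 0" | "component p = 1" | "p = 2" "component p = 2"
      by (cases "p = 2"; cases "p \<ge> 4") (auto simp: component_def)
    then show ?thesis
    proof cases
      case 1 then show ?thesis using H[of p a] p ab by (simp add: i_def)
    next
      case 2 then show ?thesis using H[of p b] p ab by (simp add: j_def)
    next
      case 3 then show ?thesis using p by (simp add: k_def)
    qed
  qed
  ultimately show ?thesis by (rule that)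
qed

lemma vertex_upper:
  assumes V: "finite V" "x \<in> V" and R: "reflp R" and \<phi>: "\<phi> \<in> V \<rightarrow> {..<3}"
  defines "a \<equiv> \<lambda>i. real (card {y \<in> V - {x}. \<phi> y = i \<and> R x y})"
    and "z \<equiv> \<lambda>i. real (card {y \<in> V. \<phi> y = i \<and> \<not> R x y})"
  shows "real (card (embs_at V R x)) \<le> attach a z + 216 * (card (mismatches V R \<phi>) * real (card V) ^ 3)"
proof -
  let ?B = "mismatches_off V R \<phi> x"
  define A where "A i = {y \<in> V - {x}. \<phi> y = i \<and> R x y}" for i
  define Z where "Z i = {y \<in> V. \<phi> y = i \<and> \<not> R x y}" for i
  define S where "S r t p = (if p = r then {x} else if component p = component r
    then A ((case t of (i, j, k) \<Rightarrow> [i, j, k]) ! component p)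
    else Z ((case t of (i, j, k) \<Rightarrow> [i, j, k]) ! component p))" for r p :: nat and t :: "nat \<times> nat \<times> nat"
  let ?J = "{..<6::nat} \<times> perms3"
  have cover: "embs_at V R x - bad_maps (embs_at V R x) ?B \<subseteq> (\<Union>(r, t)\<in>?J. PiE {..<6} (S r t))"
  proof
    fix f assume f: "f \<in> embs_at V R x - bad_maps (embs_at V R x) ?B"
    then have fe: "f \<in> embs V R" and good: "\<And>p q. p < 6 \<Longrightarrow> q < 6 \<Longrightarrow> (f p, f q) \<notin> ?B"
      by (auto simp: embs_at_def bad_maps_def)
    have fV: "f \<in> maps V" using fe embs_maps by blast
    have fin: "f p \<in> V" if "p < 6" for p using fV that by auto
    have fR: "R (f p) (f q) \<longleftrightarrow> component p = component q" if "p < 6" "q < 6" for p q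
      using fe that by (auto simp: embs_def homs_def)
    have inj: "inj_on f {..<6}" using fe by (simp add: embs_def)
    obtain r where r: "r < 6" "f r = x" using f by (auto simp: embs_at_def)
    have nx: "f p \<noteq> x" if "p < 6" "p \<noteq> r" for p using inj r that by (auto simp: inj_on_def)
    have H: "\<phi> (f p) = \<phi> (f q) \<longleftrightarrow> component p = component q"
      if "p < 6" "q < 6" "p \<noteq> r" "q \<noteq> r" for p q
      using good[OF that(1,2)] nx[OF that(1,3)] nx[OF that(2,4)] fR[OF that(1,2)] fin that
      by (auto simp: mismatches_off_def mismatches_def)
    have lt: "\<phi> (f p) < 3" if "p < 6" for p using fin[OF that] \<phi> by auto
    obtain i j k where t: "(i, j, k) \<in> perms3" "\<And>p. p < 6 \<Longrightarrow> p \<noteq> r \<Longrightarrow> \<phi> (f p) = [i, j, k] ! component p"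
      by (rule good_at_pattern[where \<psi> = "\<lambda>p. \<phi> (f p)" and r = r]) (use r lt H in auto)
    have "f \<in> PiE {..<6} (S r (i, j, k))"
    proof (rule PiE_I)
      fix p :: nat assume "p \<in> {..<6}"
      then have p: "p < 6" by simp
      have "R x (f p) \<longleftrightarrow> component r = component p" using fR[OF r(1) p] r(2) by simp
      then show "f p \<in> S r (i, j, k) p"
        using r(2) t(2)[OF p] nx[OF p] fin[OF p] by (auto simp: S_def A_def Z_def)
    next
      fix p :: nat assume "p \<notin> {..<6}" then show "f p = undefined" using fV by (rule PiE_arb[rotated])
    qed
    then show "f \<in> (\<Union>(r, t)\<in>?J. PiE {..<6} (S r t))" using r(1) t(1) by blast
  qed
  have finS: "finite (S r t p)" for r t p
    using V by (auto simp: S_def A_def Z_def)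
  have finE: "finite (embs_at V R x)"
    using finite_embs[OF V(1)] by (auto simp: embs_at_def)
  have "card (embs_at V R x) \<le> card (embs_at V R x - bad_maps (embs_at V R x) ?B) + card (bad_maps (embs_at V R x) ?B)"
  proof -
    have "embs_at V R x = (embs_at V R x - bad_maps (embs_at V R x) ?B) \<union> bad_maps (embs_at V R x) ?B"
      by (auto simp: bad_maps_def)
    then show ?thesis using card_Un_le by metis
  qed
  also have "\<dots> \<le> card (\<Union>(r, t)\<in>?J. PiE {..<6} (S r t)) + 216 * (card (mismatches V R \<phi>) * card V ^ 3)"
  proof (rule add_mono)
    have "finite (\<Union>(r, t)\<in>?J. PiE {..<6} (S r t))"
      using finite_perms3 finS by (auto intro!: finite_PiE)
    then show "card (embs_at V R x - bad_maps (embs_at V R x) ?B) \<le> card (\<Union>(r, t)\<in>?J. PiE {..<6} (S r t))"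
      using cover by (rule card_mono)
  qed (rule bad_at_le[OF V(1) R])
  finally have 1: "card (embs_at V R x) \<le> card (\<Union>(r, t)\<in>?J. PiE {..<6} (S r t))
    + 216 * (card (mismatches V R \<phi>) * card V ^ 3)" .
  have "card (\<Union>(r, t)\<in>?J. PiE {..<6} (S r t)) \<le> (\<Sum>(r, t)\<in>?J. card (PiE {..<6} (S r t)))"
    using card_UN_le[of ?J "\<lambda>(r, t). PiE {..<6} (S r t)"] finite_perms3 by (simp add: case_prod_unfold)
  with 1 have "card (embs_at V R x) \<le> (\<Sum>(r, t)\<in>?J. card (PiE {..<6} (S r t)))
    + 216 * (card (mismatches V R \<phi>) * card V ^ 3)" by linarith
  from of_nat_mono[OF this, where 'a = real]
  have "real (card (embs_at V R x)) \<le>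
      real (\<Sum>(r, t)\<in>?J. card (PiE {..<6} (S r t))) + 216 * (card (mismatches V R \<phi>) * real (card V) ^ 3)"
    unfolding of_nat_add of_nat_mult of_nat_power of_nat_numeral .
  also have "real (\<Sum>(r, t)\<in>?J. card (PiE {..<6} (S r t))) = (\<Sum>t\<in>perms3. \<Sum>r<6. real (\<Prod>p<6. card (S r t p)))"
    by (simp add: card_PiE flip: sum.cartesian_product) (rule sum.swap)
  also have "\<dots> = attach a z"
    unfolding attach_def
  proof (rule sum.cong[OF refl])
    fix t assume "t \<in> perms3"
    obtain i j k where t: "t = (i, j, k)" by (metis prod_cases3)
    have c: "real (card (A l)) = a l" "real (card (Z l)) = z l" for l
      by (auto simp: A_def Z_def a_def z_def)
    show "(\<Sum>r<6. real (\<Prod>p<6. card (S r t p)))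
      = (case t of (i, j, k) \<Rightarrow> 3 * a i ^ 2 * z j ^ 2 * z k + 2 * z i ^ 3 * a j * z k + z i ^ 3 * z j ^ 2)"
      unfolding t by (simp add: less6 S_def component_def c power2_eq_square power3_eq_cube)
  qed
  finally show ?thesis by simp
qed

lemma noninj_at_le:
  assumes V: "finite V"
  shows "card {f \<in> maps V. x \<in> f ` {..<6} \<and> \<not> inj_on f {..<6}} \<le> 252 * card V ^ 4" (is "card ?N \<le> _")
proof -
  let ?X = "(\<lambda>y. [x, y, y]) ` V" and ?Y = "{[x, x]}"
  have "?N \<subseteq> confined V ?X \<union> confined V ?Y"
  proof
    fix f assume f: "f \<in> ?N"
    then have fV: "f \<in> maps V" by simp
    obtain r where r: "r < 6" "f r = x" using f by auto
    obtain p q where pq: "p < 6" "q < 6" "p \<noteq> q" "f p = f q" using f by (auto simp: inj_on_def)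
    show "f \<in> confined V ?X \<union> confined V ?Y"
    proof (cases "f p = x")
      case True
      then have "f \<in> confined V ?Y" using pq fV by (intro confinedI[of _ _ "[p, q]"]) auto
      then show ?thesis by simp
    next
      case False
      have "f p \<in> V" using fV pq by auto
      then have "map f [r, p, q] \<in> ?X" using pq r by auto
      moreover have "r \<noteq> p" "r \<noteq> q" using False r pq by auto
      ultimately have "f \<in> confined V ?X" using pq r fV by (intro confinedI[of _ _ "[r, p, q]"]) auto
      then show ?thesis by simp
    qed
  qed
  then have "card ?N \<le> card (confined V ?X \<union> confined V ?Y)"
    by (rule card_mono[rotated]) (simp add: finite_confined V)
  also have "\<dots> \<le> card (confined V ?X) + card (confined V ?Y)" by (rule card_Un_le)
  also have "\<dots> \<le> 6 ^ 3 * (card V * card V ^ (6 - 3)) + 6 ^ 2 * (1 * card V ^ (6 - 2))"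
    by (intro add_mono card_confined_le V) (auto simp: V card_image_le)
  also have "card V * card V ^ (6 - 3) = card V ^ 4"
    by (simp add: power3_eq_cube power4_eq_xxxx)
  finally show ?thesis by simp
qed

text \<open>In the union of cliques, \<open>x\<close> can take each of the six roles, and then there are two ways to distribute the other
two components. These twelve families are disjoint up to maps that are not injective.\<close>

lemma vertex_lower:
  fixes \<phi> :: "'a \<Rightarrow> nat" and m :: real
  assumes V: "finite V" "x \<in> V" and \<phi>: "\<phi> \<in> V \<rightarrow> {..<3}"
    and m: "0 \<le> m" "\<And>i. i < 3 \<Longrightarrow> m \<le> card {y \<in> V. \<phi> y = i}"
  shows "12 * m ^ 5 \<le> card (embs_at V (same \<phi>) x) + 3024 * real (card V) ^ 4"
proof -
  define P where "P i = {y \<in> V. \<phi> y = i}" for i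
  define S where "S e p = (case e of (r, i, j, k) \<Rightarrow> if p = r then {x} else P ([i, j, k] ! component p))"
    for e :: "nat \<times> nat \<times> nat \<times> nat" and p :: nat
  define J where "J = {(r, i, j, k). r < 6 \<and> (i, j, k) \<in> perms3 \<and> [i, j, k] ! component r = \<phi> x}"
  define N where "N = {f \<in> maps V. x \<in> f ` {..<6} \<and> \<not> inj_on f {..<6}}"
  have J: "finite J" "card J = 12"
  proof -
    have eq: "J = (SIGMA r:{..<6}. {t \<in> perms3. (case t of (i, j, k) \<Rightarrow> [i, j, k]) ! component r = \<phi> x})"
      by (auto simp: J_def)
    show "finite J" unfolding eq using finite_perms3 by auto
    have "card J = (\<Sum>r<6. card {t \<in> perms3. (case t of (i, j, k) \<Rightarrow> [i, j, k]) ! component r = \<phi> x})"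
      unfolding eq using finite_perms3 by simp
    also have "\<dots> = (\<Sum>r<6::nat. 2)"
    proof (rule sum.cong[OF refl])
      fix r :: nat
      have two: "card {t \<in> perms3. (case t of (i, j, k) \<Rightarrow> [i, j, k]) ! c = l} = 2" if "c < 3" "l < 3" for c l
      proof -
        have "card {t \<in> perms3. (case t of (i, j, k) \<Rightarrow> [i, j, k]) ! c = l}
          = (\<Sum>t\<in>perms3. if (case t of (i, j, k) \<Rightarrow> [i, j, k]) ! c = l then 1 else 0)"
          unfolding card_eq_sum by (rule sum.inter_filter[OF finite_perms3])
        also have "\<dots> = 2"
          using that unfolding less3_cases sum_perms3 by (elim disjE) simp_all
        finally show ?thesis .
      qed
      have "component r < 3" by (simp add: component_def)
      moreover have "\<phi> x < 3" using V \<phi> by auto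
      ultimately show "card {t \<in> perms3. (case t of (i, j, k) \<Rightarrow> [i, j, k]) ! component r = \<phi> x} = 2"
        by (rule two)
    qed
    finally show "card J = 12" by simp
  qed
  have Sphi: "S e p \<subseteq> {y \<in> V. \<phi> y = (case e of (r, i, j, k) \<Rightarrow> [i, j, k]) ! component p}" if "e \<in> J" for e p
    using that V by (auto simp: J_def S_def P_def split: if_splits)
  have finS: "finite (S e p)" for e p using V by (auto simp: S_def P_def split: prod.splits)
  have inE: "PiE {..<6} (S e) - N \<subseteq> embs_at V (same \<phi>) x" if e: "e \<in> J" for e
  proof
    fix f assume f: "f \<in> PiE {..<6} (S e) - N"
    obtain r i j k where e': "e = (r, i, j, k)" by (metis prod_cases4)
    have p3: "(i, j, k) \<in> perms3" and r: "r < 6" using e e' by (auto simp: J_def)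
    have fp: "f p \<in> V" "\<phi> (f p) = [i, j, k] ! component p" if "p < 6" for p
      using Sphi[OF e, of p] f that by (auto simp: e' PiE_iff)
    have fV: "f \<in> maps V" using f fp by (auto simp: PiE_iff)
    have "[i, j, k] ! component p = [i, j, k] ! component q \<longleftrightarrow> component p = component q" for p q
      using p3 by (auto simp: perms3_iff component_def)
    then have "f \<in> homs V (same \<phi>)" using fV fp by (simp add: homs_def)
    moreover have "f r \<in> S e r" using f r by (auto simp: PiE_iff)
    then have "x \<in> f ` {..<6}" using r by (auto simp: S_def e')
    moreover have "inj_on f {..<6}" using f fV \<open>x \<in> f ` {..<6}\<close> by (auto simp: N_def)
    ultimately show "f \<in> embs_at V (same \<phi>) x" by (simp add: embs_at_def embs_def)
  qed
  have disj: "(PiE {..<6} (S e) - N) \<inter> (PiE {..<6} (S e') - N) = {}" if e: "e \<in> J" "e' \<in> J" "e \<noteq> e'" for e e'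
  proof (rule ccontr)
    assume "(PiE {..<6} (S e) - N) \<inter> (PiE {..<6} (S e') - N) \<noteq> {}"
    then obtain f where f: "f \<in> PiE {..<6} (S e) - N" "f \<in> PiE {..<6} (S e') - N" by blast
    obtain r i j k where ee: "e = (r, i, j, k)" by (metis prod_cases4)
    obtain r' i' j' k' where ee': "e' = (r', i', j', k')" by (metis prod_cases4)
    have r: "r < 6" "r' < 6" using e by (auto simp: J_def ee ee')
    have "f \<in> embs_at V (same \<phi>) x" using inE[OF e(1)] f by blast
    then have inj: "inj_on f {..<6}" by (simp add: embs_at_def embs_def)
    have "f r \<in> S e r" "f r' \<in> S e' r'" using f r by (auto simp: PiE_iff)
    then have "f r = x" "f r' = x" by (auto simp: S_def ee ee')
    then have "r = r'" using inj r by (auto simp: inj_on_def)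
    have "[i, j, k] ! component p = [i', j', k'] ! component p" if "p < 6" for p
    proof -
      have "f p \<in> S e p" "f p \<in> S e' p" using f that by (auto simp: PiE_iff)
      then have "\<phi> (f p) = [i, j, k] ! component p" "\<phi> (f p) = [i', j', k'] ! component p"
        using Sphi[OF e(1)] Sphi[OF e(2)] by (auto simp: ee ee')
      then show ?thesis by simp
    qed
    from this[of 0] this[of 4] this[of 2] show False
      using \<open>r = r'\<close> e(3) by (simp add: ee ee' component_def)
  qed
  have each: "m ^ 5 \<le> card (PiE {..<6} (S e) - N) + 252 * real (card V) ^ 4" if e: "e \<in> J" for e
  proof -
    obtain r i j k where ee: "e = (r, i, j, k)" by (metis prod_cases4)
    have r: "r < 6" and p3: "(i, j, k) \<in> perms3" using e by (auto simp: J_def ee)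
    have "m ^ 5 = (\<Prod>p\<in>{..<6} - {r}. m)" using r by simp
    also have "\<dots> \<le> (\<Prod>p\<in>{..<6} - {r}. real (card (S e p)))"
    proof (rule prod_mono)
      fix p assume p: "p \<in> {..<6} - {r}"
      have "[i, j, k] ! component p < 3" using p3 by (auto simp: perms3_iff component_def)
      then show "0 \<le> m \<and> m \<le> real (card (S e p))"
        using m p by (simp add: S_def ee P_def)
    qed
    also have "\<dots> = (\<Prod>p<6. real (card (S e p)))"
      using r by (subst prod.remove[of "{..<6}" r]) (auto simp: S_def ee)
    also have "\<dots> = card (PiE {..<6} (S e))" by (simp add: card_PiE)
    also have "card (PiE {..<6} (S e)) \<le> card (PiE {..<6} (S e) - N) + card N"
    proof -
      have "finite N" unfolding N_def
        by (rule finite_subset[of _ "maps V"]) (auto intro!: finite_PiE V)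
      then have "card (PiE {..<6} (S e)) \<le> card ((PiE {..<6} (S e) - N) \<union> N)"
        by (intro card_mono finite_UnI finite_Diff finite_PiE finS) auto
      then show ?thesis using card_Un_le order_trans by blast
    qed
    finally have "m ^ 5 \<le> card (PiE {..<6} (S e) - N) + real (card N)" by simp
    moreover have "real (card N) \<le> 252 * real (card V) ^ 4"
    proof -
      have "real (card N) \<le> real (252 * card V ^ 4)"
        using noninj_at_le[OF V(1), of x] unfolding N_def by (intro of_nat_mono)
      then show ?thesis by simp
    qed
    ultimately show ?thesis by linarith
  qed
  have "12 * m ^ 5 = (\<Sum>e\<in>J. m ^ 5)" using J by simp
  also have "\<dots> \<le> (\<Sum>e\<in>J. card (PiE {..<6} (S e) - N) + 252 * real (card V) ^ 4)"
    using each by (rule sum_mono)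
  also have "\<dots> = real (\<Sum>e\<in>J. card (PiE {..<6} (S e) - N)) + 3024 * real (card V) ^ 4"
    using J by (simp add: sum.distrib)
  also have "(\<Sum>e\<in>J. card (PiE {..<6} (S e) - N)) = card (\<Union>e\<in>J. PiE {..<6} (S e) - N)"
    using J finS disj by (intro card_UN_disjoint[symmetric]) (auto intro!: finite_PiE)
  also have "\<dots> \<le> card (embs_at V (same \<phi>) x)"
  proof (rule card_mono)
    show "finite (embs_at V (same \<phi>) x)" using finite_embs[OF V(1)] by (simp add: embs_at_def)
    show "(\<Union>e\<in>J. PiE {..<6} (S e) - N) \<subseteq> embs_at V (same \<phi>) x" using inE by (rule UN_least)
  qed
  finally show ?thesis by simp
qed

definition align :: "('a \<Rightarrow> 'b) \<Rightarrow> 'a \<Rightarrow> ('a \<Rightarrow> 'a \<Rightarrow> bool) \<Rightarrow> 'a \<Rightarrow> 'a \<Rightarrow> bool" where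
  "align \<phi> x R y z = (if y = x \<or> z = x then \<phi> y = \<phi> z else R y z)"

lemma vertex_gain:
  fixes m :: real
  assumes V: "finite V" "x \<in> V" and R: "reflp R" and \<phi>: "\<phi> \<in> V \<rightarrow> {..<3}"
    and m: "0 \<le> m" "\<And>i. i < 3 \<Longrightarrow> m \<le> card {y \<in> V. \<phi> y = i}"
  defines "a \<equiv> \<lambda>i. real (card {y \<in> V - {x}. \<phi> y = i \<and> R x y})"
    and "z \<equiv> \<lambda>i. real (card {y \<in> V. \<phi> y = i \<and> \<not> R x y})"
  shows "card (embs V R) + 12 * m ^ 5 \<le> card (embs V (align \<phi> x R)) + attach a z
    + 432 * (card (mismatches V R \<phi>) * real (card V) ^ 3) + 3024 * real (card V) ^ 4"
proof -
  let ?R = "align \<phi> x R" and ?B = "mismatches_off V R \<phi> x"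
  let ?b = "card (mismatches V R \<phi>) * real (card V) ^ 3"
  have split: "card (embs V R') = card (embs_at V R' x) + card (embs V R' - embs_at V R' x)" for R'
  proof -
    have "embs_at V R' x \<subseteq> embs V R'" by (auto simp: embs_at_def)
    then show ?thesis using finite_embs[OF V(1)] by (metis card_Diff_subset card_mono finite_subset le_add_diff_inverse)
  qed
  have off: "embs V R - embs_at V R x = embs V ?R - embs_at V ?R x"
  proof -
    have "?R (f p) (f q) = R (f p) (f q)" if "x \<notin> f ` {..<6::nat}" "p < 6" "q < 6" for f p q
    proof -
      have "f p \<noteq> x" "f q \<noteq> x" using that by auto
      then show ?thesis by (simp add: align_def)
    qed
    then show ?thesis unfolding embs_at_def embs_def homs_def by auto
  qed
  have sub: "embs_at V (same \<phi>) x - bad_maps (embs_at V (same \<phi>) x) ?B \<subseteq> embs_at V ?R x"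
  proof
    fix f assume f: "f \<in> embs_at V (same \<phi>) x - bad_maps (embs_at V (same \<phi>) x) ?B"
    then have good: "\<And>p q. p < 6 \<Longrightarrow> q < 6 \<Longrightarrow> (f p, f q) \<notin> ?B" by (auto simp: bad_maps_def)
    have fV: "f \<in> maps V" using f embs_maps by (auto simp: embs_at_def)
    have "?R (f p) (f q) = (\<phi> (f p) = \<phi> (f q))" if "p < 6" "q < 6" for p q
    proof -
      have "f p \<in> V" "f q \<in> V" using fV that by auto
      then show ?thesis using good[OF that] by (auto simp: align_def mismatches_off_def mismatches_def)
    qed
    then show "f \<in> embs_at V ?R x" using f by (simp add: embs_at_def embs_def homs_def)
  qed
  have finE: "finite (embs_at V R' x)" for R' using finite_embs[OF V(1)] by (auto simp: embs_at_def)
  have "card (embs_at V (same \<phi>) x) \<le> card (embs_at V ?R x \<union> bad_maps (embs_at V (same \<phi>) x) ?B)"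
    using sub finE by (intro card_mono) (auto simp: bad_maps_def)
  also have "\<dots> \<le> card (embs_at V ?R x) + card (bad_maps (embs_at V (same \<phi>) x) ?B)" by (rule card_Un_le)
  also have "\<dots> \<le> card (embs_at V ?R x) + 216 * (card (mismatches V R \<phi>) * card V ^ 3)"
    using bad_at_le[OF V(1) R, of "same \<phi>" x \<phi>] by simp
  finally have "real (card (embs_at V (same \<phi>) x)) \<le> real (card (embs_at V ?R x) + 216 * (card (mismatches V R \<phi>) * card V ^ 3))"
    by (rule of_nat_mono)
  then have 1: "real (card (embs_at V (same \<phi>) x)) \<le> card (embs_at V ?R x) + 216 * ?b" by simp
  have 2: "12 * m ^ 5 \<le> card (embs_at V (same \<phi>) x) + 3024 * real (card V) ^ 4"
    by (rule vertex_lower[OF V \<phi> m])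
  have 3: "real (card (embs_at V R x)) \<le> attach a z + 216 * ?b"
    unfolding a_def z_def by (rule vertex_upper[OF V R \<phi>])
  have 4: "real (card (embs V R)) = card (embs_at V R x) + card (embs V R - embs_at V R x)"
    using split[of R] by simp
  have 5: "real (card (embs V ?R)) = card (embs_at V ?R x) + card (embs V R - embs_at V R x)"
    using split[of ?R] off by simp
  show ?thesis using 1 2 3 4 5 by linarith
qed

text \<open>The left-hand side is the probability that exactly one of three independent events with probabilities
\<open>\<alpha>\<close>, \<open>\<beta>\<close>, \<open>\<gamma>\<close> occurs. It is near \<open>1\<close> only if one event is nearly certain and the others are nearly
impossible.\<close>

lemma not_exactly_one:
  fixes \<alpha> \<beta> \<gamma> \<eta> :: real
  assumes r: "0 \<le> \<alpha>" "\<alpha> \<le> 1" "0 \<le> \<beta>" "\<beta> \<le> 1" "0 \<le> \<gamma>" "\<gamma> \<le> 1" and \<eta>: "0 \<le> \<eta>" "\<eta> \<le> 1"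
    and far: "\<eta> \<le> (1 - \<alpha>) + \<beta> + \<gamma>" "\<eta> \<le> (1 - \<beta>) + \<alpha> + \<gamma>" "\<eta> \<le> (1 - \<gamma>) + \<alpha> + \<beta>"
  shows "\<alpha> * (1 - \<beta>) * (1 - \<gamma>) + \<beta> * (1 - \<alpha>) * (1 - \<gamma>) + \<gamma> * (1 - \<alpha>) * (1 - \<beta>) \<le> 1 - \<eta> / 8"
proof -
  have main: "x * (1 - y) * (1 - z) + y * (1 - x) * (1 - z) + z * (1 - x) * (1 - y) \<le> 1 - \<eta> / 8"
    if "1 / 2 \<le> x" "x \<le> 1" "0 \<le> y" "y \<le> 1" "0 \<le> z" "z \<le> 1" "\<eta> \<le> (1 - x) + y + z" for x y z
  proof -
    have id: "1 - (x * (1 - y) * (1 - z) + y * (1 - x) * (1 - z) + z * (1 - x) * (1 - y))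
      = (1 - x) * (1 - y) * (1 - z) + x * y + x * z * (1 - y) + (1 - x) * y * z"
      by algebra
    have t: "0 \<le> (1 - x) * y * z" "0 \<le> x * z * (1 - y)" "0 \<le> x * y" "0 \<le> (1 - x) * (1 - y) * (1 - z)"
      using that by auto
    show ?thesis
    proof (cases "y \<ge> \<eta> / 4")
      case True
      have "\<eta> / 8 \<le> x * y" using mult_mono[of "1/2" x "\<eta> / 4" y] True that \<eta> by simp
      then show ?thesis using id t by linarith
    next
      case y: False
      show ?thesis
      proof (cases "z \<ge> \<eta> / 4")
        case True
        have "\<eta> / 8 \<le> x * z" using mult_mono[of "1/2" x "\<eta> / 4" z] True that \<eta> by simp
        moreover have "x * z * (1 - y) + x * y = x * z + x * y * (1 - z)" by algebra
        moreover have "0 \<le> x * y * (1 - z)" using that by auto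
        ultimately show ?thesis using id t by linarith
      next
        case False
        have "\<eta> / 2 \<le> 1 - x" using that y False by linarith
        moreover have "1 / 2 \<le> 1 - y" "1 / 2 \<le> 1 - z" using y False \<eta> by linarith+
        ultimately have "\<eta> / 2 * (1 / 2) * (1 / 2) \<le> (1 - x) * (1 - y) * (1 - z)"
          using \<eta> that by (intro mult_mono) auto
        then show ?thesis using id t by simp
      qed
    qed
  qed
  consider "1 / 2 \<le> \<alpha>" | "1 / 2 \<le> \<beta>" | "1 / 2 \<le> \<gamma>" | "\<alpha> < 1/2" "\<beta> < 1/2" "\<gamma> < 1/2" by linarith
  then show ?thesis
  proof cases
    case 1 then show ?thesis using main[of \<alpha> \<beta> \<gamma>] r far by simp
  next
    case 2 then show ?thesis using main[of \<beta> \<alpha> \<gamma>] r far by (simp add: algebra_simps)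
  next
    case 3 then show ?thesis using main[of \<gamma> \<alpha> \<beta>] r far by (simp add: algebra_simps)
  next
    case 4
    have "1 / 2 * (1 / 2) * (1 / 2) \<le> (1 - \<alpha>) * (1 - \<beta>) * (1 - \<gamma>)"
      using 4 r by (intro mult_mono) auto
    moreover have "0 \<le> \<alpha> * \<beta> + \<alpha> * \<gamma> * (1 - \<beta>) + (1 - \<alpha>) * \<beta> * \<gamma>" using r by auto
    moreover have "1 - (\<alpha> * (1 - \<beta>) * (1 - \<gamma>) + \<beta> * (1 - \<alpha>) * (1 - \<gamma>) + \<gamma> * (1 - \<alpha>) * (1 - \<beta>))
      = (1 - \<alpha>) * (1 - \<beta>) * (1 - \<gamma>) + \<alpha> * \<beta> + \<alpha> * \<gamma> * (1 - \<beta>) + (1 - \<alpha>) * \<beta> * \<gamma>" by algebra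
    ultimately show ?thesis using \<eta> by linarith
  qed
qed

text \<open>As a function of each density \<open>a i\<close>, with \<open>z i \<le> 1 - a i\<close>, the count is at most the linear interpolation of its
values at \<open>0\<close> and \<open>1\<close>, because \<open>t\<^sup>2 \<le> t\<close> and \<open>t\<^sup>3 \<le> t\<close> on the unit interval. At the corners of the cube it equals
\<open>12\<close> if \<open>x\<close> is joined to exactly one clique, \<open>6\<close> if it is isolated, and \<open>0\<close> otherwise. So the deficit is at
least six times the probability that not exactly one of three events of probabilities \<open>a i\<close> occurs.\<close>

lemma attach_le_normalized:
  assumes a: "\<And>i. i < 3 \<Longrightarrow> 0 \<le> a i" and z: "\<And>i. i < 3 \<Longrightarrow> 0 \<le> z i" and az: "\<And>i. i < 3 \<Longrightarrow> a i + z i \<le> 1"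
    and \<eta>: "0 \<le> \<eta>" "\<eta> \<le> 1"
    and far: "\<eta> \<le> z 0 + a 1 + a 2" "\<eta> \<le> z 1 + a 0 + a 2" "\<eta> \<le> z 2 + a 0 + a 1"
  shows "attach a z \<le> 12 - 3 / 4 * \<eta>"
proof -
  define w where "w i = 1 - a i" for i
  have w: "0 \<le> w i" "z i \<le> w i" "w i \<le> 1" "a i \<le> 1" if "i < 3" for i
    using az[OF that] z[OF that] a[OF that] by (auto simp: w_def)
  have term_le: "3 * a i ^ 2 * z j ^ 2 * z k + 2 * z i ^ 3 * a j * z k + z i ^ 3 * z j ^ 2
      \<le> 3 * (a i * w j * w k) + 2 * (w i * a j * w k) + w i * w j" if "(i, j, k) \<in> perms3" for i j k
  proof -
    have l: "i < 3" "j < 3" "k < 3" using that by (auto simp: perms3_iff)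
    have p: "z l ^ 3 \<le> w l" "z l ^ 2 \<le> w l" "a l ^ 2 \<le> a l" if "l < 3" for l
    proof -
      have "z l \<le> 1" using w[OF that] by linarith
      then show "z l ^ 3 \<le> w l" "z l ^ 2 \<le> w l"
        using power_decreasing[of 1 3 "z l"] power_decreasing[of 1 2 "z l"] z[OF that] w[OF that] by auto
      show "a l ^ 2 \<le> a l" using power_decreasing[of 1 2 "a l"] a[OF that] w[OF that] by auto
    qed
    have "a i ^ 2 * z j ^ 2 * z k \<le> a i * w j * w k"
      using p l w z a by (intro mult_mono) auto
    moreover have "z i ^ 3 * a j * z k \<le> w i * a j * w k"
      using p l w z a by (intro mult_mono) auto
    moreover have "z i ^ 3 * z j ^ 2 \<le> w i * w j"
      using p l w z a by (intro mult_mono) auto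
    ultimately show ?thesis by linarith
  qed
  define E where "E = a 0 * w 1 * w 2 + a 1 * w 0 * w 2 + a 2 * w 0 * w 1"
  define W where "W = w 0 * w 1 * w 2"
  have "attach a z \<le> (\<Sum>(i, j, k)\<in>perms3. 3 * (a i * w j * w k) + 2 * (w i * a j * w k) + w i * w j)"
    unfolding attach_def by (rule sum_mono) (use term_le in auto)
  also have "\<dots> = 12 * E + 6 * W"
    unfolding sum_perms3 E_def W_def w_def by (simp add: algebra_simps)
  finally have 1: "attach a z \<le> 12 * E + 6 * W" .
  have "1 - E - W = a 0 * a 1 + a 0 * a 2 * w 1 + w 0 * a 1 * a 2"
    unfolding E_def W_def w_def by algebra
  moreover have "0 \<le> a 0 * a 1 + a 0 * a 2 * w 1 + w 0 * a 1 * a 2" using a w by simp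
  ultimately have 2: "E + W \<le> 1" by linarith
  have 3: "E \<le> 1 - \<eta> / 8"
  proof -
    have "z 0 \<le> 1 - a 0" "z 1 \<le> 1 - a 1" "z 2 \<le> 1 - a 2"
      using az[of 0] az[of 1] az[of 2] by simp_all
    then have "\<eta> \<le> (1 - a 0) + a 1 + a 2" "\<eta> \<le> (1 - a 1) + a 0 + a 2" "\<eta> \<le> (1 - a 2) + a 0 + a 1"
      using far by linarith+
    then show ?thesis unfolding E_def w_def
      by (intro not_exactly_one) (use a w(4) \<eta> in simp_all)
  qed
  show ?thesis using 1 2 3 by linarith
qed

lemma attach_le:
  assumes a: "\<And>i. i < 3 \<Longrightarrow> 0 \<le> a i" and z: "\<And>i. i < 3 \<Longrightarrow> 0 \<le> z i" and az: "\<And>i. i < 3 \<Longrightarrow> a i + z i \<le> N"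
    and N: "N > 0" and \<eta>: "0 \<le> \<eta>" "\<eta> \<le> 1"
    and far: "\<eta> * N \<le> z 0 + a 1 + a 2" "\<eta> * N \<le> z 1 + a 0 + a 2" "\<eta> * N \<le> z 2 + a 0 + a 1"
  shows "attach a z \<le> N ^ 5 * (12 - 3 / 4 * \<eta>)"
proof -
  have scale: "attach (\<lambda>i. N * b i) (\<lambda>i. N * c i) = N ^ 5 * attach b c" for b c
  proof -
    have "attach (\<lambda>i. N * b i) (\<lambda>i. N * c i) = (\<Sum>t\<in>perms3. N ^ 5 * (case t of (i, j, k) \<Rightarrow>
      3 * b i ^ 2 * c j ^ 2 * c k + 2 * c i ^ 3 * b j * c k + c i ^ 3 * c j ^ 2))"
      unfolding attach_def by (rule sum.cong[OF refl]) (auto simp: power_mult_distrib algebra_simps eval_nat_numeral)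
    then show ?thesis by (simp add: attach_def sum_distrib_left)
  qed
  have "attach a z = attach (\<lambda>i. N * (a i / N)) (\<lambda>i. N * (z i / N))" using N by simp
  also have "\<dots> = N ^ 5 * attach (\<lambda>i. a i / N) (\<lambda>i. z i / N)" by (rule scale)
  also have "\<dots> \<le> N ^ 5 * (12 - 3 / 4 * \<eta>)"
    using a z az N \<eta> far
    by (intro mult_left_mono attach_le_normalized) (auto simp: field_simps)
  finally show ?thesis .
qed

section \<open>Stability\<close>

lemma distinct_sum_three_ge:
  fixes s :: real and c :: "nat \<Rightarrow> real"
  assumes "0 \<le> s" "\<And>i. i < 3 \<Longrightarrow> s \<le> c i"
  shows "6 * s ^ 6 \<le> distinct_sum {..<3} c"
proof -
  have t: "s ^ 6 \<le> c i ^ 3 * c j ^ 2 * c k" if "i < 3" "j < 3" "k < 3" for i j k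
  proof -
    have "s ^ 3 * s ^ 2 * s \<le> c i ^ 3 * c j ^ 2 * c k"
      using assms(1) assms(2)[OF that(1)] assms(2)[OF that(2)] assms(2)[OF that(3)]
      by (intro mult_mono power_mono) auto
    then show ?thesis by (simp add: eval_nat_numeral)
  qed
  have "6 * s ^ 6 = (\<Sum>i<3. \<Sum>j\<in>{..<3::nat} - {i}. \<Sum>k\<in>{..<3::nat} - {i, j}. s ^ 6)"
    by (simp add: less3 insert_Diff_if)
  also have "\<dots> \<le> distinct_sum {..<3} c"
    unfolding distinct_sum_def by (intro sum_mono t) auto
  finally show ?thesis .
qed

lemma balanced_embs:
  assumes V: "finite V" and n: "card V \<ge> 3"
  obtains \<phi> where "\<phi> \<in> V \<rightarrow> {..<3::nat}"
    "2 / 243 * real (card V) ^ 6 - 37 * real (card V) ^ 5 \<le> card (embs V (same \<phi>))"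
proof -
  define n where "n = card V"
  define s where "s = n div 3"
  have "3 * s \<le> card V" by (simp add: s_def n_def)
  then obtain A0 A1 A2 where A: "A0 \<subseteq> V" "A1 \<subseteq> V" "A2 \<subseteq> V" "A0 \<inter> A1 = {}" "A0 \<inter> A2 = {}" "A1 \<inter> A2 = {}"
    "card A0 = s" "card A1 = s" "card A2 = s"
    by (rule three_disjoint_subsets) blast
  define \<phi> where "\<phi> x = (if x \<in> A0 then 0 else if x \<in> A1 then 1 else 2 :: nat)" for x
  have \<phi>: "\<phi> \<in> V \<rightarrow> {..<3}" by (auto simp: \<phi>_def)
  define c where "c = (\<lambda>i. real (card {x \<in> V. \<phi> x = i}))"
  have sub: "A0 \<subseteq> {x \<in> V. \<phi> x = 0}" "A1 \<subseteq> {x \<in> V. \<phi> x = 1}" "A2 \<subseteq> {x \<in> V. \<phi> x = 2}"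
    using A by (auto simp: \<phi>_def)
  have "s \<le> card {x \<in> V. \<phi> x = 0}" "s \<le> card {x \<in> V. \<phi> x = 1}" "s \<le> card {x \<in> V. \<phi> x = 2}"
    using card_mono[OF _ sub(1)] card_mono[OF _ sub(2)] card_mono[OF _ sub(3)] A V by auto
  then have c: "real s \<le> c i" if "i < 3" for i
    using that unfolding less3_cases by (auto simp: c_def)
  have sn: "real n / 3 - 1 \<le> real s" unfolding s_def by linarith
  have n3: "real n \<ge> 3" using n by (simp add: n_def)
  have "2 / 243 * real n ^ 6 - real n ^ 5 \<le> 6 * (real n / 3 - 1) ^ 6"
  proof -
    have "1 + real 6 * (- (3 / real n)) \<le> (1 + (- (3 / real n))) ^ 6"
      by (rule Bernoulli_inequality) (use n3 in \<open>simp add: field_simps\<close>)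
    then have "(real n / 3) ^ 6 * (1 - 18 / real n) \<le> (real n / 3) ^ 6 * (1 - 3 / real n) ^ 6"
      by (intro mult_left_mono) auto
    also have "\<dots> = (real n / 3 - 1) ^ 6"
    proof -
      have "real n / 3 * (1 - 3 / real n) = real n / 3 - 1" using n3 by (simp add: field_simps)
      then show ?thesis by (simp only: power_mult_distrib[symmetric])
    qed
    also have "(real n / 3) ^ 6 * (1 - 18 / real n) = real n ^ 6 / 729 - 18 * real n ^ 5 / 729"
      using n3 by (simp add: field_simps eval_nat_numeral)
    finally have "real n ^ 6 / 729 - 18 * real n ^ 5 / 729 \<le> (real n / 3 - 1) ^ 6" .
    moreover have "0 \<le> real n ^ 5" by simp
    ultimately show ?thesis by linarith
  qed
  also have "\<dots> \<le> 6 * real s ^ 6" using sn n3 by (intro mult_left_mono power_mono) auto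
  also have "\<dots> \<le> distinct_sum {..<3} c" using c by (intro distinct_sum_three_ge) auto
  also have "\<dots> = card (homs V (same \<phi>))"
    using card_homs_same[OF V finite_lessThan \<phi>] by (simp add: c_def)
  also have "\<dots> \<le> real (card (embs V (same \<phi>)) + 36 * card V ^ 5)"
    by (intro of_nat_mono homs_le_embs V)
  finally show ?thesis using \<phi> by (intro that[of \<phi>]) (auto simp: n_def)
qed

lemma power_gap:
  assumes "(10::real) ^ 40 \<le> n"
  shows "n ^ 4 \<le> n ^ 5 / 10 ^ 40" "n ^ 5 \<le> n ^ 6 / 10 ^ 40"
proof -
  have "n ^ k * 10 ^ 40 \<le> n ^ k * n" for k
    using assms by (intro mult_left_mono zero_le_power) auto
  from this[of 4] this[of 5]
  show "n ^ 4 \<le> n ^ 5 / 10 ^ 40" "n ^ 5 \<le> n ^ 6 / 10 ^ 40"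
    by (simp_all add: field_simps eval_nat_numeral)
qed

text \<open>If few edits lead from an almost extremal relation to the cliques of \<open>\<phi>\<close>, then these cliques are almost extremal,
hence balanced. The squared deviation is at most \<open>6156 / 10\<^sup>3\<^sup>1 \<le> (1 / 10\<^sup>1\<^sup>3)\<^sup>2\<close> relative to \<open>n\<^sup>2\<close>.\<close>

lemma part_sizes_near_third:
  fixes M :: real and \<phi> :: "'a \<Rightarrow> nat"
  assumes V: "finite V" and n: "real (card V) \<ge> 10 ^ 40"
    and M: "\<And>R'. reflp R' \<Longrightarrow> symp R' \<Longrightarrow> card (embs V R') \<le> M"
    and R: "reflp R" and near: "M - real (card V) ^ 6 / 10 ^ 31 \<le> card (embs V R)"
    and \<phi>: "\<phi> \<in> V \<rightarrow> {..<3}" and close: "card (mismatches V R \<phi>) \<le> real (card V) ^ 2 / 10 ^ 31" and i: "i < 3"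
  shows "\<bar>card {x \<in> V. \<phi> x = i} - real (card V) / 3\<bar> \<le> real (card V) / 10 ^ 13"
proof -
  define N where "N = real (card V)"
  define c where "c = real (card {x \<in> V. \<phi> x = i})"
  have N: "N \<ge> 10 ^ 40" "N > 0" using n by (simp_all add: N_def)
  have "real (card V) \<ge> 3" using n by (rule order_trans[rotated]) simp
  then have "card V \<ge> 3" by simp
  then obtain \<psi> :: "'a \<Rightarrow> nat" where \<psi>: "2 / 243 * N ^ 6 - 37 * N ^ 5 \<le> card (embs V (same \<psi>))"
    using balanced_embs[OF V] unfolding N_def by blast
  have "card (embs V (same \<psi>)) \<le> M" by (rule M) (auto simp: reflp_def symp_def)
  then have M1: "2 / 243 * N ^ 6 - 37 * N ^ 5 \<le> M" using \<psi> by linarith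
  have "embs V R \<subseteq> embs V (same \<phi>) \<union> bad_maps (embs V R) (mismatches V R \<phi>)"
    using good_maps_eq[of V R \<phi>] by blast
  then have "card (embs V R) \<le> card (embs V (same \<phi>) \<union> bad_maps (embs V R) (mismatches V R \<phi>))"
    using finite_embs[OF V] by (intro card_mono) (auto simp: bad_maps_def)
  also have "\<dots> \<le> card (embs V (same \<phi>)) + 36 * (card (mismatches V R \<phi>) * card V ^ 4)"
    using card_Un_le card_bad_maps_le[OF V R embs_maps] by (meson add_left_mono order_trans)
  finally have "real (card (embs V R)) \<le> real (card (embs V (same \<phi>)) + 36 * (card (mismatches V R \<phi>) * card V ^ 4))"
    by (rule of_nat_mono)
  also have "\<dots> = card (embs V (same \<phi>)) + 36 * (card (mismatches V R \<phi>) * N ^ 4)"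
    by (simp add: N_def)
  also have "\<dots> \<le> card (homs V (same \<phi>)) + 36 * (N ^ 2 / 10 ^ 31 * N ^ 4)"
    using embs_le_homs[OF V, of "same \<phi>"] close
    by (intro add_mono mult_left_mono mult_right_mono) (auto simp: N_def)
  also have "N ^ 2 / 10 ^ 31 * N ^ 4 = N ^ 6 / 10 ^ 31" by (simp add: eval_nat_numeral)
  also have "card (homs V (same \<phi>)) \<le> 2 / 243 * N ^ 6 - (c - N / 3)\<^sup>2 * N ^ 4 / 162"
    unfolding N_def c_def
    by (rule homs_three_parts[OF V _ \<phi> i]) (use \<open>card V \<ge> 3\<close> in auto)
  finally have "(c - N / 3)\<^sup>2 * N ^ 4 / 162 \<le> 37 * N ^ 5 + 37 * (N ^ 6 / 10 ^ 31)"
    using M1 near unfolding N_def[symmetric] by linarith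
  also have "\<dots> \<le> 38 * (N ^ 6 / 10 ^ 31)"
  proof -
    have "37 * N ^ 5 \<le> 37 * (N ^ 6 / 10 ^ 40)" using power_gap(2)[OF N(1)] by simp
    also have "\<dots> \<le> N ^ 6 / 10 ^ 31" using N by simp
    finally show ?thesis by linarith
  qed
  also have "N ^ 6 = N\<^sup>2 * N ^ 4" by (simp flip: power_add)
  finally have "(c - N / 3)\<^sup>2 * N ^ 4 \<le> 162 * (38 * (N\<^sup>2 * N ^ 4 / 10 ^ 31))"
    by linarith
  then have "(c - N / 3)\<^sup>2 * N ^ 4 \<le> (6156 * N\<^sup>2 / 10 ^ 31) * N ^ 4"
    by (simp add: mult.assoc)
  then have "(c - N / 3)\<^sup>2 \<le> 6156 * N\<^sup>2 / 10 ^ 31" using N by (simp add: mult_le_cancel_right)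
  also have "\<dots> \<le> (N / 10 ^ 13)\<^sup>2" by (simp add: power_divide)
  finally have "\<bar>c - N / 3\<bar> \<le> \<bar>N / 10 ^ 13\<bar>" by (simp only: abs_le_square_iff)
  then show ?thesis using N by (simp add: c_def N_def)
qed

text \<open>The number of mismatches at \<open>x\<close> if \<open>x\<close> is counted as a member of part \<open>i\<close>.\<close>

lemma attach_sums:
  fixes \<phi> :: "'a \<Rightarrow> nat"
  assumes V: "finite V" "x \<in> V" and R: "reflp R" and \<phi>: "\<phi> \<in> V \<rightarrow> {..<3}" and i: "{i, j, k} = {..<3}" "i \<noteq> j" "i \<noteq> k" "j \<noteq> k"
  shows "card {y \<in> V - {x}. R x y \<noteq> (i = \<phi> y)} =
    card {y \<in> V. \<phi> y = i \<and> \<not> R x y} + card {y \<in> V - {x}. \<phi> y = j \<and> R x y} + card {y \<in> V - {x}. \<phi> y = k \<and> R x y}"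
proof -
  let ?Z = "{y \<in> V. \<phi> y = i \<and> \<not> R x y}" and ?A = "\<lambda>j. {y \<in> V - {x}. \<phi> y = j \<and> R x y}"
  have "\<phi> y = i \<or> \<phi> y = j \<or> \<phi> y = k" if "y \<in> V" for y
  proof -
    have "\<phi> y \<in> {..<3}" using \<phi> that by auto
    then show ?thesis unfolding i(1)[symmetric] by auto
  qed
  then have "{y \<in> V - {x}. R x y \<noteq> (i = \<phi> y)} = ?Z \<union> (?A j \<union> ?A k)"
    using R i by (auto simp: reflp_def)
  moreover have "?Z \<inter> (?A j \<union> ?A k) = {}" "?A j \<inter> ?A k = {}" using i by auto
  moreover have "finite ?Z" "finite (?A j)" "finite (?A k)" using V by auto
  ultimately show ?thesis by (simp add: card_Un_disjoint)
qed

text \<open>Near the extremal configuration every edit costs a positive fraction of \<open>n\<^sup>4\<close> copies. Fix an optimal \<open>\<phi>\<close>. If some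
vertex has more than \<open>n / 10\<^sup>9\<close> mismatches, then by optimality it has so many with respect to each part; aligning
it gains copies of order \<open>n\<^sup>5\<close>, changes the distance by at most \<open>2 n\<close> and decreases it, so that induction applies.
Otherwise all mismatches can be repaired at once.

The constants form a hierarchy. In the first case the deficit \<open>3/4 / 10\<^sup>9 / 3\<^sup>5\<close> of \<open>attach_le\<close> must exceed the
uncertainty of about \<open>120 / 81 / 10\<^sup>1\<^sup>3\<close> from the part sizes, which is ensured by a distance below \<open>n\<^sup>2 / 10\<^sup>3\<^sup>1\<close>. In
the second case the gain of \<open>1 / 24\<^sup>4\<close> per mismatch must exceed \<open>2 * 216 / 10\<^sup>9\<close>.\<close>

lemma local_stability:
  fixes M :: real
  assumes V: "finite V" and n: "real (card V) \<ge> 10 ^ 40"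
    and M: "\<And>R'. reflp R' \<Longrightarrow> symp R' \<Longrightarrow> card (embs V R') \<le> M"
  shows "reflp R \<Longrightarrow> symp R \<Longrightarrow> M - real (card V) ^ 6 / 10 ^ 31 \<le> card (embs V R) \<Longrightarrow>
    dist3 V R \<le> real (card V) ^ 2 / 10 ^ 31 \<Longrightarrow> card (embs V R) + dist3 V R * real (card V) ^ 4 / 10 ^ 13 \<le> M"
proof (induction "dist3 V R" arbitrary: R rule: less_induct)
  case less
  note R = less.prems(1,2) and near = less.prems(3) and close = less.prems(4)
  define N where "N = real (card V)"
  have N: "N \<ge> 10 ^ 40" using n by (simp add: N_def)
  have "N \<ge> 100" by (rule order_trans[OF _ N]) simp
  then have N0: "N > 0" "N \<ge> 100" by linarith+
  obtain \<phi> where \<phi>: "\<phi> \<in> V \<rightarrow> {..<3}" "card (mismatches V R \<phi>) = dist3 V R" by (rule dist3_attained)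
  define b where "b = dist3 V R"
  have bN: "real b \<le> N ^ 2 / 10 ^ 31" using close by (simp add: b_def N_def)
  have sizes: "\<bar>card {x \<in> V. \<phi> x = i} - N / 3\<bar> \<le> N / 10 ^ 13" if "i < 3" for i
    unfolding N_def
    by (rule part_sizes_near_third[OF V _ M R(1) _ \<phi>(1) _ that])
      (use n near close \<phi>(2) in simp_all)
  define D where "D x = {y \<in> V - {x}. R x y \<noteq> (\<phi> x = \<phi> y)}" for x
  show ?case
  proof (cases "\<exists>x\<in>V. N / 10 ^ 9 < card (D x)")
    case True
    then obtain x where x: "x \<in> V" "N / 10 ^ 9 < card (D x)" by auto
    let ?R = "align \<phi> x R"
    have R': "reflp ?R" "symp ?R"
      using R unfolding reflp_def symp_def align_def by auto
    define a where "a = (\<lambda>i. real (card {y \<in> V - {x}. \<phi> y = i \<and> R x y}))"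
    define z where "z = (\<lambda>i. real (card {y \<in> V. \<phi> y = i \<and> \<not> R x y}))"
    define hi where "hi = N / 3 + N / 10 ^ 13"
    define lo where "lo = N / 3 - N / 10 ^ 13"
    have gain: "card (embs V R) + 12 * lo ^ 5 \<le> card (embs V ?R) + attach a z + 432 * (b * N ^ 3) + 3024 * N ^ 4"
      unfolding b_def \<phi>(2)[symmetric] a_def z_def N_def
    proof (rule vertex_gain[OF V x(1) R(1) \<phi>(1)])
      show "0 \<le> lo" using N0 by (simp add: lo_def)
      show "lo \<le> card {y \<in> V. \<phi> y = i}" if "i < 3" for i
        using sizes[OF that] unfolding lo_def by linarith
    qed
    have opt: "N / 10 ^ 9 \<le> card {y \<in> V - {x}. R x y \<noteq> (i = \<phi> y)}" if i: "i < 3" for i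
    proof -
      (* moving x to part i cannot decrease the number of mismatches *)
      let ?\<psi> = "\<phi>(x := i)"
      have "?\<psi> \<in> V \<rightarrow> {..<3}" using \<phi>(1) i by auto
      then have "dist3 V R \<le> card (mismatches V R ?\<psi>)" by (rule dist3_le)
      also have "\<dots> = card (mismatches_off V R ?\<psi> x) + 2 * card {y \<in> V - {x}. R x y \<noteq> (?\<psi> x = ?\<psi> y)}"
        by (rule card_mismatches_at[OF V x(1) R])
      also have "mismatches_off V R ?\<psi> x = mismatches_off V R \<phi> x"
        by (auto simp: mismatches_off_def mismatches_def)
      also have "{y \<in> V - {x}. R x y \<noteq> (?\<psi> x = ?\<psi> y)} = {y \<in> V - {x}. R x y \<noteq> (i = \<phi> y)}" by auto
      finally have "card (D x) \<le> card {y \<in> V - {x}. R x y \<noteq> (i = \<phi> y)}"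
        using card_mismatches_at[OF V x(1) R, of \<phi>] \<phi>(2) by (simp add: D_def)
      then show ?thesis using x(2) by linarith
    qed
    have att: "attach a z \<le> hi ^ 5 * (12 - 3 / 4 * (1 / 10 ^ 9))"
    proof (rule attach_le)
      show "0 \<le> a i" "0 \<le> z i" for i by (auto simp: a_def z_def)
      show "a i + z i \<le> hi" if "i < 3" for i
      proof -
        let ?A = "{y \<in> V - {x}. \<phi> y = i \<and> R x y}" and ?Z = "{y \<in> V. \<phi> y = i \<and> \<not> R x y}"
        have "card ?A + card ?Z = card (?A \<union> ?Z)"
          using V by (intro card_Un_disjoint[symmetric]) auto
        also have "\<dots> \<le> card {y \<in> V. \<phi> y = i}" using V by (intro card_mono) auto
        finally have "a i + z i \<le> card {y \<in> V. \<phi> y = i}" unfolding a_def z_def by linarith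
        then show ?thesis using sizes[OF that] unfolding hi_def by linarith
      qed
      show "hi > 0" using N0 by (simp add: hi_def)
      have le: "1 / 10 ^ 9 * hi \<le> N / 10 ^ 9" using N0 by (simp add: hi_def)
      have e: "{0, 1, 2} = {..<3::nat}" "{1, 0, 2} = {..<3::nat}" "{2, 0, 1} = {..<3::nat}" by auto
      show "1 / 10 ^ 9 * hi \<le> z 0 + a 1 + a 2"
        using opt[of 0] attach_sums[OF V x(1) R(1) \<phi>(1) e(1)] le by (simp add: a_def z_def)
      show "1 / 10 ^ 9 * hi \<le> z 1 + a 0 + a 2"
        using opt[of 1] attach_sums[OF V x(1) R(1) \<phi>(1) e(2)] le by (simp add: a_def z_def)
      show "1 / 10 ^ 9 * hi \<le> z 2 + a 0 + a 1"
        using opt[of 2] attach_sums[OF V x(1) R(1) \<phi>(1) e(3)] le by (simp add: a_def z_def)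
    qed auto
    have small: "432 * (b * N ^ 3) + 3024 * N ^ 4 \<le> N ^ 5 / 10 ^ 28"
    proof -
      define Y where "Y = b * N ^ 3"
      have "Y \<le> N ^ 2 / 10 ^ 31 * N ^ 3" unfolding Y_def using bN N0 by (intro mult_right_mono) auto
      also have "\<dots> = N ^ 5 / 10 ^ 31" by (simp add: eval_nat_numeral)
      finally have Y: "Y \<le> N ^ 5 / 10 ^ 31" .
      define Z where "Z = N ^ 5"
      define W where "W = N ^ 4"
      have "Z \<ge> 0" using N0 by (simp add: Z_def)
      moreover have "Y \<le> Z / 10 ^ 31" "W \<le> Z / 10 ^ 40"
        using Y power_gap(1)[OF N] by (simp_all add: Z_def W_def)
      ultimately have "432 * Y + 3024 * W \<le> Z / 10 ^ 28" by simp
      then have "432 * Y + 3024 * N ^ 4 \<le> N ^ 5 / 10 ^ 28" by (simp add: Z_def W_def)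
      then show ?thesis by (simp add: Y_def)
    qed
    have num: "12 * lo ^ 5 - hi ^ 5 * (12 - 3 / 4 * (1 / 10 ^ 9)) \<ge> N ^ 5 * (25 / 10 ^ 13)"
    proof -
      have gen: "12 * (N * u) ^ 5 - (N * v) ^ 5 * d = N ^ 5 * (12 * u ^ 5 - v ^ 5 * d)" for u v d by algebra
      have hl: "hi = N * (1 / 3 + 1 / 10 ^ 13)" "lo = N * (1 / 3 - 1 / 10 ^ 13)"
        by (simp_all add: hi_def lo_def algebra_simps)
      have "N ^ 5 * (25 / 10 ^ 13)
        \<le> N ^ 5 * (12 * (1 / 3 - 1 / 10 ^ 13) ^ 5 - (1 / 3 + 1 / 10 ^ 13) ^ 5 * (12 - 3 / 4 * (1 / 10 ^ 9)))"
        using N0 by (intro mult_left_mono) (simp_all add: power_divide)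
      then show ?thesis unfolding hl gen .
    qed
    have G: "card (embs V R) + N ^ 5 * (2 / 10 ^ 12) \<le> card (embs V ?R)"
    proof -
      have lin: "e + Z * (2 / 10 ^ 12) \<le> e'"
        if "e + 12 * L \<le> e' + A + (E1 + E2)" "A \<le> H" "E1 + E2 \<le> Z / 10 ^ 28" "Z * (25 / 10 ^ 13) \<le> 12 * L - H" "0 \<le> Z"
        for e e' Z L A E1 E2 H :: real
        using that by simp
      show ?thesis
        by (rule lin[OF _ att small num]) (use gain N0 in \<open>simp_all only: add.assoc zero_le_power less_imp_le\<close>)
    qed
    have d1: "dist3 V ?R < dist3 V R"
    proof -
      have "dist3 V ?R \<le> card (mismatches V ?R \<phi>)" by (rule dist3_le[OF \<phi>(1)])
      also have "\<dots> = card (mismatches_off V ?R \<phi> x) + 2 * card {y \<in> V - {x}. ?R x y \<noteq> (\<phi> x = \<phi> y)}"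
        by (rule card_mismatches_at[OF V x(1) R'])
      also have "{y \<in> V - {x}. ?R x y \<noteq> (\<phi> x = \<phi> y)} = {}" by (auto simp: align_def)
      also have "mismatches_off V ?R \<phi> x = mismatches_off V R \<phi> x"
        by (auto simp: mismatches_off_def mismatches_def align_def)
      finally have "dist3 V ?R + 2 * card (D x) \<le> dist3 V R"
        using card_mismatches_at[OF V x(1) R, of \<phi>] \<phi>(2) by (simp add: D_def)
      moreover have "card (D x) > 0" using x(2) N0 by (metis divide_nonneg_nonneg gr0I less_le_not_le of_nat_0 order_less_imp_le zero_le_numeral zero_le_power)
      ultimately show ?thesis by linarith
    qed
    have d2: "dist3 V R \<le> dist3 V ?R + 2 * card V"
      using dist3_diff[of V "{x}" R ?R] V x(1) by (simp add: align_def)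
    have "card (embs V ?R) + dist3 V ?R * real (card V) ^ 4 / 10 ^ 13 \<le> M"
    proof (rule less.hyps[OF d1 R'])
      show "M - real (card V) ^ 6 / 10 ^ 31 \<le> card (embs V ?R)"
      proof -
        have "0 \<le> N ^ 5 * (2 / 10 ^ 12)" using N0 by simp
        then show ?thesis using G near by linarith
      qed
      show "dist3 V ?R \<le> real (card V) ^ 2 / 10 ^ 31" using d1 close by linarith
    qed
    then have IH: "card (embs V ?R) + dist3 V ?R * N ^ 4 / 10 ^ 13 \<le> M" by (simp add: N_def)
    have shift: "dist3 V R * N ^ 4 \<le> dist3 V ?R * N ^ 4 + 2 * N ^ 5"
    proof -
      have "real (dist3 V R) \<le> dist3 V ?R + 2 * N" using of_nat_mono[OF d2, where 'a = real] by (simp add: N_def)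
      then have "dist3 V R * N ^ 4 \<le> (dist3 V ?R + 2 * N) * N ^ 4" using N0 by (intro mult_right_mono) auto
      then show ?thesis by (simp add: algebra_simps eval_nat_numeral)
    qed
    have lin: "e + D1 / 10 ^ 13 \<le> M"
      if "e' + D2 / 10 ^ 13 \<le> M" "D1 \<le> D2 + 2 * Z" "e + Z * (2 / 10 ^ 12) \<le> e'" "0 \<le> Z" for e e' D1 D2 Z :: real
      using that by simp
    show ?thesis unfolding N_def[symmetric]
      by (rule lin[OF IH shift G]) (use N0 in simp)
  next
    case False
    define m where "m = nat \<lfloor>N / 10 ^ 9\<rfloor>"
    define s where "s = nat \<lfloor>N / 12\<rfloor>"
    have m: "real m \<le> N / 10 ^ 9" unfolding m_def by (rule of_nat_floor) (use N0 in simp)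
    have s: "real s \<le> N / 12" "N / 24 \<le> real s"
    proof -
      show "real s \<le> N / 12" unfolding s_def by (rule of_nat_floor) (use N0 in simp)
      have "N / 12 - 1 \<le> real s" using N0 unfolding s_def by linarith
      then show "N / 24 \<le> real s" using N0 by linarith
    qed
    have deg: "card {y. (x, y) \<in> mismatches V R \<phi>} \<le> m" if "x \<in> V" for x
    proof -
      have "{y. (x, y) \<in> mismatches V R \<phi>} = D x"
        using that R(1) by (auto simp: mismatches_def D_def reflp_def)
      moreover have "real (card (D x)) \<le> N / 10 ^ 9" using False that by force
      ultimately show ?thesis using le_nat_floor[of "card (D x)" "N / 10 ^ 9"] by (simp add: m_def)
    qed
    have large: "3 * s + 1 \<le> card {x \<in> V. \<phi> x = i}" if "i < 3" for i
    proof -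
      have "real (3 * s + 1) \<le> N / 4 + 1" using s by simp
      also have "\<dots> \<le> N / 3 - N / 10 ^ 13" using N0 by simp
      also have "\<dots> \<le> card {x \<in> V. \<phi> x = i}" using sizes[OF that] by linarith
      finally show ?thesis by (simp only: of_nat_le_iff)
    qed
    have "2 * card (embs V R) + b * s ^ 4
      \<le> 2 * card (embs V (same \<phi>)) + 2 * (216 * (b * m * card V ^ 3) + 1296 * (b * b * card V ^ 2))"
      using flat_gain[OF V R \<phi>(1) deg large] by (simp add: b_def \<phi>(2))
    from of_nat_mono[OF this, where 'a = real]
    have flat: "2 * real (card (embs V R)) + b * real s ^ 4
      \<le> 2 * card (embs V (same \<phi>)) + 2 * (216 * (real b * real m * N ^ 3) + 1296 * (real b * real b * N ^ 2))"
      by (simp add: N_def)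
    have MM: "card (embs V (same \<phi>)) \<le> M" by (rule M) (auto simp: reflp_def symp_def)
    define X where "X = b * N ^ 4"
    have X: "X \<ge> 0" using N0 by (simp add: X_def)
    have t1: "X / 331776 \<le> b * real s ^ 4"
    proof -
      have "(N / 24) ^ 4 \<le> real s ^ 4" using s N0 by (intro power_mono) auto
      then have "b * (N / 24) ^ 4 \<le> b * real s ^ 4" by (intro mult_left_mono) auto
      then show ?thesis by (simp add: X_def power_divide)
    qed
    have t2: "real b * real m * N ^ 3 \<le> X / 10 ^ 9"
    proof -
      have "real b * real m * N ^ 3 \<le> real b * (N / 10 ^ 9) * N ^ 3" using m N0 by (intro mult_right_mono mult_left_mono) auto
      also have "\<dots> = X / 10 ^ 9" by (simp add: X_def eval_nat_numeral)
      finally show ?thesis .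
    qed
    have t3: "real b * real b * N ^ 2 \<le> X / 10 ^ 31"
    proof -
      have "real b * real b * N ^ 2 \<le> real b * (N ^ 2 / 10 ^ 31) * N ^ 2" using bN N0 by (intro mult_right_mono mult_left_mono) auto
      also have "\<dots> = X / 10 ^ 31" by (simp add: X_def eval_nat_numeral)
      finally show ?thesis by simp
    qed
    have "2 * real (card (embs V R)) + 2 * (X / 10 ^ 13) \<le> 2 * M"
      using flat MM t1 t2 t3 X by (simp add: field_simps)
    then show ?thesis unfolding N_def[symmetric] b_def[symmetric] X_def[symmetric] by simp
  qed
qed

text \<open>It remains to see that an almost extremal relation is near three cliques. If \<open>R\<close> is not, consider the relations at
least half as far as the local bound allows with no fewer placements than \<open>R\<close>, and among them one of largest
potential. An improvement of it leaves this family, hence is near three cliques. As improvements are short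
steps, the chosen relation itself is within reach of the local bound, yet so far from three cliques that it has
substantially fewer copies than the maximum, a contradiction. An improvement that is not short gains at least
\<open>4 \<theta>\<^sup>6 n\<^sup>6\<close> placements for \<open>\<theta> = 1 / (8 * 10\<^sup>3\<^sup>1)\<close>, which is impossible too; this determines the constant
\<open>10\<^sup>1\<^sup>9\<^sup>2\<close>.\<close>

lemma stability:
  fixes M :: real
  assumes V: "finite V" and n: "real (card V) \<ge> 10 ^ 200"
    and M: "\<And>R'. reflp R' \<Longrightarrow> symp R' \<Longrightarrow> card (embs V R') \<le> M"
    and R: "reflp R" "symp R"
  shows "card (embs V R) + dist3 V R * real (card V) ^ 4 / 10 ^ 192 \<le> M"
proof (cases "M - real (card V) ^ 6 / 10 ^ 192 \<le> card (embs V R)")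
  case False
  (* far from extremal: the distance never exceeds n^2 *)
  have "real (dist3 V R) \<le> real (card V) ^ 2"
    using of_nat_mono[OF dist3_le_square[OF V, of R], where 'a = real] by simp
  then have "dist3 V R * real (card V) ^ 4 \<le> real (card V) ^ 2 * real (card V) ^ 4"
    by (intro mult_right_mono) auto
  also have "\<dots> = real (card V) ^ 6" by (simp flip: power_add)
  finally show ?thesis using False by (simp add: divide_right_mono field_simps)
next
  case near: True
  define N where "N = real (card V)"
  have N: "N \<ge> 10 ^ 200" using n by (simp add: N_def)
  have N40: "N \<ge> 10 ^ 40" by (rule order_trans[OF _ N]) simp
  have N0: "N > 0" by (rule less_le_trans[OF _ N]) simp
  have N5: "36 * N ^ 5 \<le> N ^ 6 / 10 ^ 198"
  proof -
    have "N ^ 5 * 10 ^ 200 \<le> N ^ 5 * N" using N N0 by (intro mult_left_mono) auto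
    also have "\<dots> = N ^ 6" by (simp add: eval_nat_numeral)
    finally have "N ^ 5 * 10 ^ 200 \<le> N ^ 6" .
    moreover have "36 * z \<le> w / 10 ^ 198" if "z * 10 ^ 200 \<le> w" "0 \<le> z" for z w :: real
      using that by simp
    ultimately show ?thesis using N0 by (metis less_imp_le zero_le_power)
  qed
  have N6: "N ^ 6 > 0" using N0 by simp
  have local: "card (embs V R') + dist3 V R' * N ^ 4 / 10 ^ 13 \<le> M"
    if "reflp R'" "symp R'" "M - N ^ 6 / 10 ^ 31 \<le> card (embs V R')" "dist3 V R' \<le> N ^ 2 / 10 ^ 31" for R'
    unfolding N_def
    by (rule local_stability[OF V _ M that(1,2)]) (use N40 that(3,4) in \<open>simp_all only: N_def\<close>)
  have le_homs: "real (card (embs V R')) \<le> card (homs V R')" for R' using embs_le_homs[OF V] by simp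
  have homs_le: "card (homs V R') \<le> card (embs V R') + N ^ 6 / 10 ^ 198" for R'
    using of_nat_mono[OF homs_le_embs[OF V, of R'], where 'a = real] N5 by (simp add: N_def)
  have "dist3 V R \<le> N ^ 2 / 10 ^ 31"
  proof (rule ccontr)
    assume "\<not> dist3 V R \<le> N ^ 2 / 10 ^ 31"
    then have far: "N ^ 2 / 10 ^ 31 < dist3 V R" by simp
    (* the lower bound on the distance is half the range of local_stability; the other half covers
       one short step *)
    let ?P = "\<lambda>R'. reflp R' \<and> symp R' \<and> card (homs V R) \<le> card (homs V R') \<and> N ^ 2 / (2 * 10 ^ 31) \<le> dist3 V R'"
    have "N ^ 2 / (2 * 10 ^ 31) \<le> N ^ 2 / 10 ^ 31" by simp
    then have "?P R" using R far by linarith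
    moreover have "\<forall>R'. ?P R' \<longrightarrow> potential V R' < Suc (card V ^ 6 * (card V ^ 2 + 1) + card V ^ 2)"
      using potential_bounded[OF V] le_imp_less_Suc by blast
    ultimately have "\<exists>R'. ?P R' \<and> (\<forall>R''. ?P R'' \<longrightarrow> potential V R'' \<le> potential V R')"
      by (rule ex_has_greatest_nat)
    then obtain R1 where R1: "reflp R1" "symp R1" "card (homs V R) \<le> card (homs V R1)" "N ^ 2 / (2 * 10 ^ 31) \<le> dist3 V R1"
      and max: "\<And>R''. ?P R'' \<Longrightarrow> potential V R'' \<le> potential V R1" by blast
    have "dist3 V R1 \<noteq> 0" using R1(4) N0 by (intro notI) simp
    from improve[OF V R1(1,2) _ this, of "1 / (8 * 10 ^ 31)"]
    obtain R2 where R2: "reflp R2" "symp R2" "potential V R1 < potential V R2" "card (homs V R1) \<le> card (homs V R2)"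
      and alt: "real (dist3 V R1) \<le> dist3 V R2 + 2 * N + 2 * (1 / (8 * 10 ^ 31)) * N ^ 2 \<or>
        real (card (homs V R1)) + 4 * (1 / (8 * 10 ^ 31)) ^ 6 * N ^ 6 \<le> card (homs V R2)"
      unfolding N_def by auto
    have "\<not> ?P R2" using max[of R2] R2(3) by auto
    then have d2: "dist3 V R2 < N ^ 2 / (2 * 10 ^ 31)" using R1(3) R2(1,2,4) by auto
    have e1: "M - N ^ 6 / 10 ^ 192 - N ^ 6 / 10 ^ 198 \<le> card (embs V R1)"
      using near le_homs[of R] homs_le[of R1] R1(3) unfolding N_def[symmetric] by linarith
    from alt show False
    proof
      assume "real (dist3 V R1) \<le> dist3 V R2 + 2 * N + 2 * (1 / (8 * 10 ^ 31)) * N ^ 2"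
      moreover have "2 * N \<le> N ^ 2 / (4 * 10 ^ 31)"
      proof -
        have "8 * 10 ^ 31 * N \<le> N * N" by (rule mult_right_mono[OF order_trans[OF _ N]]) (use N0 in auto)
        then show ?thesis by (simp add: power2_eq_square)
      qed
      ultimately have "dist3 V R1 \<le> N ^ 2 / 10 ^ 31" using d2 by simp
      moreover have "M - N ^ 6 / 10 ^ 31 \<le> card (embs V R1)"
      proof -
        have "M - Z / 10 ^ 31 \<le> e" if "M - Z / 10 ^ 192 - Z / 10 ^ 198 \<le> e" "0 < Z" for e Z
          using that by simp
        from this[OF e1 N6] show ?thesis .
      qed
      ultimately have l1: "card (embs V R1) + dist3 V R1 * N ^ 4 / 10 ^ 13 \<le> M" by (intro local R1)
      have l2: "N ^ 6 / (2 * 10 ^ 31) \<le> dist3 V R1 * N ^ 4"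
      proof -
        have "N ^ 2 / (2 * 10 ^ 31) * N ^ 4 \<le> dist3 V R1 * N ^ 4" using R1(4) N0 by (intro mult_right_mono) auto
        then show ?thesis by (simp flip: power_add)
      qed
      have False if "e + D / 10 ^ 13 \<le> M" "Z / (2 * 10 ^ 31) \<le> D" "M - Z / 10 ^ 192 - Z / 10 ^ 198 \<le> e" "0 < Z"
        for e D Z using that by simp
      from this[OF l1 l2 e1 N6] show False .
    next
      assume l1: "real (card (homs V R1)) + 4 * (1 / (8 * 10 ^ 31)) ^ 6 * N ^ 6 \<le> card (homs V R2)"
      have l2: "card (embs V R2) \<le> M" by (rule M[OF R2(1,2)])
      have "(1::real) / 10 ^ 191 \<le> 4 * (1 / (8 * 10 ^ 31)) ^ 6" by (simp add: power_divide)
      then have "1 / 10 ^ 191 * N ^ 6 \<le> 4 * (1 / (8 * 10 ^ 31)) ^ 6 * N ^ 6"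
        using N6 by (intro mult_right_mono) auto
      with l1 have l3: "card (homs V R1) + 1 / 10 ^ 191 * N ^ 6 \<le> card (homs V R2)" by linarith
      have False if "h + 1 / 10 ^ 191 * Z \<le> h'" "e' \<le> M" "h' \<le> e' + Z / 10 ^ 198" "e \<le> h"
          "M - Z / 10 ^ 192 - Z / 10 ^ 198 \<le> e" "0 < Z" for h h' e e' Z
        using that by simp
      from this[OF l3 l2 homs_le le_homs e1 N6] show False .
    qed
  qed
  moreover have "M - N ^ 6 / 10 ^ 31 \<le> card (embs V R)"
  proof -
    have "M - Z / 10 ^ 31 \<le> e" if "M - Z / 10 ^ 192 \<le> e" "0 < Z" for e Z using that by simp
    from this[OF near[folded N_def] N6] show ?thesis .
  qed
  ultimately have "card (embs V R) + dist3 V R * N ^ 4 / 10 ^ 13 \<le> M" by (intro local R)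
  moreover have "dist3 V R * N ^ 4 / 10 ^ 192 \<le> dist3 V R * N ^ 4 / 10 ^ 13"
    using N0 by (intro divide_left_mono) auto
  ultimately show ?thesis unfolding N_def[symmetric] by linarith
qed

section \<open>Densities, edit distance and blowups\<close>

definition adj :: "'a graph \<Rightarrow> 'a \<Rightarrow> 'a \<Rightarrow> bool" where
  "adj G x y \<longleftrightarrow> x = y \<or> {x, y} \<in> edges G"

lemma reflp_adj: "reflp (adj G)"
  by (simp add: reflp_def adj_def)

lemma symp_adj: "symp (adj G)"
  by (auto simp: symp_def adj_def insert_commute)

lemma F17_edge_iff:
  assumes "p < 6" "q < 6"
  shows "{p, q} \<in> edges F17 \<longleftrightarrow> p \<noteq> q \<and> component p = component q"
proof -
  have "\<forall>p<6. \<forall>q<6. {p, q} \<in> edges F17 \<longleftrightarrow> p \<noteq> q \<and> component p = component q"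
    unfolding all_less6 by (simp add: F17_def component_def doubleton_eq_iff)
  then show ?thesis using assms by blast
qed

lemma verts_F17: "verts F17 = {..<6}"
  by (simp add: F17_def)

lemma embs_image_iso:
  assumes G: "simple_graph G"
  shows "{S \<in> nsets (verts G) (card (verts F17)). isomorphic (induced G S) F17} = (\<lambda>e. e ` {..<6}) ` embs (verts G) (adj G)"
proof (intro equalityI subsetI)
  have fin: "finite (verts G)" using G by (simp add: simple_graph_def)
  have loop: "{x} \<notin> edges G" for x
    using G by (auto simp: simple_graph_def nsets_def)
  {
    fix S assume S: "S \<in> {S \<in> nsets (verts G) (card (verts F17)). isomorphic (induced G S) F17}"
    then have SV: "S \<subseteq> verts G" by (auto simp: nsets_def)
    obtain f where f: "is_iso f (induced G S) F17" using S by (auto simp: isomorphic_def)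
    have bij: "bij_betw f S {..<6}" using f by (simp add: is_iso_def induced_def verts_F17)
    have fe: "{x, y} \<in> edges G \<longleftrightarrow> {f x, f y} \<in> edges F17" if "x \<in> S" "y \<in> S" for x y
      using f that by (auto simp: is_iso_def induced_def)
    define e where "e = restrict (inv_into S f) {..<6}"
    have bij': "bij_betw (inv_into S f) {..<6} S" by (rule bij_betw_inv_into[OF bij])
    have img: "e ` {..<6} = S" using bij' by (simp add: e_def bij_betw_def)
    have inj: "inj_on e {..<6}" using bij' by (simp add: e_def bij_betw_def inj_on_def)
    have eS: "e p \<in> S" "f (e p) = p" if "p < 6" for p
      using bij_betwE[OF bij'] bij_betw_inv_into_right[OF bij] that by (auto simp: e_def)
    have "adj G (e p) (e q) \<longleftrightarrow> component p = component q" if "p < 6" "q < 6" for p q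
    proof (cases "p = q")
      case True then show ?thesis by (simp add: adj_def)
    next
      case False
      then have "e p \<noteq> e q" using inj that by (auto simp: inj_on_def)
      then have "adj G (e p) (e q) \<longleftrightarrow> {p, q} \<in> edges F17"
        using fe[OF eS(1)[OF that(1)] eS(1)[OF that(2)]] eS(2) that by (simp add: adj_def)
      then show ?thesis using F17_edge_iff[OF that] False by simp
    qed
    moreover have "e \<in> maps (verts G)" using eS SV by (auto simp: e_def)
    ultimately have "e \<in> embs (verts G) (adj G)" using inj by (simp add: embs_def homs_def)
    then show "S \<in> (\<lambda>e. e ` {..<6}) ` embs (verts G) (adj G)" using img by blast
  }
  {
    fix S assume "S \<in> (\<lambda>e. e ` {..<6}) ` embs (verts G) (adj G)"
    then obtain e where e: "e \<in> embs (verts G) (adj G)" "S = e ` {..<6}" by auto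
    have inj: "inj_on e {..<6}" and eV: "e \<in> maps (verts G)"
      and ea: "\<And>p q. p < 6 \<Longrightarrow> q < 6 \<Longrightarrow> adj G (e p) (e q) \<longleftrightarrow> component p = component q"
      using e(1) by (auto simp: embs_def homs_def)
    have bij: "bij_betw e {..<6} S" using inj e(2) by (simp add: bij_betw_def)
    have "S \<subseteq> verts G" using eV e(2) by auto
    moreover have "card S = 6" using card_image[OF inj] e(2) by simp
    ultimately have nS: "S \<in> nsets (verts G) (card (verts F17))"
      by (simp add: nsets_def verts_F17 finite_subset[OF _ fin])
    let ?f = "inv_into {..<6} e"
    have "{x, y} \<in> edges (induced G S) \<longleftrightarrow> {?f x, ?f y} \<in> edges F17" if xy: "x \<in> S" "y \<in> S" for x y
    proof -
      obtain p q where p: "p < 6" "x = e p" and q: "q < 6" "y = e q" using xy e(2) by auto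
      have f: "?f x = p" "?f y = q" using inj p q by (simp_all add: inv_into_f_f)
      have "{x, y} \<in> edges (induced G S) \<longleftrightarrow> {x, y} \<in> edges G" using xy by (simp add: induced_def)
      also have "\<dots> \<longleftrightarrow> p \<noteq> q \<and> component p = component q"
      proof (cases "p = q")
        case True then show ?thesis using loop p q by simp
      next
        case False
        then have "e p \<noteq> e q" using inj p q by (auto simp: inj_on_def)
        then show ?thesis using ea[OF p(1) q(1)] p q False by (simp add: adj_def)
      qed
      also have "\<dots> \<longleftrightarrow> {p, q} \<in> edges F17" using F17_edge_iff p q by simp
      finally show ?thesis by (simp add: f)
    qed
    then have "is_iso ?f (induced G S) F17"
      using bij_betw_inv_into[OF bij] by (auto simp: is_iso_def induced_def verts_F17)
    then show "S \<in> {S \<in> nsets (verts G) (card (verts F17)). isomorphic (induced G S) F17}"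
      using nS by (auto simp: isomorphic_def)
  }
qed

text \<open>The components have different sizes, so none can be moved to another one.\<close>

lemma component_preserved:
  assumes \<pi>: "\<pi> \<in> embs {..<6} (same component)" and p: "p < 6"
  shows "component (\<pi> p) = component p"
proof -
  have inj: "inj_on \<pi> {..<6}" and \<pi>6: "\<And>p. p < 6 \<Longrightarrow> \<pi> p < 6"
    and iff: "\<And>p q. p < 6 \<Longrightarrow> q < 6 \<Longrightarrow> component (\<pi> p) = component (\<pi> q) \<longleftrightarrow> component p = component q"
    using \<pi> by (auto simp: embs_def homs_def PiE_iff)
  define K where "K c = {q. q < 6 \<and> component q = c}" for c
  have onto: "\<pi> ` {..<6} = {..<6}" by (rule endo_inj_surj) (use inj \<pi>6 in auto)
  have "\<pi> ` K (component p) = K (component (\<pi> p))"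
  proof (intro equalityI subsetI)
    fix y assume "y \<in> \<pi> ` K (component p)"
    then show "y \<in> K (component (\<pi> p))" using iff[OF _ p] \<pi>6 by (auto simp: K_def)
  next
    fix y assume y: "y \<in> K (component (\<pi> p))"
    then have "y \<in> \<pi> ` {..<6}" using onto by (simp add: K_def)
    then obtain q where "q < 6" "y = \<pi> q" by auto
    then show "y \<in> \<pi> ` K (component p)" using y iff[of q p] p by (auto simp: K_def)
  qed
  moreover have "inj_on \<pi> (K (component p))" using inj by (rule inj_on_subset) (auto simp: K_def)
  ultimately have eq: "card (K (component p)) = card (K (component (\<pi> p)))" using card_image by metis
  have "K 0 = {0, 1, 3}" "K 1 = {4, 5}" "K 2 = {2}"
    by (auto simp: K_def component_def split: if_splits)
  then have sz: "card (K 0) = 3" "card (K 1) = 2" "card (K 2) = 1" by simp_all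
  have "component q = 0 \<or> component q = 1 \<or> component q = 2" for q by (simp add: component_def)
  from this[of p] this[of "\<pi> p"] show ?thesis using eq sz by auto
qed

lemma card_automorphisms_F17: "card (embs {..<6} (same component)) = 12"
proof -
  let ?E = "embs {..<6} (same component)" and ?g = "\<lambda>\<pi>. map \<pi> [0..<6]"
  let ?L = "filter distinct (product_lists (map (\<lambda>p. filter (\<lambda>q. component q = component p) [0..<6]) [0..<6]))"
  have inj: "inj_on ?g ?E"
  proof (rule inj_onI)
    fix \<pi> \<rho> assume a: "\<pi> \<in> ?E" "\<rho> \<in> ?E" and eq: "?g \<pi> = ?g \<rho>"
    have E: "\<pi> \<in> maps {..<6}" "\<rho> \<in> maps {..<6}" using a embs_maps by blast+
    show "\<pi> = \<rho>" by (rule PiE_ext[OF E]) (use eq in auto)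
  qed
  have L: "xs \<in> set ?L \<longleftrightarrow> distinct xs \<and> length xs = 6 \<and> (\<forall>p<6. xs ! p < 6 \<and> component (xs ! p) = component p)" for xs
    unfolding set_filter product_lists_set list_all2_conv_all_nth by auto
  have "?g ` ?E = set ?L"
  proof (intro equalityI subsetI)
    fix xs assume "xs \<in> ?g ` ?E"
    then obtain \<pi> where \<pi>: "\<pi> \<in> ?E" "xs = ?g \<pi>" by auto
    have "distinct xs" using \<pi> by (simp add: embs_def distinct_map atLeast0LessThan)
    then show "xs \<in> set ?L"
      unfolding L using component_preserved[OF \<pi>(1)] \<pi> by (auto simp: embs_def homs_def PiE_iff)
  next
    fix xs assume "xs \<in> set ?L"
    then have xs: "distinct xs" "length xs = 6" "\<And>p. p < 6 \<Longrightarrow> xs ! p < 6 \<and> component (xs ! p) = component p"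
      unfolding L by auto
    let ?\<pi> = "\<lambda>p\<in>{..<6}. xs ! p"
    have "?\<pi> \<in> homs {..<6} (same component)" using xs by (auto simp: homs_def)
    moreover have "inj_on ?\<pi> {..<6}" using xs by (simp add: inj_on_def nth_eq_iff_index_eq)
    ultimately have "?\<pi> \<in> ?E" by (simp add: embs_def)
    moreover have "xs = ?g ?\<pi>" by (rule nth_equalityI) (use xs in auto)
    ultimately show "xs \<in> ?g ` ?E" by blast
  qed
  then have "card ?E = card (set ?L)" using card_image[OF inj] by simp
  also have "\<dots> = 12" by code_simp
  finally show ?thesis .
qed

text \<open>Two embeddings with the same image differ by an automorphism of \<open>F17\<close>.\<close>

lemma card_embs_fibre:
  assumes e0: "e0 \<in> embs V R"
  shows "card {e \<in> embs V R. e ` {..<6} = e0 ` {..<6}} = 12"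
proof -
  let ?E = "embs {..<6} (same component)" and ?F = "{e \<in> embs V R. e ` {..<6} = e0 ` {..<6}}"
  have inj0: "inj_on e0 {..<6}" and e0V: "e0 \<in> maps V"
    and e0R: "\<And>p q. p < 6 \<Longrightarrow> q < 6 \<Longrightarrow> R (e0 p) (e0 q) \<longleftrightarrow> component p = component q"
    using e0 by (auto simp: embs_def homs_def)
  have "bij_betw (\<lambda>\<pi>. \<lambda>p\<in>{..<6}. e0 (\<pi> p)) ?E ?F"
  proof (rule bij_betwI')
    fix \<pi> \<rho> assume a: "\<pi> \<in> ?E" "\<rho> \<in> ?E"
    have E: "\<pi> \<in> {..<6} \<rightarrow>\<^sub>E {..<6}" "\<rho> \<in> {..<6} \<rightarrow>\<^sub>E {..<6}" using a embs_maps by blast+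
    show "((\<lambda>p\<in>{..<6}. e0 (\<pi> p)) = (\<lambda>p\<in>{..<6}. e0 (\<rho> p))) = (\<pi> = \<rho>)"
    proof
      assume eq: "(\<lambda>p\<in>{..<6}. e0 (\<pi> p)) = (\<lambda>p\<in>{..<6}. e0 (\<rho> p))"
      show "\<pi> = \<rho>"
      proof (rule PiE_ext[OF E])
        fix p :: nat assume p: "p \<in> {..<6}"
        have "e0 (\<pi> p) = e0 (\<rho> p)" using fun_cong[OF eq, of p] p by simp
        moreover have "\<pi> p \<in> {..<6}" "\<rho> p \<in> {..<6}" using E p by auto
        ultimately show "\<pi> p = \<rho> p" using inj0 by (simp add: inj_on_eq_iff)
      qed
    qed simp
  next
    fix \<pi> assume \<pi>: "\<pi> \<in> ?E"
    have \<pi>6: "\<And>p. p < 6 \<Longrightarrow> \<pi> p < 6" and inj: "inj_on \<pi> {..<6}"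
      and c: "\<And>p q. p < 6 \<Longrightarrow> q < 6 \<Longrightarrow> component (\<pi> p) = component (\<pi> q) \<longleftrightarrow> component p = component q"
      using \<pi> by (auto simp: embs_def homs_def PiE_iff)
    have onto: "\<pi> ` {..<6} = {..<6}" by (rule endo_inj_surj) (use inj \<pi>6 in auto)
    let ?e = "\<lambda>p\<in>{..<6}. e0 (\<pi> p)"
    have "?e ` {..<6} = e0 ` (\<pi> ` {..<6})" by auto
    then have "?e ` {..<6} = e0 ` {..<6}" by (simp only: onto)
    moreover have "?e \<in> homs V R"
    proof -
      have "?e \<in> maps V" using e0V \<pi>6 by (auto simp: PiE_iff)
      moreover have "R (?e p) (?e q) \<longleftrightarrow> component p = component q" if "p < 6" "q < 6" for p q
        using e0R[OF \<pi>6[OF that(1)] \<pi>6[OF that(2)]] c[OF that] that by simp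
      ultimately show ?thesis by (simp add: homs_def)
    qed
    moreover have "inj_on ?e {..<6}"
    proof (rule inj_onI)
      fix p q :: nat assume pq: "p \<in> {..<6}" "q \<in> {..<6}" "?e p = ?e q"
      then have "\<pi> p = \<pi> q" using inj0 \<pi>6 by (simp add: inj_on_eq_iff)
      then show "p = q" using inj pq by (simp add: inj_on_eq_iff)
    qed
    ultimately show "?e \<in> ?F" by (simp add: embs_def)
  next
    fix e assume e: "e \<in> ?F"
    have inj: "inj_on e {..<6}" and eV: "e \<in> maps V" and img: "e ` {..<6} = e0 ` {..<6}"
      and eR: "\<And>p q. p < 6 \<Longrightarrow> q < 6 \<Longrightarrow> R (e p) (e q) \<longleftrightarrow> component p = component q"
      using e by (auto simp: embs_def homs_def)
    define \<pi> where "\<pi> = (\<lambda>p\<in>{..<6}. inv_into {..<6} e0 (e p))"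
    have \<pi>: "\<pi> p < 6" "e0 (\<pi> p) = e p" if "p < 6" for p
    proof -
      have "e p \<in> e0 ` {..<6}" using img that by blast
      then show "\<pi> p < 6" "e0 (\<pi> p) = e p"
        using that inv_into_into[of "e p" e0 "{..<6}"] f_inv_into_f[of "e p" e0 "{..<6}"] by (auto simp: \<pi>_def)
    qed
    have "inj_on \<pi> {..<6}"
    proof (rule inj_onI)
      fix p q :: nat assume "p \<in> {..<6}" "q \<in> {..<6}" "\<pi> p = \<pi> q"
      then have "e p = e q" using \<pi>(2)[of p] \<pi>(2)[of q] by simp
      then show "p = q" using inj \<open>p \<in> {..<6}\<close> \<open>q \<in> {..<6}\<close> by (simp add: inj_on_eq_iff)
    qed
    moreover have "component (\<pi> p) = component (\<pi> q) \<longleftrightarrow> component p = component q" if "p < 6" "q < 6" for p q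
      using e0R[OF \<pi>(1)[OF that(1)] \<pi>(1)[OF that(2)]] eR[OF that] \<pi>(2) that by simp
    moreover have "\<pi> \<in> {..<6} \<rightarrow>\<^sub>E {..<6}" using \<pi>(1) by (auto simp: \<pi>_def)
    ultimately have "\<pi> \<in> ?E" by (simp add: embs_def homs_def)
    moreover have "e = (\<lambda>p\<in>{..<6}. e0 (\<pi> p))"
    proof (rule PiE_ext[OF eV])
      show "(\<lambda>p\<in>{..<6}. e0 (\<pi> p)) \<in> maps V" using \<pi>(1) e0V by (auto simp: PiE_iff)
    qed (use \<pi>(2) in auto)
    ultimately show "\<exists>\<pi>\<in>?E. e = (\<lambda>p\<in>{..<6}. e0 (\<pi> p))" by blast
  qed
  from bij_betw_same_card[OF this] show ?thesis unfolding card_automorphisms_F17 by (rule sym)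
qed

lemma density_F17:
  assumes G: "simple_graph G"
  shows "density F17 G = card (embs (verts G) (adj G)) / (12 * real (card (verts G) choose 6))"
proof -
  let ?E = "embs (verts G) (adj G)"
  let ?\<S> = "(\<lambda>e. e ` {..<6}) ` ?E"
  have fin: "finite ?E" using G by (intro finite_embs) (simp add: simple_graph_def)
  have "?E = (\<Union>S\<in>?\<S>. {e \<in> ?E. e ` {..<6} = S})" by blast
  then have "card ?E = card (\<Union>S\<in>?\<S>. {e \<in> ?E. e ` {..<6} = S})" by simp
  also have "\<dots> = (\<Sum>S\<in>?\<S>. card {e \<in> ?E. e ` {..<6} = S})"
    by (rule card_UN_disjoint) (use fin in auto)
  also have "\<dots> = (\<Sum>S\<in>?\<S>. 12)" by (rule sum.cong[OF refl]) (use card_embs_fibre in auto)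
  finally have "card ?E = 12 * card ?\<S>" by simp
  then show ?thesis
    unfolding density_def unfolding embs_image_iso[OF G] unfolding verts_F17 by simp
qed

definition graph_of :: "'a set \<Rightarrow> ('a \<Rightarrow> 'a \<Rightarrow> bool) \<Rightarrow> 'a graph" where
  "graph_of V R = (V, {{x, y} | x y. x \<in> V \<and> y \<in> V \<and> x \<noteq> y \<and> R x y})"

lemma simple_graph_of: "finite V \<Longrightarrow> simple_graph (graph_of V R)"
  by (auto simp: simple_graph_def graph_of_def nsets_def)

lemma embs_graph_of:
  assumes R: "reflp R" "symp R"
  shows "embs V (adj (graph_of V R)) = embs V R"
proof (rule embs_cong)
  fix x y assume xy: "x \<in> V" "y \<in> V"
  have "R y x = R x y" using R(2) by (meson sympD)
  then show "adj (graph_of V R) x y = R x y"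
    using xy R(1) by (auto simp: adj_def graph_of_def doubleton_eq_iff reflp_def)
qed

lemma
  fixes n :: nat
  shows density_le_max: "\<And>G :: nat graph. simple_graph G \<Longrightarrow> card (verts G) = n \<Longrightarrow> density F17 G \<le> max_density F17 n"
    and max_density_attained: "\<exists>G :: nat graph. simple_graph G \<and> card (verts G) = n \<and> density F17 G = max_density F17 n"
proof -
  let ?D = "{density F17 G | G :: nat graph. simple_graph G \<and> card (verts G) = n}"
  have "?D \<subseteq> (\<lambda>k. real k / (12 * real (n choose 6))) ` {..n ^ 6}"
  proof
    fix d assume "d \<in> ?D"
    then obtain G :: "nat graph" where G: "simple_graph G" "card (verts G) = n" "d = density F17 G" by auto
    have "finite (verts G)" using G(1) by (simp add: simple_graph_def)
    then have "card (embs (verts G) (adj G)) \<le> n ^ 6"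
      using embs_le_homs card_homs_le G(2) order_trans by metis
    then show "d \<in> (\<lambda>k. real k / (12 * real (n choose 6))) ` {..n ^ 6}"
      using density_F17[OF G(1)] G by auto
  qed
  then have fin: "finite ?D" by (rule finite_subset) simp
  have "simple_graph ({..<n}, {})" by (simp add: simple_graph_def)
  then have ne: "?D \<noteq> {}" by (force intro!: exI[of _ "({..<n}, {})"])
  show "density F17 G \<le> max_density F17 n" if "simple_graph G" "card (verts G) = n" for G :: "nat graph"
  proof -
    have "density F17 G \<in> ?D" using that by blast
    then show ?thesis unfolding max_density_def by (rule Max_ge[OF fin])
  qed
  show "\<exists>G :: nat graph. simple_graph G \<and> card (verts G) = n \<and> density F17 G = max_density F17 n"
  proof -
    have "max_density F17 n \<in> ?D" unfolding max_density_def by (rule Max_in[OF fin ne])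
    then show ?thesis by force
  qed
qed

lemma embs_le_max_density:
  fixes V :: "nat set"
  assumes V: "finite V" and R: "reflp R" "symp R" and n: "card V \<ge> 6"
  shows "card (embs V R) \<le> 12 * real (card V choose 6) * max_density F17 (card V)"
proof -
  have "density F17 (graph_of V R) \<le> max_density F17 (card V)"
    by (rule density_le_max[OF simple_graph_of[OF V]]) (simp add: graph_of_def)
  moreover have "density F17 (graph_of V R) = card (embs V R) / (12 * real (card V choose 6))"
    using density_F17[OF simple_graph_of[OF V, of R]] embs_graph_of[OF R, of V] by (simp add: graph_of_def)
  moreover have "real (card V choose 6) > 0" using n by simp
  ultimately show ?thesis by (simp add: field_simps)
qed

lemma B17_edge_iff: "{i, j} \<in> edges B17 \<longleftrightarrow> i = j \<and> i < 3"
  by (auto simp: B17_def doubleton_eq_iff less3_cases)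

lemma verts_B17: "verts B17 = {..<3}"
  by (simp add: B17_def)

lemma blowup_B17: "blowup B17 V = (\<Union>i<3. V i, {{x, y} | x y. x \<noteq> y \<and> (\<exists>i<3. x \<in> V i \<and> y \<in> V i)})"
proof -
  have "{{x, y} | x y i j. i \<in> verts B17 \<and> j \<in> verts B17 \<and> x \<in> V i \<and> y \<in> V j \<and> x \<noteq> y \<and> {i, j} \<in> edges B17}
    = {{x, y} | x y. x \<noteq> y \<and> (\<exists>i<3. x \<in> V i \<and> y \<in> V i)}"
    unfolding B17_edge_iff verts_B17 lessThan_iff by blast
  then show ?thesis by (simp add: blowup_def verts_B17)
qed

lemma edit_distance_le_dist3:
  fixes G :: "nat graph"
  assumes G: "simple_graph G"
  shows "edit_distance G (blowups B17) \<le> dist3 (verts G) (adj G)"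
proof -
  let ?V = "verts G"
  have fin: "finite ?V" and GE: "edges G \<subseteq> nsets ?V 2" using G by (auto simp: simple_graph_def)
  obtain \<phi> where \<phi>: "\<phi> \<in> ?V \<rightarrow> {..<3}" "card (mismatches ?V (adj G) \<phi>) = dist3 ?V (adj G)"
    by (rule dist3_attained)
  define H where "H = graph_of ?V (same \<phi>)"
  define W where "W i = {x \<in> ?V. \<phi> x = i}" for i
  have "blowup B17 W \<in> blowups B17"
    unfolding blowups_def using fin
    by (intro CollectI exI[of _ W]) (auto simp: blowup_parts_def disjoint_family_on_def W_def)
  moreover have "H = blowup B17 W"
  proof -
    have "(\<exists>i<3. x \<in> W i \<and> y \<in> W i) \<longleftrightarrow> x \<in> ?V \<and> y \<in> ?V \<and> \<phi> x = \<phi> y" for x y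
      using \<phi>(1) by (auto simp: W_def)
    moreover have "(\<Union>i<3. W i) = ?V" using \<phi>(1) by (auto simp: W_def)
    ultimately show ?thesis unfolding H_def graph_of_def blowup_B17 by (simp add: conj_ac)
  qed
  moreover have "isomorphic H H"
    unfolding isomorphic_def is_iso_def by (intro exI[of _ id]) auto
  moreover have "H = (?V, edges H)" by (simp add: H_def graph_of_def)
  moreover have HE: "edges H \<subseteq> nsets ?V 2"
    using simple_graph_of[OF fin, of "same \<phi>"] by (simp add: simple_graph_def H_def graph_of_def)
  ultimately have "edit_distance G (blowups B17) \<le> card ((edges G - edges H) \<union> (edges H - edges G))"
    unfolding edit_distance_def by (intro Least_le exI[of _ "edges H"]) (metis)
  also have "\<dots> \<le> card ((\<lambda>(x, y). {x, y}) ` mismatches ?V (adj G) \<phi>)"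
  proof (rule card_mono)
    show "finite ((\<lambda>(x, y). {x, y}) ` mismatches ?V (adj G) \<phi>)" using finite_mismatches[OF fin] by simp
    show "(edges G - edges H) \<union> (edges H - edges G) \<subseteq> (\<lambda>(x, y). {x, y}) ` mismatches ?V (adj G) \<phi>"
    proof
      fix e assume e: "e \<in> (edges G - edges H) \<union> (edges H - edges G)"
      then have "e \<in> nsets ?V 2" using GE HE by blast
      then obtain x y where xy: "e = {x, y}" "x \<in> ?V" "y \<in> ?V" "x \<noteq> y"
        by (auto simp: nsets_def card_2_iff)
      have "e \<in> edges H \<longleftrightarrow> \<phi> x = \<phi> y"
        using xy by (auto simp: H_def graph_of_def doubleton_eq_iff)
      then have "(x, y) \<in> mismatches ?V (adj G) \<phi>"
        using e xy by (auto simp: mismatches_def adj_def)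
      then show "e \<in> (\<lambda>(x, y). {x, y}) ` mismatches ?V (adj G) \<phi>" using xy(1) by force
    qed
  qed
  also have "\<dots> \<le> dist3 ?V (adj G)"
    using card_image_le[OF finite_mismatches[OF fin, of "adj G" \<phi>]] \<phi>(2) by simp
  finally show ?thesis .
qed

lemma perfectly_stable_F17: "perfectly_stable F17 B17"
  unfolding perfectly_stable_def
proof (intro exI[of _ "10 ^ 200"] conjI allI impI)
  (* as threshold for the order, 10^200 comes from the lemma stability; as factor, it only has to
     exceed 12 * 10^192, where 12 is the number of automorphisms of F17 *)
  fix G :: "nat graph" assume "simple_graph G \<and> real (card (verts G)) \<ge> 10 ^ 200"
  then have G: "simple_graph G" and n: "real (card (verts G)) \<ge> 10 ^ 200" by auto
  let ?V = "verts G"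
  define N where "N = real (card ?V)"
  define b where "b = real (card ?V choose 6)"
  define d where "d = real (dist3 ?V (adj G))"
  define \<Delta> where "\<Delta> = max_density F17 (card ?V) - density F17 G"
  have fin: "finite ?V" using G by (simp add: simple_graph_def)
  have "(6::real) \<le> N" unfolding N_def by (rule order_trans[OF _ n]) simp
  then have n6: "card ?V \<ge> 6" and N0: "N > 0" by (simp_all add: N_def)
  have b0: "b > 0" using n6 by (simp add: b_def)
  have "b \<le> N ^ 6"
    using of_nat_mono[OF binomial_le_pow[OF n6], where 'a = real] by (simp add: b_def N_def)
  have "card (embs ?V (adj G)) + d * N ^ 4 / 10 ^ 192 \<le> 12 * b * max_density F17 (card ?V)"
    unfolding d_def N_def b_def
    by (rule stability[OF fin n _ reflp_adj symp_adj]) (rule embs_le_max_density[OF fin _ _ n6])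
  moreover have "card (embs ?V (adj G)) = 12 * b * density F17 G"
    using density_F17[OF G] b0 by (simp add: b_def)
  ultimately have "d * N ^ 4 / 10 ^ 192 \<le> 12 * b * \<Delta>" by (simp add: \<Delta>_def algebra_simps)
  also have "12 * b * \<Delta> \<le> 12 * N ^ 6 * \<Delta>"
    using density_le_max[OF G refl] \<open>b \<le> N ^ 6\<close> by (intro mult_right_mono) (auto simp: \<Delta>_def)
  also have "N ^ 6 = N ^ 2 * N ^ 4" by (simp flip: power_add)
  finally have le: "d * N ^ 4 / 10 ^ 192 \<le> 12 * (N ^ 2 * N ^ 4) * \<Delta>" .
  have "X \<le> (12 * c * D * a) * e" if "X / c \<le> 12 * (a * e) * D" "0 < c" for X c a e D :: real
    using that by (simp add: field_simps)
  from this[OF le] have "d * N ^ 4 \<le> (12 * 10 ^ 192 * \<Delta> * N ^ 2) * N ^ 4" by simp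
  then have "d \<le> 12 * 10 ^ 192 * \<Delta> * N ^ 2" using N0 by (simp add: mult_le_cancel_right)
  also have "\<dots> \<le> 10 ^ 200 * \<Delta> * N ^ 2"
    using density_le_max[OF G refl] by (intro mult_right_mono) (auto simp: \<Delta>_def)
  finally have "d \<le> 10 ^ 200 * \<Delta> * N ^ 2" .
  then show "real (edit_distance G (blowups B17))
      \<le> 10 ^ 200 * (max_density F17 (card ?V) - density F17 G) * real (card ?V) ^ 2"
    using of_nat_mono[OF edit_distance_le_dist3[OF G], where 'a = real] by (simp add: d_def N_def \<Delta>_def)
qed simp

lemma choose6: "real (n choose 6) = real n * (real n - 1) * (real n - 2) * (real n - 3) * (real n - 4) * (real n - 5) / 720"
proof -
  have "real (n choose 6) = (\<Prod>i = 0..<6. real n - real i) / fact 6"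
    by (simp add: binomial_gbinomial gbinomial_prod_rev)
  moreover have "{0..<6} = {0, 1, 2, 3, 4, 5 :: nat}" by auto
  ultimately show ?thesis by (simp add: fact_numeral mult.assoc)
qed

text \<open>The normalisation is by \<open>n\<^sup>6\<close>, with \<open>n\<close> the index of the sequence, because the orders \<open>N n\<close> of the graphs in a
sequence of blowups are only asymptotic to \<open>n\<close>.\<close>

lemma choose6_limit:
  fixes N :: "nat \<Rightarrow> nat"
  assumes "(\<lambda>n. real (N n) / real n) \<longlonglongrightarrow> 1"
  shows "(\<lambda>n. 12 * real (N n choose 6) / real n ^ 6) \<longlonglongrightarrow> 1 / 60"
proof -
  let ?r = "\<lambda>n. real (N n) / real n"
  have "(\<lambda>n. ?r n * (?r n - 1 / real n) * (?r n - 2 / real n) * (?r n - 3 / real n) * (?r n - 4 / real n)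
      * (?r n - 5 / real n) / 60) \<longlonglongrightarrow> 1 * (1 - 0) * (1 - 0) * (1 - 0) * (1 - 0) * (1 - 0) / 60"
    by (intro tendsto_intros assms lim_const_over_n) simp
  moreover have "eventually (\<lambda>n. ?r n * (?r n - 1 / real n) * (?r n - 2 / real n) * (?r n - 3 / real n) * (?r n - 4 / real n)
      * (?r n - 5 / real n) / 60 = 12 * real (N n choose 6) / real n ^ 6) sequentially"
    using eventually_gt_at_top[of 0]
  proof eventually_elim
    case (elim n)
    then show ?case unfolding choose6 diff_divide_distrib[symmetric] by (simp add: eval_nat_numeral)
  qed
  ultimately show ?thesis by (simp add: tendsto_cong)
qed

lemma max_density_limit: "max_density F17 \<longlonglongrightarrow> 40 / 81"
proof -
  let ?c = "\<lambda>n. 12 * real (n choose 6) / real n ^ 6"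
  have "(\<lambda>n. real n / real n) \<longlonglongrightarrow> 1"
    by (rule tendsto_eventually) (use eventually_gt_at_top[of 0] in eventually_elim, simp)
  then have c: "?c \<longlonglongrightarrow> 1 / 60" by (rule choose6_limit)
  have up: "(\<lambda>n. 2 / 243 / ?c n) \<longlonglongrightarrow> 2 / 243 / (1 / 60)"
    by (intro tendsto_divide tendsto_const c) simp
  have low: "(\<lambda>n. (2 / 243 - 37 / real n) / ?c n) \<longlonglongrightarrow> (2 / 243 - 0) / (1 / 60)"
    by (intro tendsto_divide tendsto_diff tendsto_const c lim_const_over_n) simp
  have ev: "eventually (\<lambda>n. (2 / 243 - 37 / real n) / ?c n \<le> max_density F17 n \<and> max_density F17 n \<le> 2 / 243 / ?c n) sequentially"
    using eventually_ge_at_top[of 6]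
  proof eventually_elim
    case (elim n)
    have b: "real (n choose 6) > 0" using elim by simp
    have n0: "real n > 0" using elim by simp
    obtain G :: "nat graph" where G: "simple_graph G" "card (verts G) = n" "density F17 G = max_density F17 n"
      using max_density_attained by blast
    have fin: "finite (verts G)" using G(1) by (simp add: simple_graph_def)
    have "card (embs (verts G) (adj G)) \<le> 2 / 243 * real n ^ 6"
      using homs_bound[OF fin reflp_adj symp_adj, of G] embs_le_homs[OF fin, of "adj G"] G(2) by simp
    then have "card (embs (verts G) (adj G)) / (12 * real (n choose 6)) \<le> 2 / 243 * real n ^ 6 / (12 * real (n choose 6))"
      by (rule divide_right_mono) simp
    then have "max_density F17 n \<le> 2 / 243 * real n ^ 6 / (12 * real (n choose 6))"
      using density_F17[OF G(1)] G(2,3) by simp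
    moreover have "(2 / 243 - 37 / real n) / ?c n \<le> max_density F17 n"
    proof -
      obtain \<phi> :: "nat \<Rightarrow> nat" where "2 / 243 * real (card {..<n}) ^ 6 - 37 * real (card {..<n}) ^ 5 \<le> card (embs {..<n} (same \<phi>))"
        using balanced_embs[of "{..<n}"] elim by auto
      also have "card (embs {..<n} (same \<phi>)) \<le> 12 * real (n choose 6) * max_density F17 n"
        using embs_le_max_density[of "{..<n}" "same \<phi>"] elim by (simp add: reflp_def symp_def)
      finally have "2 / 243 * real n ^ 6 - 37 * real n ^ 5 \<le> 12 * real (n choose 6) * max_density F17 n" by simp
      moreover have "2 / 243 * real n ^ 6 - 37 * real n ^ 5 = (2 / 243 - 37 / real n) * real n ^ 6"
        using n0 by (simp add: algebra_simps eval_nat_numeral)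
      ultimately have "(2 / 243 - 37 / real n) * real n ^ 6 / (12 * real (n choose 6)) \<le> max_density F17 n"
        using b by (simp add: divide_le_eq mult.commute)
      then show ?thesis by simp
    qed
    ultimately show ?case by simp
  qed
  show ?thesis
  proof (rule tendsto_sandwich)
    show "(\<lambda>n. (2 / 243 - 37 / real n) / ?c n) \<longlonglongrightarrow> 40 / 81" using low by simp
    show "(\<lambda>n. 2 / 243 / ?c n) \<longlonglongrightarrow> 40 / 81" using up by simp
  qed (use ev in \<open>auto elim: eventually_mono\<close>)
qed

lemma distinct_sum_scale: "distinct_sum I (\<lambda>i. c i / n) = distinct_sum I c / n ^ 6"
proof -
  have "distinct_sum I (\<lambda>i. c i / n) = (\<Sum>i\<in>I. \<Sum>j\<in>I - {i}. \<Sum>k\<in>I - {i, j}. c i ^ 3 * c j ^ 2 * c k / n ^ 6)"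
    unfolding distinct_sum_def by (intro sum.cong refl) (simp add: power_divide eval_nat_numeral)
  then show ?thesis by (simp add: distinct_sum_def sum_divide_distrib)
qed

lemma blowup_B17_embs:
  fixes V :: "nat \<Rightarrow> nat set"
  assumes P: "blowup_parts B17 V"
  defines "n \<equiv> card (V 0) + card (V 1) + card (V 2)"
  shows "density F17 (blowup B17 V) \<le> distinct_sum {..<3} (\<lambda>i. card (V i)) / (12 * real (n choose 6))"
    and "(distinct_sum {..<3} (\<lambda>i. card (V i)) - 36 * real n ^ 5) / (12 * real (n choose 6)) \<le> density F17 (blowup B17 V)"
proof -
  let ?G = "blowup B17 V"
  have fin: "finite (V i)" if "i < 3" for i using P that by (auto simp: blowup_parts_def B17_def)
  have disj: "V i \<inter> V j = {}" if "i < 3" "j < 3" "i \<noteq> j" for i j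
    using P that by (auto simp: blowup_parts_def B17_def disjoint_family_on_def)
  have vG: "verts ?G = V 0 \<union> V 1 \<union> V 2" by (auto simp: blowup_def B17_def less3)
  define \<phi> where "\<phi> x = (if x \<in> V 0 then 0 else if x \<in> V 1 then 1 else 2 :: nat)" for x
  have \<phi>V: "\<phi> x = i \<longleftrightarrow> x \<in> V i" if "i < 3" "x \<in> verts ?G" for i x
    using that disj[of 0 1] disj[of 0 2] disj[of 1 2] unfolding vG less3_cases by (auto simp: \<phi>_def)
  have \<phi>: "\<phi> \<in> verts ?G \<rightarrow> {..<3}" by (auto simp: \<phi>_def)
  have finG: "finite (verts ?G)" using fin by (simp add: vG)
  have parts: "{x \<in> verts ?G. \<phi> x = i} = V i" if "i < 3" for i
    using \<phi>V[OF that] that unfolding vG less3_cases by auto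
  have n: "card (verts ?G) = n"
    using sum_part_sizes[OF finG \<phi>] parts[of 0] parts[of 1] parts[of 2] by (simp add: n_def)
  have eG: "{x, y} \<in> edges ?G \<longleftrightarrow> x \<noteq> y \<and> \<phi> x = \<phi> y" if "x \<in> verts ?G" "y \<in> verts ?G" for x y
  proof -
    have "{x, y} \<in> edges ?G \<longleftrightarrow> x \<noteq> y \<and> (\<exists>i<3. x \<in> V i \<and> y \<in> V i)"
      unfolding blowup_B17 by (auto simp: doubleton_eq_iff)
    also have "\<dots> \<longleftrightarrow> x \<noteq> y \<and> \<phi> x = \<phi> y"
      using \<phi>V[OF _ that(1)] \<phi>V[OF _ that(2)] \<phi> that by (metis PiE lessThan_iff)
    finally show ?thesis .
  qed
  have sG: "simple_graph ?G"
    unfolding simple_graph_def using finG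
    by (auto simp: nsets_def blowup_B17)
  have E: "embs (verts ?G) (adj ?G) = embs (verts ?G) (same \<phi>)"
    by (rule embs_cong) (use eG in \<open>auto simp: adj_def\<close>)
  have dens: "density F17 ?G = card (embs (verts ?G) (same \<phi>)) / (12 * real (n choose 6))"
    using density_F17[OF sG] E n by simp
  have homs: "real (card (homs (verts ?G) (same \<phi>))) = distinct_sum {..<3} (\<lambda>i. card (V i))"
  proof -
    have "distinct_sum {..<3} (\<lambda>i. real (card {x \<in> verts ?G. \<phi> x = i})) = distinct_sum {..<3} (\<lambda>i. card (V i))"
      by (rule distinct_sum_cong) (simp add: parts)
    then show ?thesis using card_homs_same[OF finG finite_lessThan \<phi>] by simp
  qed
  have up: "real (card (embs (verts ?G) (same \<phi>))) \<le> distinct_sum {..<3} (\<lambda>i. card (V i))"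
    using embs_le_homs[OF finG, of "same \<phi>"] unfolding homs[symmetric] by simp
  have low: "distinct_sum {..<3} (\<lambda>i. card (V i)) - 36 * real n ^ 5 \<le> card (embs (verts ?G) (same \<phi>))"
    using of_nat_mono[OF homs_le_embs[OF finG, of "same \<phi>"], where 'a = real] homs n by simp
  show "density F17 ?G \<le> distinct_sum {..<3} (\<lambda>i. card (V i)) / (12 * real (n choose 6))"
    unfolding dens by (rule divide_right_mono[OF up]) simp
  show "(distinct_sum {..<3} (\<lambda>i. card (V i)) - 36 * real n ^ 5) / (12 * real (n choose 6)) \<le> density F17 ?G"
    unfolding dens by (rule divide_right_mono[OF low]) simp
qed

lemma has_blowup_density_B17:
  assumes x: "x \<in> std_simplex {..<3}"
  shows "has_blowup_density F17 B17 x (60 * distinct_sum {..<3} x)"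
  unfolding has_blowup_density_def
proof (intro allI impI)
  fix V :: "nat \<Rightarrow> nat \<Rightarrow> nat set"
  assume "(\<forall>n. blowup_parts B17 (V n)) \<and> (\<forall>i\<in>verts B17. (\<lambda>n. real (card (V n i)) / real n) \<longlonglongrightarrow> x i)"
  then have P: "\<And>n. blowup_parts B17 (V n)" and lim: "\<And>i. i < 3 \<Longrightarrow> (\<lambda>n. real (card (V n i)) / real n) \<longlonglongrightarrow> x i"
    by (auto simp: verts_B17)
  define N where "N n = card (V n 0) + card (V n 1) + card (V n 2)" for n
  let ?c = "\<lambda>n. 12 * real (N n choose 6) / real n ^ 6"
  let ?Q = "\<lambda>n. distinct_sum {..<3} (\<lambda>i. card (V n i) / real n)"
  have "(\<lambda>n. card (V n 0) / real n + card (V n 1) / real n + card (V n 2) / real n) \<longlonglongrightarrow> x 0 + x 1 + x 2"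
    by (intro tendsto_add lim) auto
  moreover have "x 0 + x 1 + x 2 = 1" using x by (simp add: std_simplex_def less3 add.assoc)
  ultimately have Nn: "(\<lambda>n. real (N n) / real n) \<longlonglongrightarrow> 1"
    by (simp add: N_def add_divide_distrib)
  have c: "?c \<longlonglongrightarrow> 1 / 60" by (rule choose6_limit[OF Nn])
  have Q: "?Q \<longlonglongrightarrow> distinct_sum {..<3} x"
    unfolding distinct_sum_def by (intro tendsto_sum tendsto_mult tendsto_power lim) auto
  have up: "(\<lambda>n. ?Q n / ?c n) \<longlonglongrightarrow> distinct_sum {..<3} x / (1 / 60)"
    by (intro tendsto_divide Q c) simp
  have low: "(\<lambda>n. (?Q n - 36 / real n * (real (N n) / real n) ^ 5) / ?c n) \<longlonglongrightarrow> (distinct_sum {..<3} x - 0 * 1 ^ 5) / (1 / 60)"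
    by (intro tendsto_divide tendsto_diff tendsto_mult tendsto_power Q c Nn lim_const_over_n) simp
  have ev: "eventually (\<lambda>n. (?Q n - 36 / real n * (real (N n) / real n) ^ 5) / ?c n \<le> density F17 (blowup B17 (V n))
    \<and> density F17 (blowup B17 (V n)) \<le> ?Q n / ?c n) sequentially"
    using eventually_gt_at_top[of 0]
  proof eventually_elim
    case (elim n)
    have r: "a / real n ^ 6 / ?c n = a / (12 * real (N n choose 6))" for a
      using elim by simp
    have e: "36 / real n * (real (N n) / real n) ^ 5 = 36 * real (N n) ^ 5 / real n ^ 6"
      by (simp add: power_divide eval_nat_numeral)
    show ?case
      using blowup_B17_embs[OF P[of n]]
      unfolding distinct_sum_scale e diff_divide_distrib[symmetric] r by (simp add: N_def)
  qed
  show "(\<lambda>n. density F17 (blowup B17 (V n))) \<longlonglongrightarrow> 60 * distinct_sum {..<3} x"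
  proof (rule tendsto_sandwich)
    show "(\<lambda>n. (?Q n - 36 / real n * (real (N n) / real n) ^ 5) / ?c n) \<longlonglongrightarrow> 60 * distinct_sum {..<3} x"
      using low by (simp add: mult.commute)
    show "(\<lambda>n. ?Q n / ?c n) \<longlonglongrightarrow> 60 * distinct_sum {..<3} x" using up by (simp add: mult.commute)
  qed (use ev in \<open>auto elim: eventually_mono\<close>)
qed

text \<open>A limit along all sequences of blowups determines its value only if there is such a sequence.\<close>

lemma blowup_sequence_exists:
  assumes x: "x \<in> std_simplex {..<3}"
  obtains V :: "nat \<Rightarrow> nat \<Rightarrow> nat set" where "\<And>n. blowup_parts B17 (V n)"
    "\<And>i. i < 3 \<Longrightarrow> (\<lambda>n. real (card (V n i)) / real n) \<longlonglongrightarrow> x i"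
proof
  (* residue classes modulo 3 keep the parts disjoint *)
  define V where "V n i = (\<lambda>k. 3 * k + i) ` {..<nat \<lfloor>x i * real n\<rfloor>}" for n i :: nat
  show "blowup_parts B17 (V n)" for n
  proof -
    have "V n i \<inter> V n j = {}" if "i < 3" "j < 3" "i \<noteq> j" for i j
    proof -
      have "3 * k + i \<noteq> 3 * l + j" for k l
        using that by (metis mod_less mod_mult_self4)
      then show ?thesis by (auto simp: V_def)
    qed
    then show ?thesis by (auto simp: blowup_parts_def verts_B17 disjoint_family_on_def V_def)
  qed
  fix i :: nat assume "i < 3"
  then have xi: "x i \<ge> 0" using x by (auto simp: std_simplex_def)
  have card: "card (V n i) = nat \<lfloor>x i * real n\<rfloor>" for n
    unfolding V_def by (subst card_image) (auto simp: inj_on_def)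
  have low: "(\<lambda>n. x i - 1 / real n) \<longlonglongrightarrow> x i - 0" by (intro tendsto_intros lim_const_over_n)
  have ev: "eventually (\<lambda>n. x i - 1 / real n \<le> card (V n i) / real n \<and> card (V n i) / real n \<le> x i) sequentially"
    using eventually_gt_at_top[of 0]
  proof eventually_elim
    case (elim n)
    have "x i * real n - 1 \<le> card (V n i)" "card (V n i) \<le> x i * real n"
      unfolding card using xi by (linarith, simp add: of_nat_floor)
    then show ?case
      using elim divide_right_mono[of "x i * real n - 1" "card (V n i)" "real n"]
        divide_right_mono[of "card (V n i)" "x i * real n" "real n"]
      by (simp add: diff_divide_distrib)
  qed
  show "(\<lambda>n. real (card (V n i)) / real n) \<longlonglongrightarrow> x i"
    by (rule tendsto_sandwich[OF _ _ low[simplified] tendsto_const]) (use ev in \<open>auto elim: eventually_mono\<close>)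
qed

lemma blowup_density_B17:
  assumes x: "x \<in> std_simplex {..<3}"
  shows "blowup_density F17 B17 x = 60 * distinct_sum {..<3} x"
  unfolding blowup_density_def
proof (rule the_equality)
  show "has_blowup_density F17 B17 x (60 * distinct_sum {..<3} x)" by (rule has_blowup_density_B17[OF x])
  fix L assume L: "has_blowup_density F17 B17 x L"
  obtain V :: "nat \<Rightarrow> nat \<Rightarrow> nat set" where V: "\<And>n. blowup_parts B17 (V n)"
    "\<And>i. i < 3 \<Longrightarrow> (\<lambda>n. real (card (V n i)) / real n) \<longlonglongrightarrow> x i"
    using blowup_sequence_exists[OF x] by blast
  have "(\<lambda>n. density F17 (blowup B17 (V n))) \<longlonglongrightarrow> L"
    using L V unfolding has_blowup_density_def by (auto simp: verts_B17)
  moreover have "(\<lambda>n. density F17 (blowup B17 (V n))) \<longlonglongrightarrow> 60 * distinct_sum {..<3} x"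
    using has_blowup_density_B17[OF x] V unfolding has_blowup_density_def by (auto simp: verts_B17)
  ultimately show "L = 60 * distinct_sum {..<3} x" by (rule LIMSEQ_unique)
qed

lemma unique_maximiser: "unique_blowup_maximiser F17 B17 (\<lambda>i\<in>{..<3}. 1 / 3)"
proof -
  let ?u = "\<lambda>i\<in>{..<3::nat}. 1 / 3 :: real"
  have u: "?u \<in> std_simplex {..<3}" by (auto simp: std_simplex_def less3)
  have val: "blowup_density F17 B17 ?u = 60 * (2 / 243)"
    unfolding blowup_density_B17[OF u] distinct_sum_three by simp
  have bound: "blowup_density F17 B17 y \<le> 60 * (2 / 243 - (y i - 1 / 3)\<^sup>2 / 162)"
    if y: "y \<in> std_simplex {..<3}" and i: "i < 3" for y i
  proof -
    have "y 0 + y 1 + y 2 = 1" using y by (simp add: std_simplex_def less3 add.assoc)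
    moreover have "\<And>i. i < 3 \<Longrightarrow> 0 \<le> y i" using y by (auto simp: std_simplex_def)
    ultimately have "distinct_sum {..<3} y \<le> 2 / 243 * 1 ^ 6 - (y i - 1 / 3)\<^sup>2 * 1 ^ 4 / 162"
      using i by (intro three_part_stability_scaled) auto
    then show ?thesis unfolding blowup_density_B17[OF y] by simp
  qed
  have max: "blowup_maximiser F17 B17 ?u"
    unfolding blowup_maximiser_def is_arg_max_def verts_B17
  proof (intro conjI notI u)
    assume "\<exists>y. y \<in> std_simplex {..<3} \<and> blowup_density F17 B17 ?u < blowup_density F17 B17 y"
    then obtain y where y: "y \<in> std_simplex {..<3}" "blowup_density F17 B17 ?u < blowup_density F17 B17 y" by blast
    have False if "b \<le> 60 * (2 / 243 - t / 162)" "60 * (2 / 243) < b" "0 \<le> t" for b t :: real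
      using that by simp
    from this[OF bound[OF y(1) zero_less_numeral] y(2)[unfolded val]] show False by simp
  qed
  have "\<exists>\<pi>\<in>automorphisms B17. \<forall>i\<in>verts B17. y i = ?u (\<pi> i)" if "blowup_maximiser F17 B17 y" for y
  proof (rule bexI[of _ id])
    show "id \<in> automorphisms B17" by (simp add: automorphisms_def is_iso_def)
    have y: "y \<in> std_simplex {..<3}" "\<not> blowup_density F17 B17 y < blowup_density F17 B17 ?u"
      using that u unfolding blowup_maximiser_def is_arg_max_def verts_B17 by auto
    show "\<forall>i\<in>verts B17. y i = ?u (id i)"
    proof
      fix i assume "i \<in> verts B17"
      then have i: "i < 3" by (simp add: verts_B17)
      have "t \<le> 0" if "b \<le> 60 * (2 / 243 - t / 162)" "\<not> b < 60 * (2 / 243)" for b t :: real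
        using that by simp
      from this[OF bound[OF y(1) i] y(2)[unfolded val]] have "(y i - 1 / 3)\<^sup>2 \<le> 0" .
      then show "y i = ?u (id i)" using i by simp
    qed
  qed
  then show ?thesis using max by (simp add: unique_blowup_maximiser_def)
qed

theorem theorem3p9:
  shows "convergent (max_density F17) \<and> inducibility F17 = 40 / 81 \<and>
    perfectly_stable F17 B17 \<and>
    (\<forall>x\<in>std_simplex (verts B17). has_blowup_density F17 B17 x (blowup_density F17 B17 x)) \<and>
    unique_blowup_maximiser F17 B17 (\<lambda>i\<in>{..<3}. 1 / 3)"
proof (intro conjI ballI)
  show "convergent (max_density F17)" using max_density_limit by (rule convergentI)
  show "inducibility F17 = 40 / 81" unfolding inducibility_def by (rule limI[OF max_density_limit])
  show "perfectly_stable F17 B17" by (rule perfectly_stable_F17)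
  show "has_blowup_density F17 B17 x (blowup_density F17 B17 x)" if "x \<in> std_simplex (verts B17)" for x
    using that has_blowup_density_B17 blowup_density_B17 by (simp add: verts_B17)
  show "unique_blowup_maximiser F17 B17 (\<lambda>i\<in>{..<3}. 1 / 3)" by (rule unique_maximiser)
qed

end
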